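(* For $n\ge 2$ let $C_n$ be a uniformly random Cayley tree of order $n$, i.e. a tree chosen uniformly at random among all (unrooted) labelled trees on the vertex set $\{1,2,\ldots,n\}$. Then there exist constants $\mu$ with $0.5177\le \mu<0.5178$ and $\sigma>0$ such that, as $n\to\infty$, $$\mathbb{E}\,\gamma_{\rm pr}(C_n)=\mu\, n+o(\sqrt n)\qquad\text{and}\qquad \frac{\gamma_{\rm pr}(C_n)-\mu\, n}{\sigma\sqrt n}\ \overset{\mathrm d}{\to}\ \mathcal{N}(0,1),$$ where $\overset{\mathrm d}{\to}$ denotes convergence in distribution.
   Context: A paired dominating set of a graph $G$ without isolated vertices is a set $S\subseteq V(G)$ such that every vertex of $V(G)\setminus S$ is adjacent to some vertex of $S$ and the induced subgraph $G[S]$ contains a perfect matching (not necessarily induced). The paired domination number $\gamma_{\rm pr}(G)$ is the minimum cardinality of a paired dominating set of $G$. *)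

theory Defs
  imports
    "HOL-Probability.Probability"
    "HOL-Library.Landau_Symbols"
    "Graph_Theory.Digraph"
    "Graph_Theory.Pair_Digraph"
    "Graph_Theory.Digraph_Component"
begin

(* Undirected simple graphs are the finite, loop-free, symmetric digraphs
   ("graph" and "pair_graph" in Graph_Theory): the edge {u, v} is the pair of
   arcs (u, v), (v, u). The definitions for a "pre_digraph" are meant for these. *)

definition edges :: "('a, 'b) pre_digraph \<Rightarrow> 'a set set" where
  "edges G = {{u, v} | u v. (u, v) \<in> arcs_ends G}"

definition perfect_matching :: "('a, 'b) pre_digraph \<Rightarrow> 'a set set \<Rightarrow> bool" where
  "perfect_matching G M \<longleftrightarrow> M \<subseteq> edges G \<and> (\<forall>v \<in> verts G. \<exists>!e. e \<in> M \<and> v \<in> e)"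

definition paired_dominating_set :: "('a, 'b) pre_digraph \<Rightarrow> 'a set \<Rightarrow> bool" where
  "paired_dominating_set G S \<longleftrightarrow>
     S \<subseteq> verts G \<and>
     (\<forall>v \<in> verts G - S. \<exists>u \<in> S. (v, u) \<in> arcs_ends G) \<and>
     (\<exists>M. perfect_matching (induce_subgraph G S) M)"

(* Unspecified if G has an isolated vertex, since no paired dominating set exists then. *)
definition paired_domination_number :: "('a, 'b) pre_digraph \<Rightarrow> nat" where
  "paired_domination_number G = (LEAST k. \<exists>S. paired_dominating_set G S \<and> card S = k)"

(* "Digraph_Component.tree" cannot be used: its cycles include the closed walks
   u, v, u that run along an edge and back, so no symmetric digraph with an edge is a
   tree. A cycle of an undirected graph is a cycle with at least three arcs. *)
definition labelled_trees :: "nat \<Rightarrow> nat pair_pre_digraph set" where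
  "labelled_trees n =
     {T. pverts T = {1..n} \<and> pair_graph T \<and> Digraph_Component.connected (with_proj T) \<and>
         \<not> (\<exists>p. pre_digraph.cycle (with_proj T) p \<and> length p \<ge> 3)}"

lemma finite_labelled_trees: "finite (labelled_trees n)"
proof -
  have "labelled_trees n \<subseteq>
      (\<lambda>E. \<lparr>pverts = {1..n}, parcs = E\<rparr>) ` Pow ({1..n} \<times> {1..n})"
  proof
    fix T assume T: "T \<in> labelled_trees n"
    then have "pair_graph T" and v: "pverts T = {1..n}" by (auto simp: labelled_trees_def)
    then interpret pair_graph T by simp
    have "parcs T \<subseteq> {1..n} \<times> {1..n}"
      using arc_fst_in_verts arc_snd_in_verts v by force
    then show "T \<in> (\<lambda>E. \<lparr>pverts = {1..n}, parcs = E\<rparr>) ` Pow ({1..n} \<times> {1..n})"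
      using v by (intro image_eqI[where x = "parcs T"]) auto
  qed
  then show ?thesis by (rule finite_subset) auto
qed

lemma labelled_trees_nonempty:
  assumes "n \<ge> 1"
  shows "labelled_trees n \<noteq> {}"
proof -
  define T where "T = \<lparr>pverts = {1..n}, parcs = {1} \<times> {2..n} \<union> {2..n} \<times> {1}\<rparr>"
  have v: "pverts T = {1..n}" and a: "parcs T = {1} \<times> {2..n} \<union> {2..n} \<times> {1}"
    by (simp_all add: T_def)
  have "pair_graph T"
    using assms by unfold_locales (auto simp: v a symmetric_def sym_def)
  then interpret pair_graph T .
  have conn: "Digraph_Component.connected (with_proj T)"
  proof -
    have m: "parcs (mk_symmetric (with_proj T)) = parcs T"
      unfolding mk_symmetric_def using a by force
    have mv: "pverts (mk_symmetric (with_proj T)) = {1..n}"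
      by (simp add: mk_symmetric_def v)
    have r1: "(1, y) \<in> rtrancl_on {1..n} (parcs T) \<and> (y, 1) \<in> rtrancl_on {1..n} (parcs T)"
      if "y \<in> {1..n}" for y
    proof (cases "y = 1")
      case True
      then show ?thesis using that by auto
    next
      case False
      then have "(1, y) \<in> parcs T" "(y, 1) \<in> parcs T" using that a by auto
      moreover have "1 \<in> {1..n}" using assms by simp
      ultimately show ?thesis
        using that by (meson rtrancl_on.rtrancl_on_refl rtrancl_on.rtrancl_on_into_rtrancl_on)
    qed
    have r2: "(u, w) \<in> rtrancl_on {1..n} (parcs T)" if "u \<in> {1..n}" "w \<in> {1..n}" for u w
      using r1[OF that(1)] r1[OF that(2)] rtrancl_on_trans by metis
    show ?thesis
      unfolding connected_def strongly_connected_def reachable_def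
      unfolding with_proj_simps m mv using assms r2 by simp
  qed
  have "\<not> pre_digraph.cycle (with_proj T) p" if len: "length p \<ge> 3" for p
  proof
    assume "pre_digraph.cycle (with_proj T) p"
    then obtain u where w: "awalk u p u" and d: "distinct (tl (pawalk_verts u p))"
      by (auto simp: cycle_def)
    obtain e1 e2 e3 q where p: "p = e1 # e2 # e3 # q"
      using len by (metis Suc_le_length_iff numeral_3_eq_3)
    have arcs: "e1 \<in> parcs T" "e2 \<in> parcs T" "e3 \<in> parcs T"
      and c: "fst e1 = u" "fst e2 = snd e1" "fst e3 = snd e2" "pcas (snd e3) q u"
      using w by (auto simp: awalk_def p)
    have vs: "pawalk_verts x q = x # map snd q" if "pcas x q y" for x y
      using that by (induction q arbitrary: x) auto
    have last: "last (x # map snd q) = y" if "pcas x q y" for x y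
      using that by (induction q arbitrary: x) auto
    have d': "distinct (snd e1 # snd e2 # snd e3 # map snd q)"
      using d c vs[OF c(4)] by (simp add: p)
    have l: "u \<in> set (snd e3 # map snd q)"
      using last[OF c(4)] by (metis last_in_set list.distinct(1))
    show False
      using arcs c d' l unfolding a by (cases e1; cases e2; cases e3) (auto simp del: list.set_map set_map)
  qed
  then have "T \<in> labelled_trees n"
    using v conn \<open>pair_graph T\<close> by (auto simp: labelled_trees_def)
  then show ?thesis by auto
qed

definition random_cayley_tree :: "nat \<Rightarrow> nat pair_pre_digraph pmf" where
  "random_cayley_tree n = pmf_of_set (labelled_trees n)"

end

(* Root a tree and call a vertex of type c if it has a child of type b; otherwise b if it has a
   child of type L; otherwise d if it has a child of type c; otherwise L. If k vertices have
   type b, the paired domination number is 2k or 2k+2, since the least sizes of the matchings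
   that dominate a rooted tree up to a prescribed behaviour at the root depend only on k and
   the type of the root.

   Hence it suffices to study the number K_n of vertices of type b. The exponential generating
   functions L, B, C, D of rooted trees by root type, with u marking type b, satisfy
     L = z e^D,  D = L (e^C - 1),  B = u L e^C (e^L - 1),  C = L e^(L+C) (e^B - 1).
   In the parameter X = L, the function C becomes an analytic fixpoint c(X,u), and z = X e^(-D).
   Lagrange inversion turns the coefficients of F = L + B + C + D into a contour integral of
   F_X e^(n D) / X^n over the circle |X| = x0, where F(x0,1) = 1 is the critical point. The two
   lowest terms of D have coprime degrees, so the integrand concentrates at X = x0 and
   dominated convergence after scaling by sqrt n gives a Gaussian integral. It follows that
   E exp(i t (K_n - B0 n)/sqrt n) tends to exp(-V t^2) and, as the limit also exists for imaginary
   t, that second moments are bounded. This yields the mean and, by Levy's theorem, the limit law. *)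

theory Submission
  imports Defs "HOL-Complex_Analysis.Complex_Analysis" "HOL-Real_Asymp.Real_Asymp"
begin

subsection \<open>Matchings in rooted trees\<close>

text \<open>As a function of \<open>z\<close>, \<open>F\<close> has a branch point where
  \<open>F = 1\<close>, because \<open>z e^F = F\<close> (the case \<open>u = 1\<close>) is critical
  there. In the parameter \<open>X\<close> all functions continue holomorphically beyond that point,
  and the branch point becomes a saddle of \<open>e^D / X\<close>. When
  \<open>z e^F = F - B (1 - 1/u)\<close> is differentiated at \<open>F = 1\<close>,
  \<open>u = 1\<close>, the derivative of \<open>F\<close> cancels. What remains is
  \<open>x0 D_X = 1\<close>, the saddle equation, and \<open>D_u = B0\<close>, which makes
  \<open>B0\<close> the mean. The circle stays fixed while \<open>u\<close> varies: the saddle moves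
  by the order of \<open>1 / sqrt n\<close> only, and this shows up as the mixed term of the
  limiting quadratic form. Nonnegativity of coefficients enters as an inequality between values,
  \<open>majorant\<close>, so that the analysis runs on functions of two complex variables instead
  of their double series. The two lowest terms \<open>u X^4\<close> and \<open>u X^5 / 2\<close> of
  \<open>D\<close> also yield \<open>V > 0\<close>: the exponent vectors (4, 1) and (5, 1) are
  linearly independent, so the quadratic form in both angles is definite.\<close>

definition matching_in :: "('a \<times> 'a) set \<Rightarrow> 'a set set \<Rightarrow> bool" where
  "matching_in E M \<longleftrightarrow> M \<subseteq> (\<lambda>(u, v). {u, v}) ` E \<and> pairwise disjnt M"

definition dominated :: "('a \<times> 'a) set \<Rightarrow> 'a set \<Rightarrow> 'a \<Rightarrow> bool" where
  "dominated E S v \<longleftrightarrow> v \<in> S \<or> (\<exists>u\<in>S. (v, u) \<in> E)"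

text \<open>The matching \<open>M\<close> stands for the paired dominating set \<open>\<Union>M\<close>. In \<open>sizesB\<close> the root is to be paired
  with its parent, in \<open>sizesD\<close> it may be left to its parent to dominate.\<close>

definition sizesA :: "'a set \<Rightarrow> ('a \<times> 'a) set \<Rightarrow> 'a \<Rightarrow> nat set" where
  "sizesA V E r = {card M | M. matching_in E M \<and> r \<in> \<Union>M \<and> (\<forall>v\<in>V. dominated E (\<Union>M) v)}"

definition sizesB :: "'a set \<Rightarrow> ('a \<times> 'a) set \<Rightarrow> 'a \<Rightarrow> nat set" where
  "sizesB V E r = {card M | M. matching_in E M \<and> r \<notin> \<Union>M \<and> (\<forall>v\<in>V. dominated E (insert r (\<Union>M)) v)}"

definition sizesC :: "'a set \<Rightarrow> ('a \<times> 'a) set \<Rightarrow> 'a \<Rightarrow> nat set" where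
  "sizesC V E r = {card M | M. matching_in E M \<and> r \<notin> \<Union>M \<and> (\<forall>v\<in>V. dominated E (\<Union>M) v)}"

definition sizesD :: "'a set \<Rightarrow> ('a \<times> 'a) set \<Rightarrow> 'a \<Rightarrow> nat set" where
  "sizesD V E r = {card M | M. matching_in E M \<and> r \<notin> \<Union>M \<and> (\<forall>v\<in>V - {r}. dominated E (\<Union>M) v)}"

lemma sizesA_I: "matching_in E M \<Longrightarrow> r \<in> \<Union>M \<Longrightarrow> \<forall>v\<in>V. dominated E (\<Union>M) v \<Longrightarrow> card M = x \<Longrightarrow> x \<in> sizesA V E r"
  and sizesB_I: "matching_in E M \<Longrightarrow> r \<notin> \<Union>M \<Longrightarrow> \<forall>v\<in>V. dominated E (insert r (\<Union>M)) v \<Longrightarrow> card M = x \<Longrightarrow> x \<in> sizesB V E r"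
  and sizesC_I: "matching_in E M \<Longrightarrow> r \<notin> \<Union>M \<Longrightarrow> \<forall>v\<in>V. dominated E (\<Union>M) v \<Longrightarrow> card M = x \<Longrightarrow> x \<in> sizesC V E r"
  and sizesD_I: "matching_in E M \<Longrightarrow> r \<notin> \<Union>M \<Longrightarrow> \<forall>v\<in>V - {r}. dominated E (\<Union>M) v \<Longrightarrow> card M = x \<Longrightarrow> x \<in> sizesD V E r"
  unfolding sizesA_def sizesB_def sizesC_def sizesD_def by auto

lemma matching_in_finite:
  assumes "finite E" "matching_in E M"
  shows "finite M"
  using assms unfolding matching_in_def by (meson finite_imageI finite_subset)

section \<open>Joining two rooted trees by an edge between their roots\<close>

locale graft =
  fixes V1 V2 :: "'a set" and E1 E2 :: "('a \<times> 'a) set" and r s :: 'a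
  assumes fin: "finite V1" "finite V2" and disj: "V1 \<inter> V2 = {}"
    and sub: "E1 \<subseteq> V1 \<times> V1" "E2 \<subseteq> V2 \<times> V2"
    and rs: "r \<in> V1" "s \<in> V2"
begin

definition E where "E = E1 \<union> E2 \<union> {(r, s), (s, r)}"

lemma finE: "finite E1" "finite E2" "finite E"
  using finite_subset[OF sub(1)] finite_subset[OF sub(2)] fin unfolding E_def by auto

lemma Union_sub:
  "matching_in E1 M \<Longrightarrow> \<Union>M \<subseteq> V1" "matching_in E2 M \<Longrightarrow> \<Union>M \<subseteq> V2"
  using sub unfolding matching_in_def by fast+

lemma nonempty_edge:
  "matching_in E1 M \<Longrightarrow> e \<in> M \<Longrightarrow> e \<noteq> {}" "matching_in E2 M \<Longrightarrow> e \<in> M \<Longrightarrow> e \<noteq> {}"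
  unfolding matching_in_def by fastforce+

lemma disjoint_matchings:
  assumes "matching_in E1 M1" "matching_in E2 M2"
  shows "M1 \<inter> M2 = {}"
  using Union_sub(1)[OF assms(1)] Union_sub(2)[OF assms(2)] nonempty_edge(1)[OF assms(1)] disj by blast

lemma matching_union:
  assumes "matching_in E1 M1" "matching_in E2 M2"
  shows "matching_in E (M1 \<union> M2)" "card (M1 \<union> M2) = card M1 + card M2"
proof -
  have "disjnt e f" if "e \<in> M1" "f \<in> M2" for e f
    using Union_sub(1)[OF assms(1)] Union_sub(2)[OF assms(2)] that disj unfolding disjnt_def by blast
  then have "pairwise disjnt (M1 \<union> M2)"
    using assms unfolding matching_in_def pairwise_def by (metis Un_iff disjnt_sym)
  then show "matching_in E (M1 \<union> M2)"
    using assms unfolding matching_in_def E_def by blast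
  show "card (M1 \<union> M2) = card M1 + card M2"
    using assms finE disjoint_matchings[OF assms] by (intro card_Un_disjoint) (auto intro: matching_in_finite)
qed

lemma matching_union_edge:
  assumes "matching_in E1 M1" "matching_in E2 M2" "r \<notin> \<Union>M1" "s \<notin> \<Union>M2"
  shows "matching_in E (insert {r, s} (M1 \<union> M2))"
    "card (insert {r, s} (M1 \<union> M2)) = card M1 + card M2 + 1"
proof -
  have "s \<notin> \<Union>M1" "r \<notin> \<Union>M2"
    using Union_sub(1)[OF assms(1)] Union_sub(2)[OF assms(2)] disj rs by blast+
  then have d: "disjnt {r, s} e" if "e \<in> M1 \<union> M2" for e
    using that assms unfolding disjnt_def by blast
  have "{r, s} \<in> (\<lambda>(u, v). {u, v}) ` E" unfolding E_def by force
  then show "matching_in E (insert {r, s} (M1 \<union> M2))"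
    using matching_union(1)[OF assms(1,2)] d unfolding matching_in_def
    by (auto simp: pairwise_insert disjnt_sym)
  have "{r, s} \<notin> M1 \<union> M2" using assms(3,4) by blast
  then show "card (insert {r, s} (M1 \<union> M2)) = card M1 + card M2 + 1"
    using matching_union(2)[OF assms(1,2)] assms(1,2) finE by (simp add: matching_in_finite)
qed

lemma matching_split:
  assumes "matching_in E M"
  obtains M1 M2 where "matching_in E1 M1" "matching_in E2 M2" "M = M1 \<union> M2"
  | M1 M2 where "matching_in E1 M1" "matching_in E2 M2" "M = insert {r, s} (M1 \<union> M2)"
      "r \<notin> \<Union>M1" "s \<notin> \<Union>M2"
proof -
  let ?i = "\<lambda>(u, v). {u, v}"
  define M1 where "M1 = M \<inter> ?i ` E1"
  define M2 where "M2 = M \<inter> ?i ` E2"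
  have m: "matching_in E1 M1" "matching_in E2 M2"
    using assms unfolding matching_in_def M1_def M2_def by (auto intro: pairwise_subset)
  have "?i ` E = ?i ` E1 \<union> ?i ` E2 \<union> {{r, s}}" unfolding E_def by (auto simp: insert_commute)
  then have M: "M1 \<union> M2 \<subseteq> M" "M \<subseteq> insert {r, s} (M1 \<union> M2)"
    using assms unfolding matching_in_def M1_def M2_def by auto
  show thesis
  proof (cases "{r, s} \<in> M")
    case False
    then have "M = M1 \<union> M2" using M by auto
    then show thesis using that(1) m by blast
  next
    case True
    then have eq: "M = insert {r, s} (M1 \<union> M2)" using M by auto
    have nin: "{r, s} \<notin> M1 \<union> M2"
      using Union_sub(1)[OF m(1)] Union_sub(2)[OF m(2)] disj rs by blast
    have "disjnt e {r, s}" if "e \<in> M1 \<union> M2" for e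
      using assms True that nin M unfolding matching_in_def pairwise_def by (metis subsetD)
    then have "r \<notin> \<Union>M1" "s \<notin> \<Union>M2" unfolding disjnt_def by blast+
    then show thesis using that(2) m eq by blast
  qed
qed

lemma dominated_insert [simp]: "dominated F (insert v S) v"
  by (simp add: dominated_def)

text \<open>Only the new edge crosses between \<open>V1\<close> and \<open>V2\<close>, so domination
  passes across only between \<open>r\<close> and \<open>s\<close>.\<close>

lemma dominated_union:
  assumes "S1 \<subseteq> V1" "S2 \<subseteq> V2"
  shows "v \<in> V1 \<Longrightarrow> dominated E (S1 \<union> S2) v \<longleftrightarrow> dominated E1 S1 v \<or> (v = r \<and> s \<in> S2)"
    and "v \<in> V2 \<Longrightarrow> dominated E (S1 \<union> S2) v \<longleftrightarrow> dominated E2 S2 v \<or> (v = s \<and> r \<in> S1)"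
proof -
  have n: "r \<notin> V2" "s \<notin> V1" "r \<notin> S2" "s \<notin> S1" "\<And>v. v \<in> V1 \<Longrightarrow> v \<notin> S2" "\<And>v. v \<in> V2 \<Longrightarrow> v \<notin> S1"
    "\<And>v w. (v, w) \<in> E1 \<Longrightarrow> v \<in> V1 \<and> w \<in> V1" "\<And>v w. (v, w) \<in> E2 \<Longrightarrow> v \<in> V2 \<and> w \<in> V2"
    using assms sub disj rs by auto
  have e1: "(v, u) \<in> E \<longleftrightarrow> (v, u) \<in> E1 \<or> (v = r \<and> u = s)" if "v \<in> V1" for u
    using n(2,8) that disj unfolding E_def by auto
  have e2: "(v, u) \<in> E \<longleftrightarrow> (v, u) \<in> E2 \<or> (v = s \<and> u = r)" if "v \<in> V2" for u
    using n(1,7) that disj unfolding E_def by auto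
  show "v \<in> V1 \<Longrightarrow> dominated E (S1 \<union> S2) v \<longleftrightarrow> dominated E1 S1 v \<or> (v = r \<and> s \<in> S2)"
    using n(4,5,7) by (auto simp: dominated_def e1)
  show "v \<in> V2 \<Longrightarrow> dominated E (S1 \<union> S2) v \<longleftrightarrow> dominated E2 S2 v \<or> (v = s \<and> r \<in> S1)"
    using n(3,6,8) by (auto simp: dominated_def e2)
qed

lemma all_dominated_union:
  assumes "S1 \<subseteq> V1" "S2 \<subseteq> V2"
  shows "(\<forall>v\<in>V1 \<union> V2. dominated E (S1 \<union> S2) v) \<longleftrightarrow>
      (\<forall>v\<in>V1. dominated E1 S1 v \<or> (v = r \<and> s \<in> S2)) \<and>
      (\<forall>v\<in>V2. dominated E2 S2 v \<or> (v = s \<and> r \<in> S1))"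
    and "(\<forall>v\<in>V1 \<union> V2 - {r}. dominated E (S1 \<union> S2) v) \<longleftrightarrow>
      (\<forall>v\<in>V1 - {r}. dominated E1 S1 v) \<and>
      (\<forall>v\<in>V2. dominated E2 S2 v \<or> (v = s \<and> r \<in> S1))"
proof -
  show "(\<forall>v\<in>V1 \<union> V2. dominated E (S1 \<union> S2) v) \<longleftrightarrow>
      (\<forall>v\<in>V1. dominated E1 S1 v \<or> (v = r \<and> s \<in> S2)) \<and>
      (\<forall>v\<in>V2. dominated E2 S2 v \<or> (v = s \<and> r \<in> S1))"
    using dominated_union[OF assms] by blast
  have "r \<notin> V2" using disj rs by blast
  then show "(\<forall>v\<in>V1 \<union> V2 - {r}. dominated E (S1 \<union> S2) v) \<longleftrightarrow>
      (\<forall>v\<in>V1 - {r}. dominated E1 S1 v) \<and>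
      (\<forall>v\<in>V2. dominated E2 S2 v \<or> (v = s \<and> r \<in> S1))"
    using dominated_union[OF assms] by blast
qed

lemma no_cross:
  "matching_in E1 M \<Longrightarrow> s \<notin> \<Union>M" "matching_in E2 M \<Longrightarrow> r \<notin> \<Union>M"
  using Union_sub disj rs by blast+

text \<open>Either \<open>r\<close> is matched inside \<open>V1\<close>; then it dominates
  \<open>s\<close>, and the second tree may be of kind A or D. Or \<open>r\<close> is matched along
  the new edge; then each tree sees its root as paired from outside, which is kind B on both sides
  plus one edge.\<close>

lemma sizesA_graft:
  "sizesA (V1 \<union> V2) E r =
    {a + m | a m. a \<in> sizesA V1 E1 r \<and> m \<in> sizesA V2 E2 s \<union> sizesD V2 E2 s} \<union>
    {b + c + 1 | b c. b \<in> sizesB V1 E1 r \<and> c \<in> sizesB V2 E2 s}" (is "?L = ?R1 \<union> ?R2")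
proof (intro equalityI subsetI)
  fix x assume "x \<in> ?L"
  then obtain M where M: "matching_in E M" "r \<in> \<Union>M" "\<forall>v\<in>V1 \<union> V2. dominated E (\<Union>M) v" "x = card M"
    unfolding sizesA_def by blast
  from M(1) show "x \<in> ?R1 \<union> ?R2"
  proof (cases rule: matching_split)
    case (1 M1 M2)
    note sub = Union_sub(1)[OF 1(1)] Union_sub(2)[OF 1(2)]
    have r: "r \<in> \<Union>M1" using M(2) no_cross(2)[OF 1(2)] 1(3) by auto
    have d: "\<forall>v\<in>V1. dominated E1 (\<Union>M1) v \<or> (v = r \<and> s \<in> \<Union>M2)"
      "\<forall>v\<in>V2. dominated E2 (\<Union>M2) v \<or> (v = s \<and> r \<in> \<Union>M1)"
      using M(3) all_dominated_union(1)[OF sub] unfolding 1(3) Union_Un_distrib by blast+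
    have "card M1 \<in> sizesA V1 E1 r"
      using d(1) r 1(1) unfolding sizesA_def dominated_def by blast
    moreover have "card M2 \<in> sizesA V2 E2 s \<union> sizesD V2 E2 s"
    proof (cases "s \<in> \<Union>M2")
      case True
      then show ?thesis using d(2) 1(2) unfolding sizesA_def dominated_def by blast
    next
      case False
      then show ?thesis using d(2) 1(2) unfolding sizesD_def by blast
    qed
    ultimately show ?thesis using M(4) matching_union(2)[OF 1(1,2)] 1(3) by blast
  next
    case (2 M1 M2)
    have sub: "insert r (\<Union>M1) \<subseteq> V1" "insert s (\<Union>M2) \<subseteq> V2"
      using Union_sub(1)[OF 2(1)] Union_sub(2)[OF 2(2)] rs by auto
    have eq: "\<Union>M = insert r (\<Union>M1) \<union> insert s (\<Union>M2)" using 2(3) by auto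
    have d: "\<forall>v\<in>V1. dominated E1 (insert r (\<Union>M1)) v" "\<forall>v\<in>V2. dominated E2 (insert s (\<Union>M2)) v"
      using M(3)[unfolded eq all_dominated_union(1)[OF sub]] by auto
    have "card M1 \<in> sizesB V1 E1 r" "card M2 \<in> sizesB V2 E2 s"
      using d 2 unfolding sizesB_def by blast+
    then show ?thesis using M(4) matching_union_edge(2)[OF 2(1,2,4,5)] 2(3) by auto
  qed
next
  fix x assume "x \<in> ?R1 \<union> ?R2"
  then show "x \<in> ?L"
  proof
    assume "x \<in> ?R1"
    then obtain M1 M2 where x: "x = card M1 + card M2" and M1: "matching_in E1 M1" "r \<in> \<Union>M1" "\<forall>v\<in>V1. dominated E1 (\<Union>M1) v"
      and M2: "matching_in E2 M2" "\<forall>v\<in>V2 - {s}. dominated E2 (\<Union>M2) v"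
      unfolding sizesA_def sizesD_def by blast
    have "\<forall>v\<in>V1 \<union> V2. dominated E (\<Union>(M1 \<union> M2)) v"
      unfolding Union_Un_distrib all_dominated_union(1)[OF Union_sub(1)[OF M1(1)] Union_sub(2)[OF M2(1)]]
      using M1 M2 by blast
    moreover have "r \<in> \<Union>(M1 \<union> M2)" using M1(2) by auto
    ultimately show "x \<in> ?L"
      by (intro sizesA_I[OF matching_union(1)[OF M1(1) M2(1)]]) (simp_all only: matching_union(2)[OF M1(1) M2(1)] x)
  next
    assume "x \<in> ?R2"
    then obtain M1 M2 where x: "x = card M1 + card M2 + 1"
      and M1: "matching_in E1 M1" "r \<notin> \<Union>M1" "\<forall>v\<in>V1. dominated E1 (insert r (\<Union>M1)) v"
      and M2: "matching_in E2 M2" "s \<notin> \<Union>M2" "\<forall>v\<in>V2. dominated E2 (insert s (\<Union>M2)) v"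
      unfolding sizesB_def by blast
    have sub: "insert r (\<Union>M1) \<subseteq> V1" "insert s (\<Union>M2) \<subseteq> V2"
      using Union_sub(1)[OF M1(1)] Union_sub(2)[OF M2(1)] rs by auto
    have eq: "\<Union>(insert {r, s} (M1 \<union> M2)) = insert r (\<Union>M1) \<union> insert s (\<Union>M2)" by auto
    have "\<forall>v\<in>V1 \<union> V2. dominated E (\<Union>(insert {r, s} (M1 \<union> M2))) v"
      unfolding eq all_dominated_union(1)[OF sub] using M1 M2 by blast
    moreover have "r \<in> \<Union>(insert {r, s} (M1 \<union> M2))" by auto
    ultimately show "x \<in> ?L"
      by (intro sizesA_I[OF matching_union_edge(1)[OF M1(1) M2(1) M1(2) M2(2)]])
        (simp_all only: matching_union_edge(2)[OF M1(1) M2(1) M1(2) M2(2)] x)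
  qed
qed

lemma unsplit_edge:
  assumes "matching_in E M" "r \<notin> \<Union>M"
  obtains M1 M2 where "matching_in E1 M1" "matching_in E2 M2" "M = M1 \<union> M2" "r \<notin> \<Union>M1"
    "card M = card M1 + card M2" "\<Union>M1 \<subseteq> V1" "\<Union>M2 \<subseteq> V2"
  using assms(1)
proof (cases rule: matching_split)
  case (1 M1 M2)
  then show thesis using that[OF 1] assms(2) matching_union(2)[OF 1(1,2)] Union_sub by auto
next
  case (2 M1 M2)
  then show thesis using assms(2) by auto
qed

text \<open>The root is reserved for its parent, so the new edge stays out of the matching, but
  \<open>r\<close> counts as chosen and dominates \<open>s\<close>.\<close>

lemma sizesB_graft:
  "sizesB (V1 \<union> V2) E r =
    {b + m | b m. b \<in> sizesB V1 E1 r \<and> m \<in> sizesA V2 E2 s \<union> sizesD V2 E2 s}" (is "?L = ?R")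
proof (intro equalityI subsetI)
  fix x assume "x \<in> ?L"
  then obtain M where M: "matching_in E M" "r \<notin> \<Union>M"
      "\<forall>v\<in>V1 \<union> V2. dominated E (insert r (\<Union>M)) v" "x = card M"
    unfolding sizesB_def by blast
  from M(1,2) obtain M1 M2 where 1: "matching_in E1 M1" "matching_in E2 M2" "M = M1 \<union> M2" "r \<notin> \<Union>M1"
    "card M = card M1 + card M2" "\<Union>M1 \<subseteq> V1" "\<Union>M2 \<subseteq> V2" by (rule unsplit_edge)
  have sub: "insert r (\<Union>M1) \<subseteq> V1" "\<Union>M2 \<subseteq> V2" using 1 rs by auto
  have eq: "insert r (\<Union>M) = insert r (\<Union>M1) \<union> \<Union>M2" using 1(3) by auto
  have d: "\<forall>v\<in>V1. dominated E1 (insert r (\<Union>M1)) v" "\<forall>v\<in>V2. dominated E2 (\<Union>M2) v \<or> v = s"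
    using M(3)[unfolded eq all_dominated_union(1)[OF sub]] by auto
  have "card M1 \<in> sizesB V1 E1 r" using d 1 unfolding sizesB_def by blast
  moreover have "card M2 \<in> sizesA V2 E2 s \<union> sizesD V2 E2 s"
  proof (cases "s \<in> \<Union>M2")
    case True
    then show ?thesis using d(2) 1(2) unfolding sizesA_def dominated_def by blast
  next
    case False
    then show ?thesis using d(2) 1(2) unfolding sizesD_def by blast
  qed
  ultimately show "x \<in> ?R" using M(4) 1(5) by blast
next
  fix x assume "x \<in> ?R"
  then obtain M1 M2 where x: "x = card M1 + card M2"
    and M1: "matching_in E1 M1" "r \<notin> \<Union>M1" "\<forall>v\<in>V1. dominated E1 (insert r (\<Union>M1)) v"
    and M2: "matching_in E2 M2" "\<forall>v\<in>V2 - {s}. dominated E2 (\<Union>M2) v"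
    unfolding sizesA_def sizesB_def sizesD_def by blast
  have sub: "insert r (\<Union>M1) \<subseteq> V1" "\<Union>M2 \<subseteq> V2"
    using Union_sub(1)[OF M1(1)] Union_sub(2)[OF M2(1)] rs by auto
  have eq: "insert r (\<Union>(M1 \<union> M2)) = insert r (\<Union>M1) \<union> \<Union>M2" by auto
  have "\<forall>v\<in>V1 \<union> V2. dominated E (insert r (\<Union>(M1 \<union> M2))) v"
    unfolding eq all_dominated_union(1)[OF sub] using M1 M2 by blast
  moreover have "r \<notin> \<Union>(M1 \<union> M2)" using M1(2) no_cross(2)[OF M2(1)] by auto
  ultimately show "x \<in> ?L"
    by (intro sizesB_I[OF matching_union(1)[OF M1(1) M2(1)]]) (assumption | simp only: matching_union(2)[OF M1(1) M2(1)] x)+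
qed

text \<open>An unchosen \<open>r\<close> cannot help \<open>s\<close>, so the second tree has kind A
  or C. If \<open>r\<close> is not dominated inside \<open>V1\<close>, then \<open>s\<close> has to
  be chosen, which leaves kind A.\<close>

lemma sizesC_graft:
  "sizesC (V1 \<union> V2) E r =
    {c + m | c m. c \<in> sizesC V1 E1 r \<and> m \<in> sizesA V2 E2 s \<union> sizesC V2 E2 s} \<union>
    {d + a | d a. d \<in> sizesD V1 E1 r \<and> a \<in> sizesA V2 E2 s}" (is "?L = ?R1 \<union> ?R2")
proof (intro equalityI subsetI)
  fix x assume "x \<in> ?L"
  then obtain M where M: "matching_in E M" "r \<notin> \<Union>M" "\<forall>v\<in>V1 \<union> V2. dominated E (\<Union>M) v" "x = card M"
    unfolding sizesC_def by blast
  from M(1,2) obtain M1 M2 where 1: "matching_in E1 M1" "matching_in E2 M2" "M = M1 \<union> M2" "r \<notin> \<Union>M1"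
    "card M = card M1 + card M2" "\<Union>M1 \<subseteq> V1" "\<Union>M2 \<subseteq> V2" by (rule unsplit_edge)
  have d: "\<forall>v\<in>V1. dominated E1 (\<Union>M1) v \<or> (v = r \<and> s \<in> \<Union>M2)" "\<forall>v\<in>V2. dominated E2 (\<Union>M2) v"
    using M(3)[unfolded 1(3) Union_Un_distrib all_dominated_union(1)[OF 1(6,7)]] 1(4) by auto
  show "x \<in> ?R1 \<union> ?R2"
  proof (cases "\<forall>v\<in>V1. dominated E1 (\<Union>M1) v")
    case True
    then have "card M1 \<in> sizesC V1 E1 r" "card M2 \<in> sizesA V2 E2 s \<union> sizesC V2 E2 s"
      using d 1 unfolding sizesA_def sizesC_def by blast+
    then show ?thesis using M(4) 1(5) by blast
  next
    case False
    then have "s \<in> \<Union>M2" using d(1) by blast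
    then have "card M1 \<in> sizesD V1 E1 r" "card M2 \<in> sizesA V2 E2 s"
      using d 1(4) by (auto intro!: sizesD_I[OF 1(1)] sizesA_I[OF 1(2)])
    then show ?thesis using M(4) 1(5) by blast
  qed
next
  fix x assume "x \<in> ?R1 \<union> ?R2"
  then obtain M1 M2 where x: "x = card M1 + card M2"
    and M1: "matching_in E1 M1" "r \<notin> \<Union>M1" "\<forall>v\<in>V1. dominated E1 (\<Union>M1) v \<or> (v = r \<and> s \<in> \<Union>M2)"
    and M2: "matching_in E2 M2" "\<forall>v\<in>V2. dominated E2 (\<Union>M2) v"
    unfolding sizesA_def sizesC_def sizesD_def by blast
  have "\<forall>v\<in>V1 \<union> V2. dominated E (\<Union>(M1 \<union> M2)) v"
    unfolding Union_Un_distrib all_dominated_union(1)[OF Union_sub(1)[OF M1(1)] Union_sub(2)[OF M2(1)]]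
    using M1 M2 by blast
  moreover have "r \<notin> \<Union>(M1 \<union> M2)" using M1(2) no_cross(2)[OF M2(1)] by auto
  ultimately show "x \<in> ?L"
    by (intro sizesC_I[OF matching_union(1)[OF M1(1) M2(1)]]) (assumption | simp only: matching_union(2)[OF M1(1) M2(1)] x)+
qed

lemma sizesD_graft:
  "sizesD (V1 \<union> V2) E r =
    {d + m | d m. d \<in> sizesD V1 E1 r \<and> m \<in> sizesA V2 E2 s \<union> sizesC V2 E2 s}" (is "?L = ?R")
proof (intro equalityI subsetI)
  fix x assume "x \<in> ?L"
  then obtain M where M: "matching_in E M" "r \<notin> \<Union>M" "\<forall>v\<in>V1 \<union> V2 - {r}. dominated E (\<Union>M) v" "x = card M"
    unfolding sizesD_def by blast
  from M(1,2) obtain M1 M2 where 1: "matching_in E1 M1" "matching_in E2 M2" "M = M1 \<union> M2" "r \<notin> \<Union>M1"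
    "card M = card M1 + card M2" "\<Union>M1 \<subseteq> V1" "\<Union>M2 \<subseteq> V2" by (rule unsplit_edge)
  have d: "\<forall>v\<in>V1 - {r}. dominated E1 (\<Union>M1) v" "\<forall>v\<in>V2. dominated E2 (\<Union>M2) v"
    using M(3)[unfolded 1(3) Union_Un_distrib all_dominated_union(2)[OF 1(6,7)]] 1(4) by auto
  then have "card M1 \<in> sizesD V1 E1 r" "card M2 \<in> sizesA V2 E2 s \<union> sizesC V2 E2 s"
    using 1 unfolding sizesA_def sizesC_def sizesD_def by blast+
  then show "x \<in> ?R" using M(4) 1(5) by blast
next
  fix x assume "x \<in> ?R"
  then obtain M1 M2 where x: "x = card M1 + card M2"
    and M1: "matching_in E1 M1" "r \<notin> \<Union>M1" "\<forall>v\<in>V1 - {r}. dominated E1 (\<Union>M1) v"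
    and M2: "matching_in E2 M2" "\<forall>v\<in>V2. dominated E2 (\<Union>M2) v"
    unfolding sizesA_def sizesC_def sizesD_def by blast
  have "\<forall>v\<in>V1 \<union> V2 - {r}. dominated E (\<Union>(M1 \<union> M2)) v"
    unfolding Union_Un_distrib all_dominated_union(2)[OF Union_sub(1)[OF M1(1)] Union_sub(2)[OF M2(1)]]
    using M1 M2 by blast
  moreover have "r \<notin> \<Union>(M1 \<union> M2)" using M1(2) no_cross(2)[OF M2(1)] by auto
  ultimately show "x \<in> ?L"
    by (intro sizesD_I[OF matching_union(1)[OF M1(1) M2(1)]]) (assumption | simp only: matching_union(2)[OF M1(1) M2(1)] x)+
qed

end

subsection \<open>Root types\<close>

text \<open>Relative to a number \<open>k\<close>, the least sizes of the kinds A, B, C, D are: for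
  \<open>TL\<close> above \<open>k\<close>, \<open>k\<close>, above \<open>k\<close>,
  \<open>k\<close>; for \<open>Tb\<close> exactly \<open>k\<close>, \<open>k - 1\<close>, at least
  \<open>k\<close>, at least \<open>k\<close>; for \<open>Tc\<close> exactly \<open>k\<close>,
  \<open>k\<close>, at least \<open>k\<close>, at least \<open>k\<close>; for \<open>Td\<close>
  above \<open>k\<close>, \<open>k\<close>, \<open>k\<close>, \<open>k\<close>. The minima that are
  only bounded never decide a minimum of a larger tree, so four types close the recursion.\<close>

datatype rtype = TL | Tb | Tc | Td

text \<open>\<open>big\<close> says that the tree has at least two vertices.\<close>

fun has_type :: "rtype \<Rightarrow> bool \<Rightarrow> nat \<Rightarrow> nat set \<Rightarrow> nat set \<Rightarrow> nat set \<Rightarrow> nat set \<Rightarrow> bool" where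
  "has_type TL big k A B C D \<longleftrightarrow> k \<in> B \<and> k \<in> D \<and> A \<subseteq> {k + 1..} \<and> B \<subseteq> {k..} \<and> C \<subseteq> {k + 1..} \<and> D \<subseteq> {k..}
     \<and> (big \<longrightarrow> k + 1 \<in> A)"
| "has_type Tb big k A B C D \<longleftrightarrow> k \<in> A \<and> k \<in> Suc ` B \<and> A \<subseteq> {k..} \<and> Suc ` B \<subseteq> {k..} \<and> C \<subseteq> {k..} \<and> D \<subseteq> {k..}"
| "has_type Tc big k A B C D \<longleftrightarrow> k \<in> A \<and> k \<in> B \<and> A \<subseteq> {k..} \<and> B \<subseteq> {k..} \<and> C \<subseteq> {k..} \<and> D \<subseteq> {k..}"
| "has_type Td big k A B C D \<longleftrightarrow> k \<in> B \<and> k \<in> C \<and> k \<in> D \<and> A \<subseteq> {k + 1..} \<and> B \<subseteq> {k..} \<and> C \<subseteq> {k..} \<and> D \<subseteq> {k..}"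

text \<open>The first argument is the old type of the root, the second the type of the new child.
  The order of the equations encodes the priority c, b, d, L.\<close>

fun graft_type :: "rtype \<Rightarrow> rtype \<Rightarrow> rtype" where
  "graft_type Tc _ = Tc"
| "graft_type _ Tb = Tc"
| "graft_type Tb _ = Tb"
| "graft_type _ TL = Tb"
| "graft_type Td _ = Td"
| "graft_type _ Tc = Td"
| "graft_type _ Td = TL"

text \<open>Truncated subtraction is exact in the only case \<open>Tb\<close>, \<open>Tb\<close> in which it occurs, since type \<open>Tb\<close> forces a positive size.\<close>

fun graft_size :: "rtype \<Rightarrow> rtype \<Rightarrow> nat \<Rightarrow> nat \<Rightarrow> nat" where
  "graft_size TL TL k l = k + l + 1"
| "graft_size Td TL k l = k + l + 1"
| "graft_size Tb Tb k l = k + l - 1"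
| "graft_size _ _ k l = k + l"

text \<open>The bound for B is stated for \<open>Suc x\<close> because the minimum is
  \<open>k - 1\<close> for \<open>Tb\<close>; all bounds thereby stay free of subtraction.\<close>

lemma has_type_bounds:
  assumes "has_type t b k A B C D"
  shows "x \<in> A \<Longrightarrow> (case t of TL \<Rightarrow> k + 1 | Td \<Rightarrow> k + 1 | _ \<Rightarrow> k) \<le> x"
    and "x \<in> B \<Longrightarrow> (case t of Tb \<Rightarrow> k | _ \<Rightarrow> k + 1) \<le> Suc x"
    and "x \<in> C \<Longrightarrow> (case t of TL \<Rightarrow> k + 1 | _ \<Rightarrow> k) \<le> x"
    and "x \<in> D \<Longrightarrow> k \<le> x"
    and "x \<in> A \<union> C \<Longrightarrow> (case t of TL \<Rightarrow> k + 1 | _ \<Rightarrow> k) \<le> x"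
    and "x \<in> A \<union> D \<Longrightarrow> k \<le> x"
  using assms by (cases t; auto)+

text \<open>Least sizes of the joined tree are minima of sums of least sizes of its parts: lower
  bounds come from \<open>has_type_bounds\<close>, upper bounds from explicit members, and the 16
  pairs of types are checked one by one. \<open>graft_size\<close> follows the number of vertices of
  type b: a new child can change only the type of the root, which becomes b where 1 is added and
  ceases to be b for \<open>Tb\<close>, \<open>Tb\<close>.\<close>

lemma has_type_graft:
  fixes A1 B1 C1 D1 A2 B2 C2 D2 :: "nat set"
  defines "A \<equiv> {a + m | a m. a \<in> A1 \<and> m \<in> A2 \<union> D2} \<union> {b + c + 1 | b c. b \<in> B1 \<and> c \<in> B2}"
    and "B \<equiv> {b + m | b m. b \<in> B1 \<and> m \<in> A2 \<union> D2}"
    and "C \<equiv> {c + m | c m. c \<in> C1 \<and> m \<in> A2 \<union> C2} \<union> {d + a | d a. d \<in> D1 \<and> a \<in> A2}"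
    and "D \<equiv> {d + m | d m. d \<in> D1 \<and> m \<in> A2 \<union> C2}"
  assumes t1: "has_type t b1 k A1 B1 C1 D1" and t2: "has_type t' b2 l A2 B2 C2 D2"
  shows "has_type (graft_type t t') True (graft_size t t' k l) A B C D"
proof -
  note l1 = has_type_bounds[OF t1] and l2 = has_type_bounds[OF t2]
  let ?a = "\<lambda>t (k :: nat). case t of TL \<Rightarrow> k + 1 | Td \<Rightarrow> k + 1 | _ \<Rightarrow> k"
  let ?b = "\<lambda>t (k :: nat). case t of Tb \<Rightarrow> k | _ \<Rightarrow> k + 1"
  let ?c = "\<lambda>t (k :: nat). case t of TL \<Rightarrow> k + 1 | _ \<Rightarrow> k"
  have lA: "?a t k + l \<le> x \<or> ?b t k + ?b t' l \<le> Suc x" if "x \<in> A" for x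
  proof -
    from that consider a m where "x = a + m" "a \<in> A1" "m \<in> A2 \<union> D2"
      | b c where "x = b + c + 1" "b \<in> B1" "c \<in> B2" unfolding A_def by blast
    then show ?thesis
    proof cases
      case 1
      then show ?thesis using l1(1)[OF 1(2)] l2(6)[OF 1(3)] by linarith
    next
      case 2
      then show ?thesis using l1(2)[OF 2(2)] l2(2)[OF 2(3)] by linarith
    qed
  qed
  have lB: "?b t k + l \<le> Suc x" if x: "x \<in> B" for x
  proof -
    from x obtain b m where 1: "x = b + m" "b \<in> B1" "m \<in> A2 \<union> D2" unfolding B_def by blast
    then show ?thesis using l1(2)[OF 1(2)] l2(6)[OF 1(3)] by linarith
  qed
  have lC: "?c t k + ?c t' l \<le> x \<or> k + ?a t' l \<le> x" if x: "x \<in> C" for x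
  proof -
    from x consider c m where "x = c + m" "c \<in> C1" "m \<in> A2 \<union> C2"
      | d a where "x = d + a" "d \<in> D1" "a \<in> A2" unfolding C_def by blast
    then show ?thesis
    proof cases
      case 1
      then show ?thesis using l1(3)[OF 1(2)] l2(5)[OF 1(3)] by linarith
    next
      case 2
      then show ?thesis using l1(4)[OF 2(2)] l2(1)[OF 2(3)] by linarith
    qed
  qed
  have lD: "k + ?c t' l \<le> x" if x: "x \<in> D" for x
  proof -
    from x obtain d m where 1: "x = d + m" "d \<in> D1" "m \<in> A2 \<union> C2" unfolding D_def by blast
    then show ?thesis using l1(4)[OF 1(2)] l2(5)[OF 1(3)] by linarith
  qed
  have iA: "a \<in> A1 \<Longrightarrow> m \<in> A2 \<Longrightarrow> a + m \<in> A" "a \<in> A1 \<Longrightarrow> m \<in> D2 \<Longrightarrow> a + m \<in> A"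
      "b \<in> B1 \<Longrightarrow> c \<in> B2 \<Longrightarrow> Suc (b + c) \<in> A" for a b c m
    unfolding A_def by auto
  have iB: "b \<in> B1 \<Longrightarrow> m \<in> A2 \<Longrightarrow> b + m \<in> B" "b \<in> B1 \<Longrightarrow> m \<in> D2 \<Longrightarrow> b + m \<in> B" for b m
    unfolding B_def by auto
  have iC: "c \<in> C1 \<Longrightarrow> m \<in> A2 \<Longrightarrow> c + m \<in> C" "c \<in> C1 \<Longrightarrow> m \<in> C2 \<Longrightarrow> c + m \<in> C"
     "d \<in> D1 \<Longrightarrow> m \<in> A2 \<Longrightarrow> d + m \<in> C" for c d m
    unfolding C_def by auto
  have iD: "d \<in> D1 \<Longrightarrow> m \<in> A2 \<Longrightarrow> d + m \<in> D" "d \<in> D1 \<Longrightarrow> m \<in> C2 \<Longrightarrow> d + m \<in> D" for d m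
    unfolding D_def by auto
  let ?t = "graft_type t t'" and ?k = "graft_size t t' k l"
  have pos: "t = Tb \<Longrightarrow> k > 0" "t' = Tb \<Longrightarrow> l > 0" using t1 t2 by auto
  have mem: "t = TL \<Longrightarrow> k \<in> B1 \<and> k \<in> D1" "t = Tb \<Longrightarrow> k \<in> A1 \<and> k - 1 \<in> B1"
    "t = Tc \<Longrightarrow> k \<in> A1 \<and> k \<in> B1" "t = Td \<Longrightarrow> k \<in> B1 \<and> k \<in> C1 \<and> k \<in> D1"
    "t' = TL \<Longrightarrow> l \<in> B2 \<and> l \<in> D2" "t' = Tb \<Longrightarrow> l \<in> A2 \<and> l - 1 \<in> B2"
    "t' = Tc \<Longrightarrow> l \<in> A2 \<and> l \<in> B2" "t' = Td \<Longrightarrow> l \<in> B2 \<and> l \<in> C2 \<and> l \<in> D2"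
    using t1 t2 by auto
  have A: "A \<subseteq> {?a ?t ?k..}"
  proof
    fix x assume "x \<in> A"
    from lA[OF this] show "x \<in> {?a ?t ?k..}" using pos by (cases t; cases t') auto
  qed
  have B: "?b ?t ?k \<le> Suc x" if "x \<in> B" for x
    using lB[OF that] pos by (cases t; cases t') auto
  have C: "C \<subseteq> {?c ?t ?k..}"
  proof
    fix x assume "x \<in> C"
    from lC[OF this] show "x \<in> {?c ?t ?k..}" using pos by (cases t; cases t') auto
  qed
  have D: "D \<subseteq> {?k..}"
  proof
    fix x assume "x \<in> D"
    from lD[OF this] show "x \<in> {?k..}" using pos by (cases t; cases t') auto
  qed
  show ?thesis
  proof (cases ?t)
    case TL
    then have "t = TL" "t' = Td" by (cases t; cases t'; simp)+
    then have "?k \<in> B \<and> ?k \<in> D \<and> ?k + 1 \<in> A" using mem(1,8) iA(3)[of k l] iB(2)[of k l] iD(2)[of k l] by simp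
    then show ?thesis using TL A B C D by auto
  next
    case Tb
    then consider "t = TL" "t' = TL" | "t = Td" "t' = TL" | "t = Tb" "t' = TL" | "t = Tb" "t' = Tc" | "t = Tb" "t' = Td"
      by (cases t; cases t'; simp)
    then have "?k \<in> A \<and> ?k - 1 \<in> B \<and> ?k > 0"
    proof cases
      case 1 then show ?thesis using mem(1,5) iA(3)[of k l] iB(2)[of k l] by simp
    next
      case 2 then show ?thesis using mem(4,5) iA(3)[of k l] iB(2)[of k l] by simp
    next
      case 3 then show ?thesis using mem(2,5) pos iA(2)[of k l] iB(2)[of "k - 1" l] by simp
    next
      case 4 then show ?thesis using mem(2,7) pos iA(1)[of k l] iB(1)[of "k - 1" l] by simp
    next
      case 5 then show ?thesis using mem(2,8) pos iA(2)[of k l] iB(2)[of "k - 1" l] by simp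
    qed
    then have "?k \<in> A" "?k \<in> Suc ` B" by (auto intro: image_eqI[of _ _ "?k - 1"])
    then show ?thesis using Tb A B C D by auto
  next
    case Tc
    then consider "t = Tc" "t' \<in> {Tb, Tc}" | "t = Tc" "t' \<in> {TL, Td}" | "t \<in> {TL, Td}" "t' = Tb" | "t = Tb" "t' = Tb"
      by (cases t; cases t'; simp)
    then have "?k \<in> A \<and> ?k \<in> B"
    proof cases
      case 1 then show ?thesis using mem(3,6,7) iA(1)[of k l] iB(1)[of k l] by auto
    next
      case 2 then show ?thesis using mem(3,5,8) iA(2)[of k l] iB(2)[of k l] by auto
    next
      case 3 then show ?thesis using mem(1,4,6) pos iA(3)[of k "l - 1"] iB(1)[of k l] by auto
    next
      \<comment> \<open>Two roots of type b each leave one pair open, and the new edge closes both: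
        (k - 1) + (l - 1) + 1 = k + l - 1.\<close>
      case 4 then show ?thesis using mem(2,6) pos iA(3)[of "k - 1" "l - 1"] iB(1)[of "k - 1" l] by (cases k; cases l) auto
    qed
    then show ?thesis using Tc A B C D by auto
  next
    case Td
    then consider "t = TL" "t' = Tc" | "t = Td" "t' = Tc" | "t = Td" "t' = Td"
      by (cases t; cases t'; simp)
    then have "?k \<in> B \<and> ?k \<in> C \<and> ?k \<in> D"
    proof cases
      case 1 then show ?thesis using mem(1,7) iB(1)[of k l] iC(3)[of k l] iD(1)[of k l] by simp
    next
      case 2 then show ?thesis using mem(4,7) iB(1)[of k l] iC(3)[of k l] iD(1)[of k l] by simp
    next
      case 3 then show ?thesis using mem(4,8) iB(2)[of k l] iC(2)[of k l] iD(2)[of k l] by simp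
    qed
    then show ?thesis using Td A B C D by auto
  qed
qed

lemma has_type_least:
  assumes "has_type t b k A B C D"
  shows "k \<in> A \<union> C \<union> D" and "x \<in> A \<union> C \<union> D \<Longrightarrow> k \<le> x"
    and "k \<in> A \<longleftrightarrow> t \<in> {Tb, Tc}" and "k \<in> Suc ` B \<longleftrightarrow> t = Tb" and "k \<in> C \<and> k \<notin> A \<Longrightarrow> t = Td" and "t = Td \<Longrightarrow> k \<in> C"
  using assms by (cases t; auto)+

lemma has_type_unique:
  assumes "has_type t b k A B C D" "has_type t' b' l A B C D"
  shows "t = t' \<and> k = l"
proof -
  note 1 = has_type_least[OF assms(1)] and 2 = has_type_least[OF assms(2)]
  have kl: "k = l" using 1(1,2) 2(1,2) by (meson le_antisym)
  have "t = Tb \<longleftrightarrow> t' = Tb" using 1(4) 2(4) unfolding kl by blast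
  moreover have "t = Tc \<longleftrightarrow> t' = Tc" using 1(3) 2(3) calculation unfolding kl by blast
  moreover have "t = Td \<longleftrightarrow> t' = Td"
    using 1(3,5,6) 2(3,5,6) unfolding kl by blast
  ultimately show ?thesis using kl by (cases t; cases t') auto
qed


subsection \<open>Trees as symmetric relations\<close>

text \<open>Acyclicity is expressed by every edge being a bridge, the form in which cutting and
  joining at an edge are direct. It excludes loops, since \<open>(v, v)\<close> lies in every
  reflexive closure.\<close>

definition is_tree :: "'a set \<Rightarrow> ('a \<times> 'a) set \<Rightarrow> bool" where
  "is_tree V E \<longleftrightarrow> finite V \<and> V \<noteq> {} \<and> E \<subseteq> V \<times> V \<and> sym E \<and> (\<forall>u\<in>V. \<forall>v\<in>V. (u, v) \<in> E\<^sup>*) \<and>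
    (\<forall>u v. (u, v) \<in> E \<longrightarrow> (u, v) \<notin> (E - {(u, v), (v, u)})\<^sup>*)"

definition trees :: "'a set \<Rightarrow> ('a \<times> 'a) set set" where
  "trees V = {E. is_tree V E}"

lemma finite_trees: "finite V \<Longrightarrow> finite (trees V)"
  by (rule finite_subset[of _ "Pow (V \<times> V)"]) (auto simp: trees_def is_tree_def)

text \<open>Used with a map \<open>f\<close> that folds one part of a tree onto its attachment
  vertex: a path in the whole tree becomes a path in the other part.\<close>

lemma rtrancl_project:
  assumes "(x, y) \<in> R\<^sup>*" "\<And>x y. (x, y) \<in> R \<Longrightarrow> f x = f y \<or> (f x, f y) \<in> S"
  shows "(f x, f y) \<in> S\<^sup>*"
  using assms(1)
proof (induction rule: rtrancl_induct)
  case (step y z)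
  then show ?case using assms(2)[OF step(2)] by (auto intro: rtrancl_into_rtrancl)
qed simp

lemma rtrancl_closed:
  assumes "(x, y) \<in> R\<^sup>*" "x \<in> A" "\<And>x y. (x, y) \<in> R \<Longrightarrow> x \<in> A \<Longrightarrow> y \<in> A"
  shows "y \<in> A"
  using assms by (induction rule: rtrancl_induct) auto

context graft
begin

lemma bridge_left:
  assumes "(u, v) \<in> E1" "(u, v) \<notin> (E1 - {(u, v), (v, u)})\<^sup>*"
  shows "(u, v) \<notin> (E - {(u, v), (v, u)})\<^sup>*"
proof
  assume p: "(u, v) \<in> (E - {(u, v), (v, u)})\<^sup>*"
  let ?f = "\<lambda>x. if x \<in> V2 then r else x"
  have uv: "u \<notin> V2" "v \<notin> V2" using assms sub disj by auto
  have "(?f u, ?f v) \<in> (E1 - {(u, v), (v, u)})\<^sup>*"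
  proof (rule rtrancl_project[OF p])
    fix x y assume "(x, y) \<in> E - {(u, v), (v, u)}"
    then show "?f x = ?f y \<or> (?f x, ?f y) \<in> E1 - {(u, v), (v, u)}"
      using sub disj rs unfolding E_def by auto
  qed
  then show False using uv assms(2) by simp
qed

lemma bridge_right:
  assumes "(u, v) \<in> E2" "(u, v) \<notin> (E2 - {(u, v), (v, u)})\<^sup>*"
  shows "(u, v) \<notin> (E - {(u, v), (v, u)})\<^sup>*"
proof
  assume p: "(u, v) \<in> (E - {(u, v), (v, u)})\<^sup>*"
  let ?f = "\<lambda>x. if x \<in> V1 then s else x"
  have uv: "u \<notin> V1" "v \<notin> V1" using assms sub disj by auto
  have "(?f u, ?f v) \<in> (E2 - {(u, v), (v, u)})\<^sup>*"
  proof (rule rtrancl_project[OF p])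
    fix x y assume "(x, y) \<in> E - {(u, v), (v, u)}"
    then show "?f x = ?f y \<or> (?f x, ?f y) \<in> E2 - {(u, v), (v, u)}"
      using sub disj rs unfolding E_def by auto
  qed
  then show False using uv assms(2) by simp
qed

lemma is_tree_graft:
  assumes "is_tree V1 E1" "is_tree V2 E2"
  shows "is_tree (V1 \<union> V2) E"
proof -
  have s: "sym E1" "sym E2"
    and c: "\<And>u v. u \<in> V1 \<Longrightarrow> v \<in> V1 \<Longrightarrow> (u, v) \<in> E1\<^sup>*" "\<And>u v. u \<in> V2 \<Longrightarrow> v \<in> V2 \<Longrightarrow> (u, v) \<in> E2\<^sup>*"
    and b: "\<And>u v. (u, v) \<in> E1 \<Longrightarrow> (u, v) \<notin> (E1 - {(u, v), (v, u)})\<^sup>*"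
      "\<And>u v. (u, v) \<in> E2 \<Longrightarrow> (u, v) \<notin> (E2 - {(u, v), (v, u)})\<^sup>*"
    using assms unfolding is_tree_def by auto
  have symE: "sym E" using s unfolding E_def sym_def by auto
  have mono: "E1\<^sup>* \<subseteq> E\<^sup>*" "E2\<^sup>* \<subseteq> E\<^sup>*" unfolding E_def by (auto intro!: rtrancl_mono)
  have reach: "(r, v) \<in> E\<^sup>*" if "v \<in> V1 \<union> V2" for v
  proof (cases "v \<in> V1")
    case True
    then show ?thesis using c(1)[OF rs(1)] mono by blast
  next
    case False
    then have "(s, v) \<in> E\<^sup>*" using that c(2)[OF rs(2)] mono by blast
    moreover have "(r, s) \<in> E" unfolding E_def by simp
    ultimately show ?thesis by (rule converse_rtrancl_into_rtrancl[rotated])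
  qed
  have conn: "(u, v) \<in> E\<^sup>*" if "u \<in> V1 \<union> V2" "v \<in> V1 \<union> V2" for u v
    using reach[OF that(1)] reach[OF that(2)] symE by (meson rtrancl_trans sym_rtrancl symD)
  have cross: "(u, v) \<notin> (E - {(u, v), (v, u)})\<^sup>*" if "(u, v) = (r, s) \<or> (u, v) = (s, r)" for u v
  proof -
    have E: "E - {(u, v), (v, u)} \<subseteq> E1 \<union> E2" using that unfolding E_def by auto
    have 1: "y \<in> V1" if "(r, y) \<in> (E1 \<union> E2)\<^sup>*" for y
      using that rs(1) by (rule rtrancl_closed) (use sub disj in auto)
    have 2: "y \<in> V2" if "(s, y) \<in> (E1 \<union> E2)\<^sup>*" for y
      using that rs(2) by (rule rtrancl_closed) (use sub disj in auto)
    have "(r, s) \<notin> (E1 \<union> E2)\<^sup>*" "(s, r) \<notin> (E1 \<union> E2)\<^sup>*"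
      using 1[of s] 2[of r] rs disj by blast+
    then show ?thesis using that rtrancl_mono[OF E] by auto
  qed
  have "(u, v) \<notin> (E - {(u, v), (v, u)})\<^sup>*" if "(u, v) \<in> E" for u v
    using that bridge_left[OF _ b(1)] bridge_right[OF _ b(2)] cross unfolding E_def[of ] by blast
  then show ?thesis
    using fin rs sub symE conn unfolding is_tree_def by (auto simp: E_def)
qed

end

section \<open>Cutting off the branch of the root that contains a marked vertex\<close>

locale rooted_split =
  fixes V :: "'a set" and r v0 :: 'a
  assumes finV: "finite V" and rV: "r \<in> V" and v0V: "v0 \<in> V" and r_v0: "r \<noteq> v0"
begin

definition comp :: "('a \<times> 'a) set \<Rightarrow> 'a set" where
  "comp E = {w. (v0, w) \<in> (E \<inter> (- {r}) \<times> (- {r}))\<^sup>*}"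

text \<open>Marking \<open>v0\<close> singles out one branch at the root, so that a root with any
  number of branches splits into just two trees. On generating functions this is differentiation,
  which removes the marked vertex.\<close>

definition pieces where
  "pieces = (SIGMA W:{W. v0 \<in> W \<and> W \<subseteq> V - {r}}. SIGMA s:W. trees (V - W) \<times> trees W)"

definition join where
  "join = (\<lambda>(W :: 'a set, s, E1, E2). E1 \<union> E2 \<union> {(r, s), (s, r)})"

lemma comp_step: "x \<in> comp E \<Longrightarrow> (x, y) \<in> E \<Longrightarrow> y \<noteq> r \<Longrightarrow> x \<noteq> r \<Longrightarrow> y \<in> comp E"
  unfolding comp_def by (auto intro: rtrancl_into_rtrancl)

lemma r_comp: "r \<notin> comp E"
proof
  assume "r \<in> comp E"
  then have "(v0, r) \<in> (E \<inter> (- {r}) \<times> (- {r}))\<^sup>*" by (simp add: comp_def)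
  then have "r \<in> - {r}" by (rule rtrancl_closed) (use r_v0 in auto)
  then show False by simp
qed

lemma v0_comp: "v0 \<in> comp E"
  by (simp add: comp_def)

lemma comp_sub:
  assumes "E \<subseteq> V \<times> V" shows "comp E \<subseteq> V"
proof
  fix x assume "x \<in> comp E"
  then have "(v0, x) \<in> (E \<inter> (- {r}) \<times> (- {r}))\<^sup>*" by (simp add: comp_def)
  then show "x \<in> V" by (rule rtrancl_closed) (use v0V assms in auto)
qed

lemma comp_join:
  assumes "(W, s, E1, E2) \<in> pieces"
  shows "comp (join (W, s, E1, E2)) = W"
proof -
  let ?E = "join (W, s, E1, E2)"
  have a: "v0 \<in> W" "r \<notin> W" "s \<in> W" "E1 \<subseteq> (V - W) \<times> (V - W)" "E2 \<subseteq> W \<times> W"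
    and c: "\<And>w. w \<in> W \<Longrightarrow> (v0, w) \<in> E2\<^sup>*"
    using assms unfolding pieces_def trees_def is_tree_def by auto
  show ?thesis
  proof (intro equalityI subsetI)
    fix x assume "x \<in> comp ?E"
    then have "(v0, x) \<in> (?E \<inter> (- {r}) \<times> (- {r}))\<^sup>*" by (simp add: comp_def)
    then show "x \<in> W" by (rule rtrancl_closed) (use a in \<open>auto simp: join_def\<close>)
  next
    fix x assume "x \<in> W"
    have "E2 \<subseteq> ?E \<inter> (- {r}) \<times> (- {r})" using a by (auto simp: join_def)
    then show "x \<in> comp ?E" using c[OF \<open>x \<in> W\<close>] rtrancl_mono unfolding comp_def by blast
  qed
qed

text \<open>\<open>comp_join\<close> recovers \<open>W\<close> from the joined tree;
  \<open>E1\<close> and \<open>E2\<close> are then the restrictions to the complement of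
  \<open>W\<close> and to \<open>W\<close>, and \<open>s\<close> is the only neighbour of
  \<open>r\<close> in \<open>W\<close>.\<close>

lemma inj_join: "inj_on join pieces"
proof (rule inj_onI)
  fix p q assume p: "p \<in> pieces" and q: "q \<in> pieces" and eq: "join p = join q"
  obtain W s E1 E2 where p': "p = (W, s, E1, E2)" by (metis prod_cases4)
  obtain W' s' E1' E2' where q': "q = (W', s', E1', E2')" by (metis prod_cases4)
  have W: "W' = W" using comp_join p q eq unfolding p' q' by metis
  have a: "r \<notin> W" "s \<in> W" "s' \<in> W" "E1 \<subseteq> (V - W) \<times> (V - W)" "E2 \<subseteq> W \<times> W"
    "E1' \<subseteq> (V - W) \<times> (V - W)" "E2' \<subseteq> W \<times> W"
    using p q W unfolding p' q' pieces_def trees_def is_tree_def by auto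
  have e: "E1 \<union> E2 \<union> {(r, s), (s, r)} = E1' \<union> E2' \<union> {(r, s'), (s', r)}"
    using eq unfolding p' q' join_def by simp
  have "E1 = (E1 \<union> E2 \<union> {(r, s), (s, r)}) \<inter> (- W) \<times> (- W)"
    "E2 = (E1 \<union> E2 \<union> {(r, s), (s, r)}) \<inter> W \<times> W"
    "E1' = (E1' \<union> E2' \<union> {(r, s'), (s', r)}) \<inter> (- W) \<times> (- W)"
    "E2' = (E1' \<union> E2' \<union> {(r, s'), (s', r)}) \<inter> W \<times> W"
    using a by auto
  then have "E1 = E1'" "E2 = E2'" unfolding e by simp_all
  moreover have "s = s'"
  proof -
    have "(r, s) \<in> E1' \<union> E2' \<union> {(r, s'), (s', r)}" using e by blast
    then show ?thesis using a by auto
  qed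
  ultimately show "p = q" using W p' q' by simp
qed

lemma join_graft:
  assumes "(W, s, E1, E2) \<in> pieces"
  shows "graft (V - W) W E1 E2 r s" "join (W, s, E1, E2) = graft.E E1 E2 r s" "is_tree (V - W) E1" "is_tree W E2"
    "(V - W) \<union> W = V"
proof -
  show g: "graft (V - W) W E1 E2 r s"
    using assms finV rV unfolding pieces_def trees_def is_tree_def graft_def by (auto intro: finite_subset)
  show "join (W, s, E1, E2) = graft.E E1 E2 r s"
    by (simp add: join_def graft.E_def[OF g])
  show "is_tree (V - W) E1" "is_tree W E2" "(V - W) \<union> W = V"
    using assms unfolding pieces_def trees_def by auto
qed

lemma join_tree:
  assumes "p \<in> pieces" shows "join p \<in> trees V"
proof -
  obtain W s E1 E2 where p': "p = (W, s, E1, E2)" by (metis prod_cases4)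
  note g = join_graft[OF assms[unfolded p']]
  show ?thesis using graft.is_tree_graft[OF g(1,3,4)] g(2,5) unfolding p' trees_def by simp
qed

text \<open>The component \<open>W\<close> of \<open>v0\<close> after deleting \<open>r\<close>
  meets the rest of the tree only through \<open>r\<close>, and by a single edge: a second neighbour
  of \<open>r\<close> in \<open>W\<close> would give a detour around the first edge, which is a
  bridge.\<close>

lemma tree_join:
  assumes "E \<in> trees V" shows "E \<in> join ` pieces"
proof -
  have E: "E \<subseteq> V \<times> V" and symE: "sym E" and conn: "\<And>u v. u \<in> V \<Longrightarrow> v \<in> V \<Longrightarrow> (u, v) \<in> E\<^sup>*"
    and bridge: "\<And>u v. (u, v) \<in> E \<Longrightarrow> (u, v) \<notin> (E - {(u, v), (v, u)})\<^sup>*"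
    using assms unfolding trees_def is_tree_def by auto
  define W where "W = comp E"
  let ?R = "E \<inter> (- {r}) \<times> (- {r})"
  have symR: "sym ?R" using symE unfolding sym_def by auto
  have W: "v0 \<in> W" "r \<notin> W" "W \<subseteq> V" using v0_comp r_comp comp_sub[OF E] by (auto simp: W_def)
  have cross: "x = r" if "(x, y) \<in> E" "x \<notin> W" "y \<in> W" for x y
  proof (rule ccontr)
    assume "x \<noteq> r"
    moreover have "(y, x) \<in> E" using that symE by (auto dest: symD)
    ultimately show False using comp_step[of y E x] that W unfolding W_def by auto
  qed
  obtain s where s: "s \<in> W" "(r, s) \<in> E"
  proof -
    have "\<exists>s\<in>W. (r, s) \<in> E"
    proof (rule ccontr)
      assume *: "\<not> (\<exists>s\<in>W. (r, s) \<in> E)"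
      have "v0 \<in> - W"
        using conn[OF rV v0V] by (rule rtrancl_closed) (use W cross * in auto)
      then show False using W by simp
    qed
    then show thesis using that by blast
  qed
  have inW: "(v0, x) \<in> ?R\<^sup>*" if "x \<in> W" for x using that by (simp add: W_def comp_def)
  have unique: "s' = s" if s': "s' \<in> W" "(r, s') \<in> E" for s'
  proof (rule ccontr)
    assume ne: "s' \<noteq> s"
    have "(s, s') \<in> ?R\<^sup>*"
      using inW[OF s(1)] inW[OF s'(1)] symR by (meson rtrancl_trans sym_rtrancl symD)
    moreover have "?R \<subseteq> E - {(s, r), (r, s)}" by auto
    ultimately have "(s, s') \<in> (E - {(s, r), (r, s)})\<^sup>*" using rtrancl_mono by blast
    moreover have "(s', r) \<in> E - {(s, r), (r, s)}" using s' symE ne s W by (auto dest: symD)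
    ultimately have "(s, r) \<in> (E - {(s, r), (r, s)})\<^sup>*" by (rule rtrancl_into_rtrancl)
    then show False using bridge[of s r] s symE by (auto dest: symD)
  qed
  define E1 where "E1 = E \<inter> (V - W) \<times> (V - W)"
  define E2 where "E2 = E \<inter> W \<times> W"
  have eqE: "E = E1 \<union> E2 \<union> {(r, s), (s, r)}"
  proof (intro equalityI subsetI)
    fix p assume p: "p \<in> E"
    obtain x y where xy: "p = (x, y)" by (cases p)
    have V: "x \<in> V" "y \<in> V" using p xy E by auto
    have yx: "(y, x) \<in> E" using p xy symE by (auto dest: symD)
    consider "x \<in> W" "y \<in> W" | "x \<notin> W" "y \<notin> W" | "x \<notin> W" "y \<in> W" | "x \<in> W" "y \<notin> W" by blast
    then show "p \<in> E1 \<union> E2 \<union> {(r, s), (s, r)}"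
    proof cases
      case 3
      then show ?thesis using cross[of x y] unique[of y] p xy by auto
    next
      case 4
      then show ?thesis using cross[of y x] unique[of x] yx xy by auto
    qed (use p xy V in \<open>auto simp: E1_def E2_def\<close>)
  next
    fix p assume "p \<in> E1 \<union> E2 \<union> {(r, s), (s, r)}"
    then show "p \<in> E" using s symE by (auto simp: E1_def E2_def dest: symD)
  qed
  have sym12: "sym E1" "sym E2" using symE unfolding E1_def E2_def sym_def by auto
  have c2: "(v0, x) \<in> E2\<^sup>*" if "x \<in> W" for x
    using inW[OF that]
  proof (induction rule: rtrancl_induct)
    case (step y z)
    have "y \<in> W" "z \<in> W" using step(1,2) unfolding W_def comp_def by (auto intro: rtrancl_into_rtrancl)
    then show ?case using step by (auto simp: E2_def intro: rtrancl_into_rtrancl)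
  qed simp
  \<comment> \<open>Excursions of a path into \<open>W\<close> start and end at \<open>r\<close>, so
    folding \<open>W\<close> onto \<open>r\<close> removes them.\<close>
  have c1: "(r, x) \<in> E1\<^sup>*" if "x \<in> V - W" for x
  proof -
    let ?f = "\<lambda>x. if x \<in> W then r else x"
    have "(r, x) \<in> E\<^sup>*" using conn rV that by blast
    then have "(?f r, ?f x) \<in> E1\<^sup>*"
    proof (rule rtrancl_project)
      fix y z assume yz: "(y, z) \<in> E"
      then have "(y, z) \<in> E1 \<union> E2 \<union> {(r, s), (s, r)}" using eqE by blast
      then show "?f y = ?f z \<or> (?f y, ?f z) \<in> E1"
        using W(2) s(1) by (auto simp: E1_def E2_def)
    qed
    then show ?thesis using that W by simp
  qed
  have b: "(u, v) \<notin> (F - {(u, v), (v, u)})\<^sup>*" if "F \<subseteq> E" "(u, v) \<in> F" for F u v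
  proof -
    have "(F - {(u, v), (v, u)})\<^sup>* \<subseteq> (E - {(u, v), (v, u)})\<^sup>*" using that by (intro rtrancl_mono) auto
    then show ?thesis using bridge that by blast
  qed
  have conn2: "(u, v) \<in> E2\<^sup>*" if "u \<in> W" "v \<in> W" for u v
    using c2[OF that(1)] c2[OF that(2)] sym12(2) by (meson rtrancl_trans sym_rtrancl symD)
  have conn1: "(u, v) \<in> E1\<^sup>*" if "u \<in> V - W" "v \<in> V - W" for u v
    using c1[OF that(1)] c1[OF that(2)] sym12(1) by (meson rtrancl_trans sym_rtrancl symD)
  have "E1 \<subseteq> E" "E2 \<subseteq> E" "E1 \<subseteq> (V - W) \<times> (V - W)" "E2 \<subseteq> W \<times> W"
    unfolding E1_def E2_def by auto
  note sub = this
  have "is_tree W E2"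
    unfolding is_tree_def
    using W(1) finite_subset[OF W(3) finV] sym12(2) conn2 b[OF sub(2)] sub(4) by blast
  moreover have "is_tree (V - W) E1"
    unfolding is_tree_def
    using W(2) rV finV sym12(1) conn1 b[OF sub(1)] sub(3) by blast
  ultimately have "(W, s, E1, E2) \<in> pieces"
    using W s unfolding pieces_def trees_def by auto
  then show ?thesis using eqE by (intro image_eqI[of _ _ "(W, s, E1, E2)"]) (auto simp: join_def)
qed

lemma bij_join: "bij_betw join pieces (trees V)"
  using inj_join join_tree tree_join unfolding bij_betw_def by blast

end


subsection \<open>Type and size of a rooted tree\<close>

text \<open>Defining the class through the size sets rather than by recursion over children makes it
  visibly independent of the order in which branches are cut off; \<open>has_type_unique\<close>
  makes the description definite.\<close>

definition tree_class :: "'a set \<Rightarrow> ('a \<times> 'a) set \<Rightarrow> 'a \<Rightarrow> rtype \<times> nat" where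
  "tree_class V E r = (THE p. has_type (fst p) False (snd p)
     (sizesA V E r) (sizesB V E r) (sizesC V E r) (sizesD V E r))"

lemma has_type_weaken: "has_type t b k A B C D \<Longrightarrow> has_type t False k A B C D"
  by (cases t) auto

lemma tree_class_eq:
  assumes "has_type t b k (sizesA V E r) (sizesB V E r) (sizesC V E r) (sizesD V E r)"
  shows "tree_class V E r = (t, k)"
  unfolding tree_class_def
proof (rule the_equality)
  show "has_type (fst (t, k)) False (snd (t, k)) (sizesA V E r) (sizesB V E r) (sizesC V E r) (sizesD V E r)"
    using has_type_weaken[OF assms] by simp
  show "p = (t, k)"
    if "has_type (fst p) False (snd p) (sizesA V E r) (sizesB V E r) (sizesC V E r) (sizesD V E r)" for p
    using has_type_unique[OF that assms] by (simp add: prod_eq_iff)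
qed

lemma trees_singleton: "trees {r} = {{}}"
proof -
  have "is_tree {r} E \<longleftrightarrow> E = {}" for E
  proof
    assume E: "is_tree {r} E"
    then have "(r, r) \<notin> E" unfolding is_tree_def by blast
    then show "E = {}" using E unfolding is_tree_def by auto
  qed (auto simp: is_tree_def sym_def)
  then show ?thesis by (auto simp: trees_def)
qed

lemma has_type_singleton:
  "has_type TL False 0 (sizesA {r} {} r) (sizesB {r} {} r) (sizesC {r} {} r) (sizesD {r} {} r)"
proof -
  have m: "matching_in {} M \<longleftrightarrow> M = {}" for M :: "'a set set" by (auto simp: matching_in_def)
  show ?thesis
    by (auto simp: sizesA_def sizesB_def sizesC_def sizesD_def m dominated_def)
qed

definition well_typed :: "'a set \<Rightarrow> ('a \<times> 'a) set \<Rightarrow> 'a \<Rightarrow> bool" where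
  "well_typed V E r \<longleftrightarrow> has_type (fst (tree_class V E r)) (card V \<ge> 2) (snd (tree_class V E r))
     (sizesA V E r) (sizesB V E r) (sizesC V E r) (sizesD V E r)"

lemma tree_class_graft:
  assumes "graft V1 V2 E1 E2 r s" "well_typed V1 E1 r" "well_typed V2 E2 s"
  shows "well_typed (V1 \<union> V2) (graft.E E1 E2 r s) r"
    "tree_class (V1 \<union> V2) (graft.E E1 E2 r s) r =
      (graft_type (fst (tree_class V1 E1 r)) (fst (tree_class V2 E2 s)),
       graft_size (fst (tree_class V1 E1 r)) (fst (tree_class V2 E2 s)) (snd (tree_class V1 E1 r)) (snd (tree_class V2 E2 s)))"
proof -
  interpret graft V1 V2 E1 E2 r s by fact
  have h: "has_type (graft_type (fst (tree_class V1 E1 r)) (fst (tree_class V2 E2 s))) True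
       (graft_size (fst (tree_class V1 E1 r)) (fst (tree_class V2 E2 s)) (snd (tree_class V1 E1 r)) (snd (tree_class V2 E2 s)))
     (sizesA (V1 \<union> V2) E r) (sizesB (V1 \<union> V2) E r) (sizesC (V1 \<union> V2) E r) (sizesD (V1 \<union> V2) E r)"
    using has_type_graft[OF assms(2,3)[unfolded well_typed_def]]
    unfolding sizesA_graft sizesB_graft sizesC_graft sizesD_graft .
  show c: "tree_class (V1 \<union> V2) E r =
      (graft_type (fst (tree_class V1 E1 r)) (fst (tree_class V2 E2 s)),
       graft_size (fst (tree_class V1 E1 r)) (fst (tree_class V2 E2 s)) (snd (tree_class V1 E1 r)) (snd (tree_class V2 E2 s)))"
    by (rule tree_class_eq[OF h])
  have "has_type t b k A B C D" if "has_type t True k A B C D" for t b k A B C D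
    using that by (cases t) auto
  then show "well_typed (V1 \<union> V2) E r" using h unfolding well_typed_def c by simp
qed

lemma tree_well_typed:
  assumes "is_tree V E" "r \<in> V"
  shows "well_typed V E r"
  using assms
proof (induction "card V" arbitrary: V E r rule: less_induct)
  case less
  show ?case
  proof (cases "V = {r}")
    case True
    then have "E = {}" using less.prems trees_singleton[of r] by (auto simp: trees_def)
    then show ?thesis
      unfolding well_typed_def True by (simp add: tree_class_eq[OF has_type_singleton] has_type_singleton del: has_type.simps)
  next
    case False
    then obtain v0 where v0: "v0 \<in> V" "r \<noteq> v0" using less.prems by blast
    have fin: "finite V" using less.prems by (simp add: is_tree_def)
    interpret rooted_split V r v0 using fin less.prems(2) v0 by unfold_locales auto
    obtain p where p: "p \<in> pieces" "E = join p" using tree_join[of E] less.prems by (auto simp: trees_def)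
    obtain W s E1 E2 where p': "p = (W, s, E1, E2)" by (metis prod_cases4)
    note g = join_graft[OF p(1)[unfolded p']]
    have W: "W \<subseteq> V - {r}" "v0 \<in> W" "s \<in> W" using p(1) unfolding p' pieces_def by auto
    have "card (V - W) < card V" "card W < card V"
      using fin W v0 rV by (auto intro!: psubset_card_mono)
    then have "well_typed (V - W) E1 r" "well_typed W E2 s"
      using less.hyps[of "V - W" E1 r] less.hyps[of W E2 s] g(3,4) W rV by blast+
    then show ?thesis using tree_class_graft(1)[OF g(1)] g(2,5) p p' by simp
  qed
qed

subsection \<open>Counting trees by type and size\<close>

definition weight_sum :: "'b::field \<Rightarrow> rtype \<Rightarrow> 'a set \<Rightarrow> 'a \<Rightarrow> 'b" where
  "weight_sum u t V r = (\<Sum>E\<in>trees V. if fst (tree_class V E r) = t then u ^ snd (tree_class V E r) else 0)"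

text \<open>The factor by which \<open>u\<close> raised to \<open>graft_size\<close> differs from
  the product of the two weights. Its inverse in the case \<open>Tb\<close>, \<open>Tb\<close> is
  the reason for the hypothesis \<open>u \<noteq> 0\<close> from here on.\<close>

fun graft_weight :: "'b::field \<Rightarrow> rtype \<Rightarrow> rtype \<Rightarrow> 'b" where
  "graft_weight u TL TL = u"
| "graft_weight u Td TL = u"
| "graft_weight u Tb Tb = inverse u"
| "graft_weight u _ _ = 1"

lemma graft_weight_power:
  assumes "u \<noteq> 0" "t = Tb \<Longrightarrow> k > 0"
  shows "u ^ graft_size t t' k l = graft_weight u t t' * u ^ k * u ^ l"
proof (cases "t = Tb \<and> t' = Tb")
  case True
  then obtain k' where "k = Suc k'" using assms(2) by (cases k) auto
  then show ?thesis using assms(1) True by (simp add: power_add)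
next
  case False
  then show ?thesis by (cases t; cases t') (auto simp: power_add)
qed

lemma UNIV_rtype: "(UNIV :: rtype set) = {TL, Tb, Tc, Td}"
  using rtype.exhaust by blast

instance rtype :: finite
  by standard (simp add: UNIV_rtype)

lemma weight_sum_singleton: "weight_sum u t {r} r = (if t = TL then 1 else 0)"
  by (simp add: weight_sum_def trees_singleton tree_class_eq[OF has_type_singleton])

context rooted_split
begin

lemma weight_sum_split:
  assumes "u \<noteq> 0"
  shows "weight_sum u t V r = (\<Sum>W\<in>{W. v0 \<in> W \<and> W \<subseteq> V - {r}}. \<Sum>s\<in>W. \<Sum>(t1, t2)\<in>{(t1, t2). graft_type t1 t2 = t}.
    graft_weight u t1 t2 * weight_sum u t1 (V - W) r * weight_sum u t2 W s)"
proof -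
  let ?h = "\<lambda>E. if fst (tree_class V E r) = t then u ^ snd (tree_class V E r) else 0"
  define g where "g V E r t = (if fst (tree_class V E r) = t then u ^ snd (tree_class V E r) else 0)"
    for V :: "'a set" and E r t
  have finW: "finite W" if "v0 \<in> W \<and> W \<subseteq> V - {r}" for W
    using that finV by (meson Diff_subset finite_subset order_trans)
  have fin1: "finite {W. v0 \<in> W \<and> W \<subseteq> V - {r}}"
    by (rule finite_subset[of _ "Pow V"]) (use finV in auto)
  have h: "?h (join (W, s, E1, E2)) = (\<Sum>(t1, t2)\<in>{(t1, t2). graft_type t1 t2 = t}.
      graft_weight u t1 t2 * g (V - W) E1 r t1 * g W E2 s t2)"
    if p: "(W, s, E1, E2) \<in> pieces" for W s E1 E2
  proof -
    note gr = join_graft[OF p]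
    have s: "s \<in> W" "r \<in> V - W" using p rV unfolding pieces_def by auto
    note wt = tree_well_typed[OF gr(3) s(2)] tree_well_typed[OF gr(4) s(1)]
    obtain t1 k where 1: "tree_class (V - W) E1 r = (t1, k)" by (cases "tree_class (V - W) E1 r")
    obtain t2 l where 2: "tree_class W E2 s = (t2, l)" by (cases "tree_class W E2 s")
    have c: "tree_class V (join (W, s, E1, E2)) r = (graft_type t1 t2, graft_size t1 t2 k l)"
      using tree_class_graft(2)[OF gr(1) wt] unfolding gr(2,5) 1 2 by simp
    have pos: "t1 = Tb \<Longrightarrow> k > 0" using wt(1) unfolding well_typed_def 1 by auto
    have "(\<Sum>(t1, t2)\<in>{(t1, t2). graft_type t1 t2 = t}. graft_weight u t1 t2 * g (V - W) E1 r t1 * g W E2 s t2) =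
      (\<Sum>p\<in>{(t1, t2). graft_type t1 t2 = t}. if p = (t1, t2) then graft_weight u t1 t2 * u ^ k * u ^ l else 0)"
      by (intro sum.cong refl) (auto simp: g_def 1 2 split: prod.splits)
    also have "\<dots> = (if graft_type t1 t2 = t then graft_weight u t1 t2 * u ^ k * u ^ l else 0)"
      by (subst sum.delta) auto
    finally show ?thesis using graft_weight_power[OF assms pos] by (simp add: c)
  qed
  have "weight_sum u t V r = (\<Sum>p\<in>pieces. ?h (join p))"
    unfolding weight_sum_def by (rule sum.reindex_bij_betw[OF bij_join, symmetric])
  also have "\<dots> = (\<Sum>(W, s, E1, E2)\<in>pieces. \<Sum>(t1, t2)\<in>{(t1, t2). graft_type t1 t2 = t}.
      graft_weight u t1 t2 * g (V - W) E1 r t1 * g W E2 s t2)"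
  proof (intro sum.cong refl)
    fix p assume p: "p \<in> pieces"
    obtain W s E1 E2 where p': "p = (W, s, E1, E2)" by (metis prod_cases4)
    show "?h (join p) = (case p of (W, s, E1, E2) \<Rightarrow> \<Sum>(t1, t2)\<in>{(t1, t2). graft_type t1 t2 = t}.
      graft_weight u t1 t2 * g (V - W) E1 r t1 * g W E2 s t2)"
      unfolding p' prod.case by (rule h[OF p[unfolded p']])
  qed
  also have "\<dots> = (\<Sum>W\<in>{W. v0 \<in> W \<and> W \<subseteq> V - {r}}. \<Sum>s\<in>W. \<Sum>E1\<in>trees (V - W). \<Sum>E2\<in>trees W.
      \<Sum>(t1, t2)\<in>{(t1, t2). graft_type t1 t2 = t}. graft_weight u t1 t2 * g (V - W) E1 r t1 * g W E2 s t2)"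
  proof -
    define F where "F W s E1 E2 = (\<Sum>(t1, t2)\<in>{(t1, t2). graft_type t1 t2 = t}.
      graft_weight u t1 t2 * g (V - W) E1 r t1 * g W E2 s t2)" for W s E1 E2
    let ?A = "{W. v0 \<in> W \<and> W \<subseteq> V - {r}}"
    have "(\<Sum>W\<in>?A. \<Sum>s\<in>W. \<Sum>E1\<in>trees (V - W). \<Sum>E2\<in>trees W. F W s E1 E2) =
        (\<Sum>W\<in>?A. \<Sum>s\<in>W. \<Sum>(E1, E2)\<in>trees (V - W) \<times> trees W. F W s E1 E2)" 
      by (simp only: sum.cartesian_product)
    also have "\<dots> = (\<Sum>W\<in>?A. \<Sum>(s, E1, E2)\<in>(SIGMA s:W. trees (V - W) \<times> trees W). F W s E1 E2)"
    proof (intro sum.cong refl sum.Sigma ballI)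
      fix W assume W: "W \<in> ?A"
      show "finite W" using finW W by blast
      show "finite (trees (V - W) \<times> trees W)"
        using finite_trees[of W] finite_trees[of "V - W"] finW[of W] W finV by simp
    qed
    also have "\<dots> = (\<Sum>(W, s, E1, E2)\<in>pieces. F W s E1 E2)"
      unfolding pieces_def
    proof (intro sum.Sigma ballI fin1)
      fix W assume W: "W \<in> ?A"
      show "finite (SIGMA s:W. trees (V - W) \<times> trees W)"
        using finite_trees[of W] finite_trees[of "V - W"] finW[of W] W finV by (intro finite_SigmaI) simp_all
    qed
    finally show ?thesis unfolding F_def by (rule sym)
  qed
  also have "\<dots> = (\<Sum>W\<in>{W. v0 \<in> W \<and> W \<subseteq> V - {r}}. \<Sum>s\<in>W. \<Sum>(t1, t2)\<in>{(t1, t2). graft_type t1 t2 = t}.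
    graft_weight u t1 t2 * weight_sum u t1 (V - W) r * weight_sum u t2 W s)"
  proof (intro sum.cong refl)
    fix W s
    have "(\<Sum>E1\<in>trees (V - W). \<Sum>E2\<in>trees W. \<Sum>(t1, t2)\<in>{(t1, t2). graft_type t1 t2 = t}.
        graft_weight u t1 t2 * g (V - W) E1 r t1 * g W E2 s t2) =
      (\<Sum>(t1, t2)\<in>{(t1, t2). graft_type t1 t2 = t}. \<Sum>E1\<in>trees (V - W). \<Sum>E2\<in>trees W.
        graft_weight u t1 t2 * g (V - W) E1 r t1 * g W E2 s t2)"
      unfolding split_def by (subst sum.swap[of _ _ "trees W"], subst sum.swap[of _ _ "trees (V - W)"], rule refl)
    also have "\<dots> = (\<Sum>(t1, t2)\<in>{(t1, t2). graft_type t1 t2 = t}.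
      graft_weight u t1 t2 * weight_sum u t1 (V - W) r * weight_sum u t2 W s)"
    proof (intro sum.cong refl, unfold split_beta)
      fix p :: "rtype \<times> rtype"
      have "graft_weight u (fst p) (snd p) * weight_sum u (fst p) (V - W) r * weight_sum u (snd p) W s =
        graft_weight u (fst p) (snd p) * (\<Sum>E1\<in>trees (V - W). \<Sum>E2\<in>trees W. g (V - W) E1 r (fst p) * g W E2 s (snd p))"
        unfolding weight_sum_def g_def[symmetric] mult.assoc sum_product ..
      also have "\<dots> = (\<Sum>E1\<in>trees (V - W). \<Sum>E2\<in>trees W.
          graft_weight u (fst p) (snd p) * g (V - W) E1 r (fst p) * g W E2 s (snd p))"
        by (simp add: sum_distrib_left mult.assoc)
      finally show "(\<Sum>E1\<in>trees (V - W). \<Sum>E2\<in>trees W.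
          graft_weight u (fst p) (snd p) * g (V - W) E1 r (fst p) * g W E2 s (snd p)) =
        graft_weight u (fst p) (snd p) * weight_sum u (fst p) (V - W) r * weight_sum u (snd p) W s" ..
    qed
    finally show "(\<Sum>E1\<in>trees (V - W). \<Sum>E2\<in>trees W. \<Sum>(t1, t2)\<in>{(t1, t2). graft_type t1 t2 = t}.
        graft_weight u t1 t2 * g (V - W) E1 r t1 * g W E2 s t2) = \<dots>" .
  qed
  finally show ?thesis .
qed

end


lemma sum_subsets_by_card:
  assumes "finite A"
  shows "(\<Sum>B | B \<subseteq> A. f (card B)) = (\<Sum>j\<le>card A. of_nat (card A choose j) * (f j :: 'b :: comm_ring_1))"
proof -
  have "(\<Sum>B | B \<subseteq> A. f (card B)) = (\<Sum>j\<in>{..card A}. \<Sum>B | B \<in> {B. B \<subseteq> A} \<and> card B = j. f (card B))"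
    using assms by (intro sum.group[symmetric]) (auto intro: card_mono)
  also have "\<dots> = (\<Sum>j\<le>card A. of_nat (card A choose j) * f j)"
  proof (intro sum.cong refl)
    fix j
    have "(\<Sum>B | B \<in> {B. B \<subseteq> A} \<and> card B = j. f (card B)) = (\<Sum>B | B \<subseteq> A \<and> card B = j. f j)"
      by (intro sum.cong) auto
    then show "(\<Sum>B | B \<in> {B. B \<subseteq> A} \<and> card B = j. f (card B)) = of_nat (card A choose j) * f j"
      using n_subsets[OF assms, of j] by simp
  qed
  finally show ?thesis .
qed

text \<open>Here \<open>n\<close> counts the vertices besides the root. As
  \<open>tree_count u t n / n!\<close> equals \<open>(n + 1) * tree_count u t n / (n + 1)!\<close>,
  it is the coefficient of \<open>z^(n + 1)\<close> in the exponential generating function of trees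
  rooted at an arbitrary label.\<close>

definition tree_count :: "'b::field \<Rightarrow> rtype \<Rightarrow> nat \<Rightarrow> 'b" where
  "tree_count u t n = weight_sum u t {0..n} (0 :: nat)"

text \<open>The recursion below only depends on cardinalities, so no relabelling of trees is needed.\<close>

lemma weight_sum_step:
  fixes u :: "'b :: field_char_0" and V :: "nat set"
  assumes "u \<noteq> 0" "finite V" "r \<in> V" "card V = Suc (Suc m)"
    and IH: "\<And>(W :: nat set) s t. finite W \<Longrightarrow> s \<in> W \<Longrightarrow> card W < card V \<Longrightarrow> weight_sum u t W s = tree_count u t (card W - 1)"
  shows "weight_sum u t V r = (\<Sum>j\<le>m. of_nat (m choose j) * (of_nat (Suc j) *
     (\<Sum>(t1, t2)\<in>{(t1, t2). graft_type t1 t2 = t}. graft_weight u t1 t2 * tree_count u t1 (m - j) * tree_count u t2 j)))"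
proof -
  have "V - {r} \<noteq> {}" using assms by (metis card.empty card_Suc_Diff1 nat.inject old.nat.distinct(1))
  then obtain v0 where v0: "v0 \<in> V" "r \<noteq> v0" by blast
  interpret rooted_split V r v0 using assms v0 by unfold_locales auto
  define A where "A = V - {r, v0}"
  \<comment> \<open>The branch \<open>W\<close> consists of \<open>v0\<close> and \<open>j\<close>
    of the \<open>m\<close> other non-root vertices. This leaves \<open>j + 1\<close> choices of
    \<open>s\<close>, and \<open>j\<close> and \<open>m - j\<close> non-root vertices in the two
    pieces.\<close>
  define h where "h j = of_nat (Suc j) * (\<Sum>(t1, t2)\<in>{(t1, t2). graft_type t1 t2 = t}.
      graft_weight u t1 t2 * tree_count u t1 (m - j) * tree_count u t2 j)" for j
  have A: "finite A" "card A = m" "v0 \<notin> A"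
    using assms v0 unfolding A_def by (auto simp: card_Diff_subset)
  have inj: "inj_on (insert v0) {B. B \<subseteq> A}"
    using A(3) by (intro inj_onI) (metis insert_ident mem_Collect_eq subset_eq)
  have img: "{W. v0 \<in> W \<and> W \<subseteq> V - {r}} = insert v0 ` {B. B \<subseteq> A}"
  proof (intro equalityI subsetI)
    fix W assume "W \<in> {W. v0 \<in> W \<and> W \<subseteq> V - {r}}"
    then show "W \<in> insert v0 ` {B. B \<subseteq> A}" by (intro image_eqI[of _ _ "W - {v0}"]) (auto simp: A_def)
  qed (use v0 in \<open>auto simp: A_def\<close>)
  have "weight_sum u t V r = (\<Sum>W\<in>{W. v0 \<in> W \<and> W \<subseteq> V - {r}}. h (card W - 1))"
    unfolding weight_sum_split[OF assms(1)]
  proof (intro sum.cong refl)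
    fix W assume W: "W \<in> {W. v0 \<in> W \<and> W \<subseteq> V - {r}}"
    have fW: "finite W" using W assms(2) by (auto intro: finite_subset[of W V])
    have rW: "r \<notin> W" using W by blast
    have c0: "card W > 0" using W fW by (auto simp: card_gt_0_iff)
    have cle: "card W \<le> card (V - {r})" using W assms(2) by (auto intro: card_mono)
    have cr: "card (V - {r}) = Suc m" using assms by simp
    have cd: "card (V - W) = Suc (Suc m) - card W" using W fW assms(4) by (simp add: card_Diff_subset subset_iff)
    have "(\<Sum>(t1, t2)\<in>{(t1, t2). graft_type t1 t2 = t}. graft_weight u t1 t2 * weight_sum u t1 (V - W) r * weight_sum u t2 W s) =
       (\<Sum>(t1, t2)\<in>{(t1, t2). graft_type t1 t2 = t}. graft_weight u t1 t2 * tree_count u t1 (m - (card W - 1)) * tree_count u t2 (card W - 1))"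
      if "s \<in> W" for s
    proof -
      have "weight_sum u t1 (V - W) r = tree_count u t1 (m - (card W - 1))" for t1
        using IH[of "V - W" r t1] assms(2,3,4) W rW cd cle cr c0 by (simp add: Suc_diff_le)
      moreover have "weight_sum u t2 W s = tree_count u t2 (card W - 1)" for t2
        using IH[of W s t2] fW that cle cr assms(4) by simp
      ultimately show ?thesis by simp
    qed
    then show "(\<Sum>s\<in>W. \<Sum>(t1, t2)\<in>{(t1, t2). graft_type t1 t2 = t}. graft_weight u t1 t2 * weight_sum u t1 (V - W) r * weight_sum u t2 W s)
      = h (card W - 1)"
      using c0 by (simp add: h_def del: of_nat_Suc)
  qed
  also have "\<dots> = (\<Sum>B | B \<subseteq> A. h (card B))"
    unfolding img sum.reindex[OF inj] o_def
  proof (intro sum.cong refl)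
    fix B assume "B \<in> {B. B \<subseteq> A}"
    then have "finite B" "v0 \<notin> B" using A by (auto intro: finite_subset)
    then show "h (card (insert v0 B) - 1) = h (card B)" by simp
  qed
  also have "\<dots> = (\<Sum>j\<le>m. of_nat (m choose j) * h j)"
    using sum_subsets_by_card[OF A(1)] A(2) by simp
  finally show ?thesis by (simp add: h_def)
qed

lemma weight_sum_eq_tree_count:
  fixes u :: "'b :: field_char_0" and V :: "nat set"
  assumes "u \<noteq> 0" "finite V" "r \<in> V"
  shows "weight_sum u t V r = tree_count u t (card V - 1)"
  using assms(2,3)
proof (induction "card V" arbitrary: V r t rule: less_induct)
  case less
  show ?case
  proof (cases "card V = 1")
    case True
    then have "V = {r}" using less.prems by (metis card_1_singletonE singletonD)
    then show ?thesis by (simp add: tree_count_def weight_sum_singleton)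
  next
    case False
    then have "card V \<noteq> 0" "card V \<noteq> Suc 0" using less.prems by auto
    then obtain m where m: "card V = Suc (Suc m)" by (metis nat.exhaust)
    have IH: "weight_sum u t W s = tree_count u t (card W - 1)" if "finite W" "s \<in> W" "card W < card V"
      for W :: "nat set" and s t
      using less.hyps that by blast
    \<comment> \<open>The step lemma is applied to \<open>V\<close> forwards and to the standard set
      of the same size backwards; both sums agree term by term.\<close>
    have "weight_sum u t V r = weight_sum u t {0..Suc m} 0"
    proof (rule trans[OF weight_sum_step weight_sum_step[symmetric]])
      show "weight_sum u t W s = tree_count u t (card W - 1)" if "finite W" "s \<in> W" "card W < card {0..Suc m}"
        for W :: "nat set" and s t
        using IH that m by simp
    qed (use assms(1) less.prems m IH in auto)
    then show ?thesis using m by (simp add: tree_count_def)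
  qed
qed

lemma tree_count_0: "tree_count u t 0 = (if t = TL then 1 else 0)"
  by (simp add: tree_count_def weight_sum_singleton)

lemma tree_count_Suc:
  fixes u :: "'b :: field_char_0"
  assumes "u \<noteq> 0"
  shows "tree_count u t (Suc m) = (\<Sum>j\<le>m. of_nat (m choose j) * (of_nat (Suc j) *
     (\<Sum>(t1, t2)\<in>{(t1, t2). graft_type t1 t2 = t}. graft_weight u t1 t2 * tree_count u t1 (m - j) * tree_count u t2 j)))"
  unfolding tree_count_def[of u t "Suc m"]
  by (rule weight_sum_step[OF assms]) (use weight_sum_eq_tree_count[OF assms] in auto)

lemma sum_rtype: "(\<Sum>t\<in>UNIV. f t) = f TL + f Tb + f Tc + f (Td :: rtype)"
  by (simp add: UNIV_rtype add.assoc)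

lemma sum_trees_power:
  fixes u :: "'b :: field_char_0" and V :: "nat set"
  assumes "u \<noteq> 0" "finite V" "r \<in> V"
  shows "(\<Sum>E\<in>trees V. u ^ snd (tree_class V E r)) = (\<Sum>t\<in>UNIV. tree_count u t (card V - 1))"
proof -
  have "(\<Sum>t\<in>UNIV. tree_count u t (card V - 1)) = (\<Sum>t\<in>UNIV. weight_sum u t V r)"
    using weight_sum_eq_tree_count[OF assms] by simp
  also have "\<dots> = (\<Sum>E\<in>trees V. \<Sum>t\<in>UNIV. if fst (tree_class V E r) = t then u ^ snd (tree_class V E r) else 0)"
    unfolding weight_sum_def by (rule sum.swap)
  also have "\<dots> = (\<Sum>E\<in>trees V. u ^ snd (tree_class V E r))" by simp
  finally show ?thesis by simp
qed


subsection \<open>Labelled trees\<close>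

context pair_graph
begin

lemma sym_parcs: "sym (parcs G)"
  using pair_sym_arcs by (simp add: symmetric_def)

lemma rtrancl_awalk:
  assumes "(u, v) \<in> R\<^sup>*" "R \<subseteq> parcs G" "u \<in> pverts G"
  shows "\<exists>p. awalk u p v \<and> set p \<subseteq> R"
  using assms(1)
proof (induction rule: rtrancl_induct)
  case base
  then show ?case using assms(3) by (intro exI[of _ "[]"]) (simp add: awalk_def)
next
  case (step y z)
  then obtain p where p: "awalk u p y" "set p \<subseteq> R" by blast
  have "awalk y [(y, z)] z"
    using step(2) assms(2) arc_fst_in_verts[of "(y, z)"] by (auto simp: awalk_def)
  then have "awalk u (p @ [(y, z)]) z" using p(1) by (auto intro: awalk_appendI)
  then show ?case using p step(2) by (intro exI[of _ "p @ [(y, z)]"]) auto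
qed

lemma pawalk_verts_snd: "pcas x q y \<Longrightarrow> pawalk_verts x q = x # map snd q"
  by (induction q arbitrary: x) auto

lemma pcas_rtrancl: "pcas x q y \<Longrightarrow> set q \<subseteq> R \<Longrightarrow> (x, y) \<in> R\<^sup>*"
  by (induction q arbitrary: x) (auto intro: converse_rtrancl_into_rtrancl)

lemma pcas_last: "pcas x q y \<Longrightarrow> q \<noteq> [] \<Longrightarrow> y \<in> set (map snd q)"
proof (induction q arbitrary: x)
  case (Cons e q)
  then show ?case by (cases "q = []") auto
qed simp

text \<open>A detour around an edge, shortened to a simple path and closed by the edge, is a cycle
  of length at least 3. Conversely, the remainder of a long cycle is a detour around its first
  arc.\<close>

lemma no_long_cycle_iff_bridges:
  "(\<nexists>p. cycle p \<and> length p \<ge> 3) \<longleftrightarrow>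
    (\<forall>u v. (u, v) \<in> parcs G \<longrightarrow> (u, v) \<notin> (parcs G - {(u, v), (v, u)})\<^sup>*)"
proof (intro iffI allI impI notI)
  fix u v assume *: "\<nexists>p. cycle p \<and> length p \<ge> 3" and uv: "(u, v) \<in> parcs G"
    and reach: "(u, v) \<in> (parcs G - {(u, v), (v, u)})\<^sup>*"
  have u: "u \<in> pverts G" using arc_fst_in_verts[OF uv] by simp
  have vu: "(v, u) \<in> parcs G" using uv sym_parcs by (auto dest: symD)
  have ne: "u \<noteq> v" using pair_no_loops[OF uv] by simp
  obtain p where p: "awalk u p v" "set p \<subseteq> parcs G - {(u, v), (v, u)}"
    using rtrancl_awalk[OF reach _ u] by blast
  define q where "q = awalk_to_apath p"
  have q: "apath u q v" "set q \<subseteq> parcs G - {(u, v), (v, u)}"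
    using apath_awalk_to_apath[OF p(1)] awalk_to_apath_subset[OF p(1)] p(2) by (auto simp: q_def)
  have c: "pcas u q v" and d: "distinct (u # map snd q)"
    using q(1) pawalk_verts_snd[of u q v] by (auto simp: apath_def awalk_def)
  have len: "length q \<ge> 2"
  proof (rule ccontr)
    assume "\<not> length q \<ge> 2"
    then consider "q = []" | e where "q = [e]" by (cases q) (auto simp: Suc_le_eq)
    then show False
      using c q(2) ne by cases auto
  qed
  have "awalk u (q @ [(v, u)]) u"
  proof -
    have "awalk v [(v, u)] u" using vu arc_fst_in_verts[OF vu] by (auto simp: awalk_def)
    then show ?thesis using q(1) by (auto simp: apath_def intro: awalk_appendI)
  qed
  moreover from this have "pawalk_verts u (q @ [(v, u)]) = u # map snd (q @ [(v, u)])"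
    by (intro pawalk_verts_snd) (auto simp: awalk_def)
  ultimately have "cycle (q @ [(v, u)])" using d by (auto simp: cycle_def)
  then show False using * len by auto
next
  assume *: "\<forall>u v. (u, v) \<in> parcs G \<longrightarrow> (u, v) \<notin> (parcs G - {(u, v), (v, u)})\<^sup>*"
    and "\<exists>p. cycle p \<and> 3 \<le> length p"
  then obtain p where p: "cycle p" "length p \<ge> 3" by blast
  then obtain u where w: "awalk u p u" and d: "distinct (tl (pawalk_verts u p))"
    by (auto simp: cycle_def)
  obtain e q where pq: "p = e # q" using p by (cases p) auto
  obtain w where e: "e = (u, w)" using w pq by (cases e) (auto simp: awalk_def)
  have c: "pcas w q u" and arcs: "set q \<subseteq> parcs G" "(u, w) \<in> parcs G"
    using w pq e by (auto simp: awalk_def)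
  have d': "distinct (w # map snd q)" using d pawalk_verts_snd[OF c] pq e by simp
  have "(u, w) \<notin> set q" using d' by force
  \<comment> \<open>If the reverse arc occurred, distinctness of the vertices would reduce the cycle
    to \<open>u, w, u\<close>, which has length 2.\<close>
  moreover have "(w, u) \<notin> set q"
  proof
    assume "(w, u) \<in> set q"
    then obtain q1 q2 where q: "q = q1 @ (w, u) # q2" by (meson split_list)
    have "pcas w q1 w \<and> pcas u q2 u"
      using c unfolding q by (induction q1 arbitrary: w) auto
    then have "q1 = []" "q2 = []" using pcas_last[of w q1 w] pcas_last[of u q2 u] d' q by auto
    then show False using p(2) pq q by simp
  qed
  ultimately have "(w, u) \<in> (parcs G - {(w, u), (u, w)})\<^sup>*"
    using arcs by (intro pcas_rtrancl[OF c]) auto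
  then show False using * arcs(2) sym_parcs by (auto dest: symD)
qed

lemma connected_iff:
  "Digraph_Component.connected (with_proj G) \<longleftrightarrow>
    pverts G \<noteq> {} \<and> (\<forall>u\<in>pverts G. \<forall>v\<in>pverts G. (u, v) \<in> (parcs G)\<^sup>*)"
proof -
  have m: "parcs (mk_symmetric (with_proj G)) = parcs G" "pverts (mk_symmetric (with_proj G)) = pverts G"
    using sym_parcs unfolding mk_symmetric_def by (auto dest: symD)
  have "(u, v) \<in> rtrancl_on (pverts G) (parcs G) \<longleftrightarrow> (u, v) \<in> (parcs G)\<^sup>*" if "u \<in> pverts G" for u v
  proof
    assume "(u, v) \<in> rtrancl_on (pverts G) (parcs G)"
    then show "(u, v) \<in> (parcs G)\<^sup>*" by (induction rule: rtrancl_on_induct) (auto intro: rtrancl_into_rtrancl)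
  next
    assume "(u, v) \<in> (parcs G)\<^sup>*"
    then show "(u, v) \<in> rtrancl_on (pverts G) (parcs G)"
    proof (induction rule: rtrancl_induct)
      case (step y z)
      then show ?case using arc_snd_in_verts[of "(y, z)"] by (auto intro: rtrancl_on_into_rtrancl_on)
    qed (use that in auto)
  qed
  then show ?thesis
    unfolding connected_def strongly_connected_def reachable_def by (simp add: m)
qed

end

lemma labelled_trees_iff:
  assumes "n \<ge> 1"
  shows "T \<in> labelled_trees n \<longleftrightarrow> pverts T = {1..n} \<and> parcs T \<in> trees {1..n}"
proof
  assume T: "T \<in> labelled_trees n"
  then interpret pair_graph T by (simp add: labelled_trees_def)
  have v: "pverts T = {1..n}" using T by (simp add: labelled_trees_def)
  have "parcs T \<subseteq> {1..n} \<times> {1..n}"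
    using arc_fst_in_verts arc_snd_in_verts v by force
  then show "pverts T = {1..n} \<and> parcs T \<in> trees {1..n}"
    using T assms connected_iff no_long_cycle_iff_bridges sym_parcs v
    unfolding labelled_trees_def trees_def is_tree_def by auto
next
  assume T: "pverts T = {1..n} \<and> parcs T \<in> trees {1..n}"
  then have E: "parcs T \<subseteq> {1..n} \<times> {1..n}" "sym (parcs T)"
    and b: "\<And>u v. (u, v) \<in> parcs T \<Longrightarrow> (u, v) \<notin> (parcs T - {(u, v), (v, u)})\<^sup>*"
    by (auto simp: trees_def is_tree_def)
  have "u \<noteq> v" if "(u, v) \<in> parcs T" for u v using b[OF that] by auto
  then interpret pair_graph T
    using T E by unfold_locales (auto simp: symmetric_def finite_subset)
  show "T \<in> labelled_trees n"
    using T connected_iff no_long_cycle_iff_bridges pair_graph_axioms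
    unfolding labelled_trees_def trees_def is_tree_def by auto
qed

lemma bij_labelled_trees:
  assumes "n \<ge> 1"
  shows "bij_betw parcs (labelled_trees n) (trees {1..n})"
proof (rule bij_betw_byWitness[where f' = "\<lambda>E. \<lparr>pverts = {1..n}, parcs = E\<rparr>"])
  show "\<forall>T\<in>labelled_trees n. \<lparr>pverts = {1..n}, parcs = parcs T\<rparr> = T"
    using labelled_trees_iff[OF assms] by (metis pair_pre_digraph.surjective old.unit.exhaust)
qed (auto simp: labelled_trees_iff[OF assms])

text \<open>A set whose induced subgraph has a perfect matching is the union of a matching of the
  tree, so minimising over sets amounts to minimising over matchings.\<close>

lemma paired_dominating_set_iff:
  "paired_dominating_set (with_proj T) S \<longleftrightarrow> (\<exists>M. S \<subseteq> pverts T \<and> matching_in (parcs T) M \<and> S = \<Union>M \<and>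
     (\<forall>v\<in>pverts T. dominated (parcs T) S v))"
proof -
  have ed: "edges (with_proj T) = (\<lambda>(u, v). {u, v}) ` parcs T" for T :: "'a pair_pre_digraph"
    by (auto simp: edges_def arcs_ends_def arc_to_ends_def image_iff)
  have ind: "edges (induce_subgraph (with_proj T) S) = (\<lambda>(u, v). {u, v}) ` {(u, v). (u, v) \<in> parcs T \<and> u \<in> S \<and> v \<in> S}"
    "verts (induce_subgraph (with_proj T) S) = S"
    by (auto simp: edges_def arcs_ends_def arc_to_ends_def induce_subgraph_def image_iff)
  have "perfect_matching (induce_subgraph (with_proj T) S) M \<longleftrightarrow> matching_in (parcs T) M \<and> S = \<Union>M" for M
  proof
    assume pm: "perfect_matching (induce_subgraph (with_proj T) S) M"
    then have M: "M \<subseteq> (\<lambda>(u, v). {u, v}) ` {(u, v). (u, v) \<in> parcs T \<and> u \<in> S \<and> v \<in> S}"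
      and un: "\<And>v. v \<in> S \<Longrightarrow> \<exists>!e. e \<in> M \<and> v \<in> e"
      unfolding perfect_matching_def ind by auto
    have S: "S = \<Union>M" using M un by fastforce
    have "disjnt e f" if "e \<in> M" "f \<in> M" "e \<noteq> f" for e f
    proof (rule ccontr)
      assume "\<not> disjnt e f"
      then obtain v where v: "v \<in> e" "v \<in> f" by (auto simp: disjnt_def)
      then have "v \<in> S" using S that by blast
      then show False using un[of v] v that by blast
    qed
    then show "matching_in (parcs T) M \<and> S = \<Union>M"
      using M S unfolding matching_in_def pairwise_def by auto
  next
    assume *: "matching_in (parcs T) M \<and> S = \<Union>M"
    then have M: "M \<subseteq> (\<lambda>(u, v). {u, v}) ` parcs T" and d: "pairwise disjnt M" and S: "S = \<Union>M"
      by (auto simp: matching_in_def)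
    have "M \<subseteq> (\<lambda>(u, v). {u, v}) ` {(u, v). (u, v) \<in> parcs T \<and> u \<in> S \<and> v \<in> S}"
    proof
      fix e assume e: "e \<in> M"
      then obtain u v where uv: "(u, v) \<in> parcs T" "e = {u, v}" using M by auto
      then have "u \<in> S" "v \<in> S" using e S by auto
      then show "e \<in> (\<lambda>(u, v). {u, v}) ` {(u, v). (u, v) \<in> parcs T \<and> u \<in> S \<and> v \<in> S}"
        using uv by (intro image_eqI[of _ _ "(u, v)"]) auto
    qed
    moreover have "\<exists>!e. e \<in> M \<and> v \<in> e" if v: "v \<in> S" for v
    proof -
      obtain e where e: "e \<in> M" "v \<in> e" using v S by blast
      have "f = e" if "f \<in> M" "v \<in> f" for f
        using pairwiseD[OF d that(1) e(1)] that e by (auto simp: disjnt_def)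
      then show ?thesis using e by blast
    qed
    ultimately show "perfect_matching (induce_subgraph (with_proj T) S) M"
      unfolding perfect_matching_def ind by auto
  qed
  note pm = this
  have "arcs_ends (with_proj T) = parcs T"
    by (auto simp: arcs_ends_def arc_to_ends_def image_iff)
  then have dom: "(\<forall>v\<in>verts (with_proj T) - S. \<exists>u\<in>S. (v, u) \<in> arcs_ends (with_proj T)) \<longleftrightarrow>
      (\<forall>v\<in>pverts T. dominated (parcs T) S v)"
    by (auto simp: dominated_def)
  show ?thesis
    unfolding paired_dominating_set_def pm dom by (simp del: Sup_le_iff ex_simps add: ex_simps[symmetric] conj_ac)
qed

lemma card_Union_matching:
  assumes "matching_in E M" "finite E" "\<And>v. (v, v) \<notin> E"
  shows "card (\<Union>M) = 2 * card M"
proof -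
  have "card (\<Union>M) = sum card M"
  proof (rule card_Union_disjoint)
    show "finite A" if "A \<in> M" for A using assms(1) that by (auto simp: matching_in_def)
  qed (use assms(1) in \<open>simp add: matching_in_def disjoint_def disjnt_def pairwise_def\<close>)
  also have "\<dots> = (\<Sum>e\<in>M. 2)"
  proof (intro sum.cong refl)
    fix e assume "e \<in> M"
    then obtain u v where "(u, v) \<in> E" "e = {u, v}" using assms(1) by (auto simp: matching_in_def)
    moreover from this have "u \<noteq> v" using assms(3) by auto
    ultimately show "card e = 2" by simp
  qed
  finally show ?thesis by simp
qed

text \<open>The root of the whole tree has no parent, so only the kinds A and C count. Types
  \<open>Tb\<close>, \<open>Tc\<close> and \<open>Td\<close> attain \<open>k\<close> there; type
  \<open>TL\<close> attains only \<open>k + 1\<close>, which requires a second vertex.\<close>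

lemma paired_domination_number_bounds:
  assumes "n \<ge> 2" "T \<in> labelled_trees n"
  defines "k \<equiv> snd (tree_class {1..n} (parcs T) 1)"
  shows "2 * k \<le> paired_domination_number (with_proj T)" "paired_domination_number (with_proj T) \<le> 2 * k + 2"
proof -
  let ?V = "{1..n}" and ?E = "parcs T"
  have T: "pverts T = ?V" "is_tree ?V ?E"
    using labelled_trees_iff[of n T] assms(1,2) by (auto simp: trees_def)
  have E: "?E \<subseteq> ?V \<times> ?V" using T(2) unfolding is_tree_def by simp
  have finE: "finite ?E" by (rule finite_subset[OF E]) simp
  have irr: "(v, v) \<notin> ?E" for v using T(2) unfolding is_tree_def by blast
  let ?A = "sizesA ?V ?E 1" and ?C = "sizesC ?V ?E 1"
  have iff: "(\<exists>S. paired_dominating_set (with_proj T) S \<and> card S = m) \<longleftrightarrow> (\<exists>j\<in>?A \<union> ?C. m = 2 * j)" for m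
  proof
    assume "\<exists>S. paired_dominating_set (with_proj T) S \<and> card S = m"
    then obtain M where M: "matching_in ?E M" "card (\<Union>M) = m" "\<forall>v\<in>?V. dominated ?E (\<Union>M) v"
      unfolding paired_dominating_set_iff T by blast
    have "card M \<in> ?A \<union> ?C"
      using M sizesA_I[of ?E M 1 ?V "card M"] sizesC_I[of ?E M 1 ?V "card M"] by blast
    then show "\<exists>j\<in>?A \<union> ?C. m = 2 * j" using card_Union_matching[OF M(1) finE irr] M(2) by auto
  next
    assume "\<exists>j\<in>?A \<union> ?C. m = 2 * j"
    then obtain M where M: "matching_in ?E M" "\<forall>v\<in>?V. dominated ?E (\<Union>M) v" "m = 2 * card M"
      unfolding sizesA_def sizesC_def by blast
    have "\<Union>M \<subseteq> ?V" using M(1) E unfolding matching_in_def by fastforce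
    then have "paired_dominating_set (with_proj T) (\<Union>M)"
      unfolding paired_dominating_set_iff T using M by blast
    then show "\<exists>S. paired_dominating_set (with_proj T) S \<and> card S = m"
      using card_Union_matching[OF M(1) finE irr] M(3) by auto
  qed
  have wt: "well_typed ?V ?E 1" using tree_well_typed[OF T(2), of 1] assms(1) by simp
  obtain t where t: "tree_class ?V ?E 1 = (t, k)" unfolding k_def by (cases "tree_class ?V ?E 1") auto
  have ht: "has_type t True k ?A (sizesB ?V ?E 1) ?C (sizesD ?V ?E 1)"
    using wt assms(1) unfolding well_typed_def t by simp
  have low: "k \<le> j" if "j \<in> ?A \<union> ?C" for j using has_type_least(2)[OF ht] that by blast
  have "k \<in> ?A \<union> ?C \<or> k + 1 \<in> ?A \<union> ?C" using ht by (cases t) auto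
  then obtain j where j: "j \<in> ?A \<union> ?C" "j \<le> k + 1" by (metis le_add1 order_refl)
  have "\<exists>S. paired_dominating_set (with_proj T) S \<and> card S = 2 * j" using iff j by blast
  then have "paired_domination_number (with_proj T) \<le> 2 * j"
    unfolding paired_domination_number_def by (rule Least_le)
  then show "paired_domination_number (with_proj T) \<le> 2 * k + 2" using j(2) by simp
  have "\<exists>S. paired_dominating_set (with_proj T) S \<and> card S = paired_domination_number (with_proj T)"
    unfolding paired_domination_number_def
    by (rule LeastI[of "\<lambda>k. \<exists>S. paired_dominating_set (with_proj T) S \<and> card S = k" "2 * j"]) fact
  then obtain i where "i \<in> ?A \<union> ?C" "paired_domination_number (with_proj T) = 2 * i"
    using iff by blast
  then show "2 * k \<le> paired_domination_number (with_proj T)" using low by simp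
qed


subsection \<open>Majorants\<close>

text \<open>For \<open>X\<close> and \<open>u\<close> in the discs of radii \<open>xmax\<close> and \<open>umax\<close>, the map \<open>cstep\<close> below is a contraction of the disc of
  radius \<open>cmax\<close>. The critical value of \<open>X\<close> is about 0.4085.\<close>

abbreviation (input) xmax :: real where "xmax \<equiv> 21 / 50"
abbreviation (input) umax :: real where "umax \<equiv> 101 / 100"
abbreviation (input) cmax :: real where "cmax \<equiv> 7 / 20"

text \<open>Every function with a convergent double power series with nonnegative coefficients
  satisfies this. The inequality keeps what is used of such series and is preserved by sums,
  products, exponential tails and pointwise limits.\<close>

definition majorant :: "(complex \<Rightarrow> complex \<Rightarrow> complex) \<Rightarrow> bool" where
  "majorant f \<longleftrightarrow> (\<forall>X u x v. cmod X \<le> x \<and> x \<le> xmax \<and> cmod u \<le> v \<and> v \<le> umax \<longrightarrow>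
     cmod (f X u) \<le> Re (f (of_real x) (of_real v)))"

lemma majorantD:
  "majorant f \<Longrightarrow> cmod X \<le> x \<Longrightarrow> x \<le> xmax \<Longrightarrow> cmod u \<le> v \<Longrightarrow> v \<le> umax \<Longrightarrow>
     cmod (f X u) \<le> Re (f (of_real x) (of_real v))"
  by (simp add: majorant_def)

text \<open>A complex number whose modulus is at most its real part is real and nonnegative.\<close>

lemma majorant_real:
  assumes "majorant f" "0 \<le> x" "x \<le> xmax" "0 \<le> v" "v \<le> umax"
  shows "f (of_real x) (of_real v) = of_real (Re (f (of_real x) (of_real v)))" "0 \<le> Re (f (of_real x) (of_real v))"
proof -
  let ?z = "f (of_real x) (of_real v)"
  have le: "cmod ?z \<le> Re ?z" using assms by (intro majorantD) auto
  then show "0 \<le> Re ?z" using norm_ge_zero order_trans by blast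
  have "(Re ?z)\<^sup>2 + (Im ?z)\<^sup>2 \<le> (Re ?z)\<^sup>2"
    using power_mono[OF le norm_ge_zero, of 2] by (simp add: cmod_power2)
  then show "?z = of_real (Re ?z)" by (simp add: complex_eq_iff)
qed

lemma majorant_of_real: "0 \<le> a \<Longrightarrow> majorant (\<lambda>X u. of_real a)"
  and majorant_fst: "majorant (\<lambda>X u. X)"
  and majorant_snd: "majorant (\<lambda>X u. u)"
  by (auto simp: majorant_def)

lemma majorant_add: "majorant f \<Longrightarrow> majorant g \<Longrightarrow> majorant (\<lambda>X u. f X u + g X u)"
  unfolding majorant_def by (auto intro!: order_trans[OF norm_triangle_ineq] add_mono)

lemma majorant_mult:
  assumes "majorant f" "majorant g"
  shows "majorant (\<lambda>X u. f X u * g X u)"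
  unfolding majorant_def
proof (intro allI impI)
  fix X u x v assume h: "cmod X \<le> x \<and> x \<le> xmax \<and> cmod u \<le> v \<and> v \<le> umax"
  have x: "0 \<le> x" "x \<le> xmax" "0 \<le> v" "v \<le> umax" using h norm_ge_zero order_trans by blast+
  let ?f = "f (of_real x) (of_real v)" and ?g = "g (of_real x) (of_real v)"
  have "cmod (f X u * g X u) \<le> Re ?f * Re ?g"
    unfolding norm_mult using h assms majorant_real(2)[OF assms(1) x]
    by (intro mult_mono majorantD) auto
  also have "\<dots> = Re (?f * ?g)"
    using majorant_real(1)[OF assms(1) x] majorant_real(1)[OF assms(2) x]
    by (metis Re_complex_of_real of_real_mult)
  finally show "cmod (f X u * g X u) \<le> Re (?f * ?g)" .
qed

text \<open>Tails of the exponential series keep nonnegative coefficients after the low-order terms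
  are split off.\<close>

definition exp_tail :: "nat \<Rightarrow> 'a::{real_normed_field,banach} \<Rightarrow> 'a" where
  "exp_tail n z = exp z - (\<Sum>k<n. z ^ k / fact k)"

lemma exp_tail_sums: "(\<lambda>k. z ^ (k + n) / fact (k + n)) sums exp_tail n z" for z :: "'a::{real_normed_field,banach}"
proof -
  have "(\<lambda>k. z ^ k / fact k) sums exp z"
    using exp_converges[of z] by (simp add: scaleR_conv_of_real field_simps)
  then show ?thesis unfolding exp_tail_def by (rule sums_split_initial_segment)
qed

lemma norm_exp_tail: "norm (exp_tail n z) \<le> exp_tail n (norm z)" for z :: complex
proof -
  have "norm (exp_tail n z) \<le> (\<Sum>k. norm (z ^ (k + n) / fact (k + n)))"
    unfolding sums_unique[OF exp_tail_sums]
    using sums_summable[OF exp_tail_sums[of "norm z" n]] by (intro summable_norm) (simp add: norm_divide norm_power)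
  also have "\<dots> = exp_tail n (norm z)"
    unfolding sums_unique[OF exp_tail_sums] by (simp add: norm_divide norm_power)
  finally show ?thesis .
qed

lemma exp_tail_mono:
  assumes "0 \<le> x" "x \<le> (y :: real)" shows "exp_tail n x \<le> exp_tail n y"
  by (rule sums_le[OF _ exp_tail_sums exp_tail_sums]) (use assms in \<open>auto intro!: divide_right_mono power_mono\<close>)

lemma exp_tail_of_real: "exp_tail n (of_real x :: complex) = of_real (exp_tail n x)"
  by (simp add: exp_tail_def exp_of_real)

lemma exp_tail_simps:
  "exp_tail 0 z = exp z" "exp_tail (Suc 0) z = exp z - 1" "exp_tail 1 z = exp z - 1" "exp_tail 2 z = exp z - 1 - z"
  "exp_tail 3 z = exp z - 1 - z - z\<^sup>2 / 2"
  by (simp_all add: exp_tail_def numeral_eq_Suc)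

lemma majorant_exp_tail:
  assumes "majorant f" shows "majorant (\<lambda>X u. exp_tail n (f X u))"
  unfolding majorant_def
proof (intro allI impI)
  fix X u x v assume h: "cmod X \<le> x \<and> x \<le> xmax \<and> cmod u \<le> v \<and> v \<le> umax"
  have x: "0 \<le> x" "x \<le> xmax" "0 \<le> v" "v \<le> umax" using h norm_ge_zero order_trans by blast+
  let ?f = "f (of_real x) (of_real v)"
  have "cmod (exp_tail n (f X u)) \<le> exp_tail n (cmod (f X u))" by (rule norm_exp_tail)
  also have "\<dots> \<le> exp_tail n (Re ?f)" using h assms by (intro exp_tail_mono majorantD) auto
  also have "\<dots> = Re (exp_tail n ?f)"
    using majorant_real(1)[OF assms x] exp_tail_of_real by (metis Re_complex_of_real)
  finally show "cmod (exp_tail n (f X u)) \<le> Re (exp_tail n ?f)" .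
qed

lemmas majorant_exp = majorant_exp_tail[where n = 0, unfolded exp_tail_simps]
lemmas majorant_exp_minus_1 = majorant_exp_tail[where n = 1, unfolded exp_tail_simps]

lemma majorant_lim:
  assumes "\<And>k. majorant (f k)"
    and "\<And>X u. cmod X \<le> xmax \<Longrightarrow> cmod u \<le> umax \<Longrightarrow> (\<lambda>k. f k X u) \<longlonglongrightarrow> g X u"
  shows "majorant g"
  unfolding majorant_def
proof (intro allI impI)
  fix X u x v assume h: "cmod X \<le> x \<and> x \<le> xmax \<and> cmod u \<le> v \<and> v \<le> umax"
  have x: "0 \<le> x" "0 \<le> v" using h norm_ge_zero order_trans by blast+
  show "cmod (g X u) \<le> Re (g (of_real x) (of_real v))"
  proof (rule tendsto_le[OF sequentially_bot])
    show "(\<lambda>k. cmod (f k X u)) \<longlonglongrightarrow> cmod (g X u)" using h by (intro tendsto_norm assms(2)) auto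
    show "(\<lambda>k. Re (f k (of_real x) (of_real v))) \<longlonglongrightarrow> Re (g (of_real x) (of_real v))"
      using h x by (intro tendsto_Re assms(2)) auto
    show "\<forall>\<^sub>F k in sequentially. cmod (f k X u) \<le> Re (f k (of_real x) (of_real v))"
      using h assms(1) by (intro always_eventually allI majorantD) auto
  qed
qed

subsection \<open>Bounds for the exponential function\<close>

lemma exp_bounds:
  assumes "0 \<le> x" "x \<le> (1 :: real)"
  shows "(\<Sum>k<n. x ^ k / fact k) \<le> exp x" "exp x \<le> (\<Sum>k<n. x ^ k / fact k) + 3 * x ^ n / fact n"
proof -
  obtain t where t: "\<bar>t\<bar> \<le> \<bar>x\<bar>" "exp x = (\<Sum>m<n. x ^ m / fact m) + exp t / fact n * x ^ n"
    using Maclaurin_exp_le[of x n] by blast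
  have "exp t \<le> exp 1" using t assms by auto
  then have "exp t \<le> 3" using exp_le by linarith
  then have "exp t / fact n * x ^ n \<le> 3 * x ^ n / fact n" "0 \<le> exp t / fact n * x ^ n"
    using assms by (simp_all add: field_simps mult_right_mono)
  then show "(\<Sum>k<n. x ^ k / fact k) \<le> exp x" "exp x \<le> (\<Sum>k<n. x ^ k / fact k) + 3 * x ^ n / fact n"
    using t(2) by simp_all
qed

text \<open>The arguments 0.42 and 0.35 are the radii for \<open>X\<close> and the fixpoint; 0.3143
  bounds the inner exponent in \<open>cstep\<close>.\<close>

lemma exp_xmax: "exp xmax \<le> 761 / 500" and exp_cmax: "exp cmax \<le> 14191 / 10000" and exp_3143: "exp (3143 / 10000) \<le> (13694 / 10000 :: real)"
proof -
  have "exp xmax \<le> (\<Sum>k<8. (xmax) ^ k / fact k) + 3 * (xmax) ^ 8 / fact 8" by (rule exp_bounds) auto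
  also have "\<dots> \<le> 761 / 500" by (simp add: eval_nat_numeral)
  finally show "exp xmax \<le> 761 / 500" .
  have "exp cmax \<le> (\<Sum>k<8. (cmax) ^ k / fact k) + 3 * (cmax) ^ 8 / fact 8" by (rule exp_bounds) auto
  also have "\<dots> \<le> 14191 / 10000" by (simp add: eval_nat_numeral)
  finally show "exp cmax \<le> 14191 / 10000" .
  have "exp (3143 / 10000) \<le> (\<Sum>k<8. (3143 / 10000) ^ k / fact k) + 3 * (3143 / 10000) ^ 8 / (fact 8 :: real)" by (rule exp_bounds) auto
  also have "\<dots> \<le> 13694 / 10000" by (simp add: eval_nat_numeral)
  finally show "exp (3143 / 10000) \<le> (13694 / 10000 :: real)" .
qed

subsection \<open>The implicit function\<close>

text \<open>The equation for \<open>C\<close> with \<open>B\<close> eliminated, written for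
  \<open>y = C\<close>.\<close>

definition cstep :: "complex \<Rightarrow> complex \<Rightarrow> complex \<Rightarrow> complex" where
  "cstep X u y = X * exp (X + y) * (exp (u * X * exp y * (exp X - 1)) - 1)"

lemma majorant_cstep:
  assumes "majorant f" shows "majorant (\<lambda>X u. cstep X u (f X u))"
  unfolding cstep_def
  by (intro majorant_mult majorant_exp majorant_exp_minus_1 majorant_add majorant_fst majorant_snd assms)

text \<open>The numbers round up 1.01 * 0.42 * 1.4191 * 0.522 and 0.42 * 1.522 * 1.4191. The disc is
  mapped into itself because 0.9072 * 0.3694 < 0.35.\<close>

lemma cstep_bounds:
  assumes "cmod X \<le> xmax" "cmod u \<le> umax" "cmod y \<le> cmax"
  shows "cmod (u * X * exp y * (exp X - 1)) \<le> 3143 / 10000" "cmod (X * exp (X + y)) \<le> 9072 / 10000"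
    "cmod (cstep X u y) \<le> cmax"
proof -
  have y: "cmod (exp y) \<le> 14191 / 10000" using norm_exp[of y] exp_cmax assms(3) by (meson exp_le_cancel_iff order_trans)
  have X: "cmod (exp X) \<le> 761 / 500" using norm_exp[of X] exp_xmax assms(1) by (meson exp_le_cancel_iff order_trans)
  have "cmod (exp X - 1) \<le> exp (cmod X) - 1" using norm_exp_tail[of 1 X] by (simp add: exp_tail_simps)
  also have "\<dots> \<le> 522 / 1000" using assms(1) exp_xmax exp_le_cancel_iff[of "cmod X" xmax] by linarith
  finally have X1: "cmod (exp X - 1) \<le> 522 / 1000" .
  have "cmod (u * X * exp y * (exp X - 1)) \<le> umax * xmax * (14191 / 10000) * (522 / 1000)"
    unfolding norm_mult by (intro mult_mono mult_nonneg_nonneg norm_ge_zero assms y X1) auto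
  then show E: "cmod (u * X * exp y * (exp X - 1)) \<le> 3143 / 10000" by simp
  have "cmod (X * exp (X + y)) \<le> xmax * ((761 / 500) * (14191 / 10000))"
    unfolding norm_mult exp_add by (intro mult_mono mult_nonneg_nonneg norm_ge_zero assms y X) auto
  then show Xe: "cmod (X * exp (X + y)) \<le> 9072 / 10000" by simp
  let ?E = "u * X * exp y * (exp X - 1)"
  have "cmod (exp ?E - 1) \<le> exp (cmod ?E) - 1" using norm_exp_tail[of 1 ?E] by (simp add: exp_tail_simps)
  also have "\<dots> \<le> 3694 / 10000" using E exp_3143 exp_le_cancel_iff[of "cmod ?E" "3143 / 10000"] by linarith
  finally have "cmod (cstep X u y) \<le> (9072 / 10000) * (3694 / 10000)"
    unfolding cstep_def norm_mult[of "X * exp (X + y)"] using Xe by (intro mult_mono) simp_all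
  then show "cmod (cstep X u y) \<le> cmax" by simp
qed

text \<open>The two summands of the derivative in \<open>y\<close> are at most 0.9072 * 0.3694 and
  0.9072 * 1.3694 * 0.3143, together less than 0.73.\<close>

lemma cstep_contraction:
  assumes "cmod X \<le> xmax" "cmod u \<le> umax" "cmod y \<le> cmax" "cmod y' \<le> cmax"
  shows "cmod (cstep X u y - cstep X u y') \<le> 3 / 4 * cmod (y - y')"
proof (rule field_differentiable_bound[of "cball 0 cmax"])
  let ?E = "\<lambda>y. u * X * exp y * (exp X - 1)"
  let ?d = "\<lambda>y. X * exp (X + y) * (exp (?E y) - 1) + X * exp (X + y) * (exp (?E y) * ?E y)"
  show "(cstep X u has_field_derivative ?d z) (at z within cball 0 cmax)" for z
    unfolding cstep_def by (auto intro!: derivative_eq_intros simp: algebra_simps)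
  show "cmod (?d z) \<le> 3 / 4" if "z \<in> cball 0 cmax" for z
  proof -
    have z: "cmod z \<le> cmax" using that by simp
    note b = cstep_bounds(1,2)[OF assms(1,2) z]
    have e: "cmod (exp (?E z)) \<le> 13694 / 10000"
      using norm_exp[of "?E z"] exp_3143 b(1) by (meson exp_le_cancel_iff order_trans)
    have "cmod (exp (?E z) - 1) \<le> exp (cmod (?E z)) - 1" using norm_exp_tail[of 1 "?E z"] by (simp add: exp_tail_simps)
    also have "\<dots> \<le> 3694 / 10000" using b(1) exp_3143 exp_le_cancel_iff[of "cmod (?E z)" "3143 / 10000"] by linarith
    finally have e1: "cmod (exp (?E z) - 1) \<le> 3694 / 10000" .
    have "cmod (X * exp (X + z) * (exp (?E z) - 1)) \<le> (9072 / 10000) * (3694 / 10000)"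
      unfolding norm_mult[of "X * exp (X + z)"] by (intro mult_mono mult_nonneg_nonneg norm_ge_zero b e1) auto
    moreover have "cmod (X * exp (X + z) * (exp (?E z) * ?E z)) \<le> (9072 / 10000) * ((13694 / 10000) * (3143 / 10000))"
      unfolding norm_mult[of "X * exp (X + z)"] norm_mult[of "exp (?E z)"] by (intro mult_mono mult_nonneg_nonneg norm_ge_zero b e) auto
    ultimately show ?thesis by (intro order_trans[OF norm_triangle_ineq]) linarith
  qed
qed (use assms in auto)

fun citer :: "nat \<Rightarrow> complex \<Rightarrow> complex \<Rightarrow> complex" where
  "citer 0 X u = 0"
| "citer (Suc k) X u = cstep X u (citer k X u)"

lemma majorant_citer: "majorant (citer k)"
proof (induction k)
  case 0
  show ?case using majorant_of_real[of 0] by (simp add: majorant_def)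
next
  case (Suc k)
  then show ?case using majorant_cstep by (simp add: majorant_def)
qed

lemma norm_citer: "cmod X \<le> xmax \<Longrightarrow> cmod u \<le> umax \<Longrightarrow> cmod (citer k X u) \<le> cmax"
proof (induction k)
  case (Suc k)
  then show ?case using cstep_bounds(3)[of X u "citer k X u"] by simp
qed simp

lemma norm_citer_diff:
  assumes "cmod X \<le> xmax" "cmod u \<le> umax"
  shows "cmod (citer (Suc k) X u - citer k X u) \<le> (3 / 4) ^ k"
proof (induction k)
  case 0
  then show ?case using norm_citer[OF assms, of 1] by simp
next
  case (Suc k)
  have "cmod (citer (Suc (Suc k)) X u - citer (Suc k) X u) \<le> 3 / 4 * cmod (citer (Suc k) X u - citer k X u)"
    using cstep_contraction[OF assms norm_citer[OF assms, of "Suc k"] norm_citer[OF assms, of k]] by simp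
  then show ?case using Suc by simp
qed

text \<open>The limit of the iterates from 0, as a telescoping series: the M-test then gives
  convergence uniform in both variables at once.\<close>

definition cfun :: "complex \<Rightarrow> complex \<Rightarrow> complex" where
  "cfun X u = (\<Sum>k. citer (Suc k) X u - citer k X u)"

lemma citer_telescope: "(\<Sum>k<n. citer (Suc k) X u - citer k X u) = citer n X u"
  by (induction n) auto

lemma uniform_limit_citer:
  "uniform_limit {(X, u). cmod X \<le> xmax \<and> cmod u \<le> umax} (\<lambda>n (X, u). citer n X u) (\<lambda>(X, u). cfun X u) sequentially"
proof -
  have "uniform_limit {(X, u). cmod X \<le> xmax \<and> cmod u \<le> umax}
      (\<lambda>n p. \<Sum>k<n. citer (Suc k) (fst p) (snd p) - citer k (fst p) (snd p))
      (\<lambda>p. \<Sum>k. citer (Suc k) (fst p) (snd p) - citer k (fst p) (snd p)) sequentially"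
    by (rule Weierstrass_m_test[where M = "\<lambda>k. (3 / 4) ^ k"]) (auto intro: norm_citer_diff simp del: citer.simps)
  then show ?thesis by (simp only: citer_telescope cfun_def split_def)
qed

lemma citer_tendsto:
  assumes "cmod X \<le> xmax" "cmod u \<le> umax"
  shows "(\<lambda>n. citer n X u) \<longlonglongrightarrow> cfun X u"
  using tendsto_uniform_limitI[OF uniform_limit_citer, of "(X, u)"] assms by simp

lemma majorant_cfun: "majorant cfun"
  by (rule majorant_lim[OF majorant_citer]) (rule citer_tendsto)

lemma norm_cfun:
  assumes "cmod X \<le> xmax" "cmod u \<le> umax"
  shows "cmod (cfun X u) \<le> cmax"
  by (rule tendsto_upperbound[OF tendsto_norm[OF citer_tendsto[OF assms]]]) (use norm_citer[OF assms] in auto)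

lemma cfun_fixpoint:
  assumes "cmod X \<le> xmax" "cmod u \<le> umax"
  shows "cstep X u (cfun X u) = cfun X u"
proof -
  have "(\<lambda>n. cstep X u (citer n X u)) \<longlonglongrightarrow> cstep X u (cfun X u)"
    unfolding cstep_def by (intro tendsto_intros citer_tendsto assms)
  moreover have "(\<lambda>n. citer (Suc n) X u) \<longlonglongrightarrow> cfun X u"
    by (rule LIMSEQ_Suc[OF citer_tendsto[OF assms]])
  ultimately show ?thesis by (simp add: LIMSEQ_unique)
qed

lemma holomorphic_citer:
  assumes "f holomorphic_on A" "g holomorphic_on A"
  shows "(\<lambda>z. citer k (f z) (g z)) holomorphic_on A"
proof (induction k)
  case (Suc k)
  then show ?case using assms by (auto simp: cstep_def intro!: holomorphic_intros)
qed auto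

text \<open>With two arbitrary holomorphic arguments, one lemma covers \<open>X\<close> alone,
  \<open>u\<close> alone, the local inverse of \<open>Zfun\<close> and exponential
  coordinates.\<close>

lemma holomorphic_cfun:
  assumes "open A" "f holomorphic_on A" "g holomorphic_on A"
    and "\<And>z. z \<in> A \<Longrightarrow> cmod (f z) \<le> xmax" "\<And>z. z \<in> A \<Longrightarrow> cmod (g z) \<le> umax"
  shows "(\<lambda>z. cfun (f z) (g z)) holomorphic_on A"
proof (rule holomorphic_uniform_sequence[OF assms(1)])
  show "(\<lambda>z. citer n (f z) (g z)) holomorphic_on A" for n
    by (rule holomorphic_citer[OF assms(2,3)])
  fix z assume "z \<in> A"
  then obtain d where d: "d > 0" "cball z d \<subseteq> A" using assms(1) open_contains_cball by blast
  have "uniform_limit (cball z d) (\<lambda>n z. case (f z, g z) of (X, u) \<Rightarrow> citer n X u) (\<lambda>z. case (f z, g z) of (X, u) \<Rightarrow> cfun X u) sequentially"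
    by (rule uniform_limit_compose'[OF uniform_limit_citer]) (use d assms(4,5) in auto)
  then show "\<exists>d>0. cball z d \<subseteq> A \<and> uniform_limit (cball z d) (\<lambda>n z. citer n (f z) (g z)) (\<lambda>z. cfun (f z) (g z)) sequentially"
    using d by auto
qed


subsection \<open>The generating functions in terms of the leaf-type parameter\<close>

definition Bfun :: "complex \<Rightarrow> complex \<Rightarrow> complex" where
  "Bfun X u = u * X * exp (cfun X u) * (exp X - 1)"

definition Dfun :: "complex \<Rightarrow> complex \<Rightarrow> complex" where
  "Dfun X u = X * (exp (cfun X u) - 1)"

definition Ffun :: "complex \<Rightarrow> complex \<Rightarrow> complex" where
  "Ffun X u = X + Bfun X u + cfun X u + Dfun X u"

definition Zfun :: "complex \<Rightarrow> complex \<Rightarrow> complex" where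
  "Zfun X u = X * exp (- Dfun X u)"

lemma cfun_eq:
  "cmod X \<le> xmax \<Longrightarrow> cmod u \<le> umax \<Longrightarrow> cfun X u = X * exp (X + cfun X u) * (exp (Bfun X u) - 1)"
  using cfun_fixpoint[of X u] by (simp add: cstep_def Bfun_def)

text \<open>If all children have types in {d}, {d, c}, {d, c, L} or are arbitrary, the root has type
  in {L}, {L, d}, {L, d, b} or any type. Each exponential thus equals a partial sum of the
  generating functions, where \<open>B\<close> appears as \<open>B / u\<close> because the root
  itself is not yet marked.\<close>

lemma Zfun_identities:
  assumes "cmod X \<le> xmax" "cmod u \<le> umax"
  shows "Zfun X u * exp (Dfun X u) = X"
    and "Zfun X u * exp (Dfun X u + cfun X u) = X + Dfun X u"
    and "Zfun X u * exp (Dfun X u + cfun X u + X) = X + Dfun X u + X * exp (cfun X u) * (exp X - 1)"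
    and "Zfun X u * exp (Dfun X u + cfun X u + X + Bfun X u) = X + Dfun X u + X * exp (cfun X u) * (exp X - 1) + cfun X u"
proof -
  show 1: "Zfun X u * exp (Dfun X u) = X" by (simp add: Zfun_def exp_minus)
  show 2: "Zfun X u * exp (Dfun X u + cfun X u) = X + Dfun X u"
    unfolding exp_add mult.assoc[symmetric] 1 by (simp add: Dfun_def algebra_simps)
  show 3: "Zfun X u * exp (Dfun X u + cfun X u + X) = X + Dfun X u + X * exp (cfun X u) * (exp X - 1)"
    unfolding exp_add[of _ X] mult.assoc[symmetric] 2 by (simp add: Dfun_def algebra_simps)
  have "X + Dfun X u + X * exp (cfun X u) * (exp X - 1) = X * exp (X + cfun X u)"
    by (simp add: Dfun_def exp_add algebra_simps)
  then show "Zfun X u * exp (Dfun X u + cfun X u + X + Bfun X u) = X + Dfun X u + X * exp (cfun X u) * (exp X - 1) + cfun X u"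
    unfolding exp_add[of _ "Bfun X u"] mult.assoc[symmetric] 3 using cfun_eq[OF assms] by (simp add: algebra_simps)
qed

text \<open>For \<open>u = 1\<close> this is Cayley's equation for rooted trees; the term with
  \<open>1 - inverse u\<close> is what the mean is read off from.\<close>

lemma Ffun_identity:
  assumes "cmod X \<le> xmax" "cmod u \<le> umax" "u \<noteq> 0"
  shows "Zfun X u * exp (Ffun X u) = Ffun X u - Bfun X u * (1 - inverse u)"
proof -
  have "Ffun X u = Dfun X u + cfun X u + X + Bfun X u" by (simp add: Ffun_def)
  moreover have "X * exp (cfun X u) * (exp X - 1) = Bfun X u * inverse u"
    using assms(3) by (simp add: Bfun_def)
  ultimately show ?thesis using Zfun_identities(4)[OF assms(1,2)] by (simp add: algebra_simps)
qed

lemma majorant_Bfun: "majorant Bfun"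
  unfolding Bfun_def
  by (intro majorant_mult majorant_exp majorant_exp_minus_1 majorant_fst majorant_snd majorant_cfun)

lemma majorant_Dfun: "majorant Dfun"
  unfolding Dfun_def
  by (intro majorant_mult majorant_exp majorant_exp_minus_1 majorant_fst majorant_snd majorant_cfun)

lemma majorant_Ffun: "majorant Ffun"
  unfolding Ffun_def
  by (intro majorant_add majorant_fst majorant_cfun majorant_Bfun majorant_Dfun)

lemma majorant_Ffun_minus: "majorant (\<lambda>X u. Ffun X u - X)"
proof -
  have "(\<lambda>X u. Ffun X u - X) = (\<lambda>X u. Bfun X u + cfun X u + Dfun X u)"
    by (simp add: Ffun_def fun_eq_iff)
  then show ?thesis using majorant_Bfun majorant_cfun majorant_Dfun by (simp only: majorant_add)
qed

lemma holomorphic_funs: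
  assumes "open A" "f holomorphic_on A" "g holomorphic_on A"
    and "\<And>z. z \<in> A \<Longrightarrow> cmod (f z) \<le> xmax" "\<And>z. z \<in> A \<Longrightarrow> cmod (g z) \<le> umax"
  shows "(\<lambda>z. Bfun (f z) (g z)) holomorphic_on A" "(\<lambda>z. Dfun (f z) (g z)) holomorphic_on A"
    "(\<lambda>z. Ffun (f z) (g z)) holomorphic_on A" "(\<lambda>z. Zfun (f z) (g z)) holomorphic_on A"
proof -
  have c: "(\<lambda>z. cfun (f z) (g z)) holomorphic_on A"
    using holomorphic_cfun[OF assms(1-3)] assms(4,5) by blast
  show B: "(\<lambda>z. Bfun (f z) (g z)) holomorphic_on A"
    unfolding Bfun_def by (intro holomorphic_intros assms(2,3) c)
  show D: "(\<lambda>z. Dfun (f z) (g z)) holomorphic_on A"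
    unfolding Dfun_def by (intro holomorphic_intros assms(2,3) c)
  show "(\<lambda>z. Ffun (f z) (g z)) holomorphic_on A"
    unfolding Ffun_def by (intro holomorphic_intros assms(2,3) c B D)
  show "(\<lambda>z. Zfun (f z) (g z)) holomorphic_on A"
    unfolding Zfun_def by (intro holomorphic_intros assms(2,3) c B D)
qed

text \<open>The two lowest terms of \<^term>\<open>Dfun\<close> have coprime degrees in \<^term>\<open>X\<close>; this aperiodicity makes
  \<^term>\<open>\<lambda>t. Re (Dfun (x * cis t) u)\<close> have its only maximum at \<^term>\<open>t = 0\<close>.\<close>

definition Drest :: "complex \<Rightarrow> complex \<Rightarrow> complex" where
  "Drest X u = Dfun X u - u * X ^ 4 - u * X ^ 5 / 2"

lemma majorant_cong:
  assumes "majorant f" "\<And>X u. cmod X \<le> xmax \<Longrightarrow> cmod u \<le> umax \<Longrightarrow> g X u = f X u"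
  shows "majorant g"
  unfolding majorant_def
proof (intro allI impI)
  fix X u x v assume h: "cmod X \<le> x \<and> x \<le> xmax \<and> cmod u \<le> v \<and> v \<le> umax"
  have x: "0 \<le> x" "0 \<le> v" using h norm_ge_zero order_trans by blast+
  have "g X u = f X u" "g (of_real x) (of_real v) = f (of_real x) (of_real v)"
    using h x by (auto intro!: assms(2))
  then show "cmod (g X u) \<le> Re (g (of_real x) (of_real v))"
    using majorantD[OF assms(1)] h by simp
qed

text \<open>To lowest order \<open>D = X C\<close>, \<open>C = X B\<close> and
  \<open>B = u X (X + X^2 / 2)\<close>, which produces the two monomials. What is dropped on the way
  is built from \<open>X\<close>, \<open>u\<close> and exponential tails, hence is a
  majorant.\<close>

lemma majorant_Drest: "majorant Drest"
proof (rule majorant_cong)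
  show "majorant (\<lambda>X u. X * exp_tail 2 (cfun X u) + X * (X * ((exp (X + cfun X u) - 1) * (exp (Bfun X u) - 1)))
    + X * (X * exp_tail 2 (Bfun X u)) + X * (X * (u * (X * ((exp (cfun X u) - 1) * (exp X - 1)))))
    + X * (X * (u * (X * exp_tail 3 X))))"
    by (intro majorant_add majorant_mult majorant_fst majorant_snd majorant_exp_tail majorant_exp_minus_1
        majorant_cfun majorant_Bfun)
  fix X u assume h: "cmod X \<le> xmax" "cmod u \<le> umax"
  have "Dfun X u = X * exp_tail 2 (cfun X u) + X * cfun X u"
    by (simp add: Dfun_def exp_tail_simps algebra_simps)
  moreover have "cfun X u = X * ((exp (X + cfun X u) - 1) * (exp (Bfun X u) - 1)) + X * exp_tail 2 (Bfun X u) + X * Bfun X u"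
    by (subst cfun_eq[OF h]) (simp add: exp_tail_simps algebra_simps)
  moreover have "Bfun X u = u * (X * ((exp (cfun X u) - 1) * (exp X - 1))) + u * (X * exp_tail 3 X) + u * X * (X + X\<^sup>2 / 2)"
    by (simp add: Bfun_def exp_tail_simps algebra_simps)
  ultimately have "Dfun X u = X * exp_tail 2 (cfun X u) + X * (X * ((exp (X + cfun X u) - 1) * (exp (Bfun X u) - 1)) + X * exp_tail 2 (Bfun X u) +
      X * (u * (X * ((exp (cfun X u) - 1) * (exp X - 1))) + u * (X * exp_tail 3 X) + u * X * (X + X\<^sup>2 / 2)))"
    by metis
  then show "Drest X u = X * exp_tail 2 (cfun X u) + X * (X * ((exp (X + cfun X u) - 1) * (exp (Bfun X u) - 1)))
    + X * (X * exp_tail 2 (Bfun X u)) + X * (X * (u * (X * ((exp (cfun X u) - 1) * (exp X - 1)))))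
    + X * (X * (u * (X * exp_tail 3 X)))"
    unfolding Drest_def by (simp add: algebra_simps power_numeral_reduce)
qed

text \<open>The two monomials have phases \<open>4 s + t\<close> and \<open>5 s + t\<close>; the
  rest is estimated by its modulus. Keeping both angles lets the bound serve for the concentration
  in \<open>s\<close> as well as for the definiteness of the quadratic form.\<close>

lemma Re_Dfun_bound:
  assumes "0 \<le> x" "x \<le> xmax" "0 \<le> v" "v \<le> umax"
  shows "Re (Dfun (x * cis s) (v * cis t)) \<le> Re (Dfun x v)
     - v * x ^ 4 * (1 - cos (4 * s + t)) - v * x ^ 5 / 2 * (1 - cos (5 * s + t))"
proof -
  have "Re (Drest (x * cis s) (v * cis t)) \<le> cmod (Drest (x * cis s) (v * cis t))" by (rule complex_Re_le_cmod)
  also have "\<dots> \<le> Re (Drest (of_real x) (of_real v))"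
    using assms by (intro majorantD[OF majorant_Drest]) (auto simp: norm_mult)
  finally have r: "Re (Drest (x * cis s) (v * cis t)) \<le> Re (Drest (of_real x) (of_real v))" .
  have e: "v * cis t * (x * cis s) ^ n = of_real (v * x ^ n) * cis (real n * s + t)" for n :: nat
  proof -
    have "v * cis t * (x * cis s) ^ n = of_real (v * x ^ n) * (cis s ^ n * cis t)"
      by (simp add: power_mult_distrib)
    also have "cis s ^ n * cis t = cis (real n * s + t)" unfolding Complex.DeMoivre cis_mult ..
    finally show ?thesis .
  qed
  have "Dfun (x * cis s) (v * cis t) = Drest (x * cis s) (v * cis t)
      + of_real (v * x ^ 4) * cis (real 4 * s + t) + of_real (v * x ^ 5) * cis (real 5 * s + t) / 2"
    unfolding Drest_def e[symmetric] by simp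
  then have "Re (Dfun (x * cis s) (v * cis t)) = Re (Drest (x * cis s) (v * cis t)) + v * x ^ 4 * cos (4 * s + t) + v * x ^ 5 / 2 * cos (5 * s + t)"
    by (simp flip: of_real_power of_real_mult)
  moreover have "Re (Dfun x v) = Re (Drest (of_real x) (of_real v)) + v * x ^ 4 + v * x ^ 5 / 2"
    unfolding Drest_def by (simp flip: of_real_power of_real_mult)
  ultimately show ?thesis using r unfolding right_diff_distrib by linarith
qed


subsection \<open>Lagrange inversion as a contour integral\<close>

text \<open>With \<open>z = X exp (- D X)\<close> the integrand is the derivative of
  \<open>P (z X)\<close> divided by \<open>z^N\<close>, with residue \<open>N p_N\<close>. The
  expansion of \<open>P\<close> is available only near 0, so the residue is taken on a small circle.
  As \<open>F' exp (N D)\<close> is holomorphic on the large disc, the radius can then be raised to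
  \<open>r\<close>, where \<open>X\<close> need no longer be a function of \<open>z\<close>.\<close>

lemma lagrange_inversion:
  fixes D F P :: "complex \<Rightarrow> complex"
  assumes D: "D holomorphic_on ball 0 \<rho>" and F: "F holomorphic_on ball 0 \<rho>"
    and P: "P has_fps_expansion p" and PF: "\<forall>\<^sub>F X in nhds 0. P (X * exp (- D X)) = F X"
    and r: "0 < r" "r < \<rho>" and N: "N > 0"
  shows "((\<lambda>X. deriv F X * exp (of_nat N * D X) / X ^ N) has_contour_integral (2 * pi * \<i> * (of_nat N * fps_nth p N)))
      (circlepath 0 r)"
proof -
  define z where "z X = X * exp (- D X)" for X
  have holz: "z holomorphic_on ball 0 \<rho>" unfolding z_def using D by (intro holomorphic_intros)
  have rho: "\<rho> > 0" using r by simp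
  have z0: "z 0 = 0" by (simp add: z_def)
  have znz: "z X \<noteq> 0" if "X \<noteq> 0" for X using that by (simp add: z_def)
  \<comment> \<open>The part of \<open>p\<close> beyond degree \<open>N\<close>. Dividing it by
    \<open>w^(N + 1)\<close> leaves a holomorphic \<open>S\<close>, so that its contribution to
    \<open>F' / z^N\<close> is holomorphic and integrates to zero.\<close>
  define q where "q = p - (\<Sum>m\<le>N. fps_const (fps_nth p m) * fps_X ^ m)"
  have qn: "fps_nth q m = (if m \<le> N then 0 else fps_nth p m)" for m
    unfolding q_def by (simp add: fps_sum_nth if_distrib[of "\<lambda>x. _ * x"] cong: if_cong)
  have sub: "q = 0 \<or> Suc N \<le> subdegree q"
    using qn by (metis not_less_eq_eq nth_subdegree_nonzero)
  define Q where "Q w = P w - (\<Sum>m\<le>N. fps_nth p m * w ^ m)" for w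
  have Qq: "Q has_fps_expansion q"
    unfolding Q_def q_def by (intro fps_expansion_intros P)
  have "\<exists>S. S has_fps_expansion fps_shift (Suc N) q \<and> (\<forall>\<^sub>F w in nhds 0. Q w = w ^ Suc N * S w)"
  proof (cases "q = 0")
    case True
    then have "\<forall>\<^sub>F w in nhds 0. Q w = w ^ Suc N * (\<lambda>w. 0) w"
      using Qq by (simp add: has_fps_expansion_0_iff)
    then show ?thesis using True by (intro exI[of _ "\<lambda>w. 0"]) simp
  next
    case False
    then have le: "Suc N \<le> subdegree q" using sub by simp
    let ?S = "\<lambda>w. if w = 0 then fps_nth q (Suc N) else Q w / w ^ Suc N"
    have "?S has_fps_expansion fps_shift (Suc N) q"
      by (rule has_fps_expansion_shift[OF Qq le refl])
    moreover have "Q 0 = 0" using has_fps_expansion_imp_0_eq_fps_nth_0[OF Qq] qn[of 0] by simp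
    then have "Q w = w ^ Suc N * ?S w" for w by simp
    ultimately show ?thesis by (intro exI[of _ ?S]) auto
  qed
  then obtain S where S: "S has_fps_expansion fps_shift (Suc N) q" and QS: "\<forall>\<^sub>F w in nhds 0. Q w = w ^ Suc N * S w"
    by blast
  obtain A where A: "open A" "0 \<in> A" "S holomorphic_on A"
    using has_fps_expansion_imp_holomorphic[OF S] by metis
  have isz: "isCont z 0"
    using holz rho by (meson centre_in_ball continuous_on_eq_continuous_at holomorphic_on_imp_continuous_on open_ball)
  have zt: "filterlim z (nhds 0) (nhds 0)" using isz z0 tendsto_at_iff_tendsto_nhds[of z 0] by (simp add: isCont_def)
  have "\<forall>\<^sub>F X in nhds 0. F X = (\<Sum>m\<le>N. fps_nth p m * z X ^ m) + z X ^ Suc N * S (z X) \<and> z X \<in> A \<and> X \<in> ball 0 \<rho>"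
  proof -
    have "\<forall>\<^sub>F X in nhds 0. Q (z X) = z X ^ Suc N * S (z X)" using QS zt by (rule eventually_compose_filterlim)
    moreover have "\<forall>\<^sub>F X in nhds 0. z X \<in> A"
      using eventually_compose_filterlim[OF eventually_nhds_in_open[OF A(1,2)] zt] .
    moreover have "\<forall>\<^sub>F X in nhds 0. X \<in> ball 0 \<rho>" using rho by (intro eventually_nhds_in_open) auto
    ultimately show ?thesis using PF
    proof eventually_elim
      case (elim X)
      then show ?case by (simp add: Q_def z_def algebra_simps)
    qed
  qed
  then obtain d where d: "d > 0" "\<And>X. cmod X < d \<Longrightarrow> F X = (\<Sum>m\<le>N. fps_nth p m * z X ^ m) + z X ^ Suc N * S (z X) \<and> z X \<in> A \<and> X \<in> ball 0 \<rho>"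
    unfolding eventually_nhds_metric by (auto simp: dist_norm)
  define e where "e = d / 2"
  have e: "0 < e" "e < d" "e < \<rho>" using d(1) d(2)[of "of_real e"] rho by (auto simp: e_def)
  define B where "B = ball (0::complex) d"
  have B: "open B" "B \<subseteq> ball 0 \<rho>" using d(2) by (auto simp: B_def)
  have zder: "(z has_field_derivative deriv z X) (at X)" if "X \<in> ball 0 \<rho>" for X
    using holz that holomorphic_derivI open_ball by blast
  have zder_eq: "deriv z X = exp (- D X) * (1 - X * deriv D X)" if "X \<in> ball 0 \<rho>" for X
  proof (rule DERIV_imp_deriv)
    have "(D has_field_derivative deriv D X) (at X)" using D that holomorphic_derivI open_ball by blast
    then show "(z has_field_derivative exp (- D X) * (1 - X * deriv D X)) (at X)"
      unfolding z_def[abs_def] by (auto intro!: derivative_eq_intros simp: algebra_simps)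
  qed
  define h where "h X = of_nat (Suc N) * deriv z X * S (z X) + z X * (deriv S (z X) * deriv z X)" for X
  have SzB: "(\<lambda>X. S (z X)) holomorphic_on B" "(\<lambda>X. deriv S (z X)) holomorphic_on B"
  proof -
    have zB: "z holomorphic_on B" "z ` B \<subseteq> A" using holz holomorphic_on_subset B d(2) by (auto simp: B_def)
    show "(\<lambda>X. S (z X)) holomorphic_on B"
      using holomorphic_on_compose_gen[OF zB(1) A(3) zB(2)] by (simp add: o_def)
    show "(\<lambda>X. deriv S (z X)) holomorphic_on B"
      using holomorphic_on_compose_gen[OF zB(1) holomorphic_deriv[OF A(3,1)] zB(2)] by (simp add: o_def)
  qed
  have dF: "deriv F X = (\<Sum>m\<le>N. fps_nth p m * (of_nat m * z X ^ (m - 1) * deriv z X)) + z X ^ N * h X" if X: "X \<in> B" for X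
  proof -
    have Xr: "X \<in> ball 0 \<rho>" using X B by auto
    have "S field_differentiable at (z X)"
      using A(1,3) d(2)[of X] X holomorphic_on_imp_differentiable_at by (auto simp: B_def)
    then have "(S has_field_derivative deriv S (z X)) (at (z X))"
      by (simp add: DERIV_deriv_iff_field_differentiable)
    then have Sz: "((\<lambda>X. S (z X)) has_field_derivative deriv S (z X) * deriv z X) (at X)"
      using zder[OF Xr] by (rule DERIV_chain2)
    have "((\<lambda>X. (\<Sum>m\<le>N. fps_nth p m * z X ^ m) + z X ^ Suc N * S (z X)) has_field_derivative
        (\<Sum>m\<le>N. fps_nth p m * (of_nat m * z X ^ (m - 1) * deriv z X)) +
        (of_nat (Suc N) * z X ^ N * deriv z X * S (z X) + z X ^ Suc N * (deriv S (z X) * deriv z X))) (at X)"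
      by (rule derivative_eq_intros refl zder[OF Xr] Sz | simp add: mult_ac)+
    note der = this
    have ev: "\<forall>\<^sub>F Y in nhds X. F Y = (\<Sum>m\<le>N. fps_nth p m * z Y ^ m) + z Y ^ Suc N * S (z Y)"
      using eventually_nhds_in_open[OF B(1) X] by eventually_elim (use d(2) in \<open>auto simp: B_def\<close>)
    have "(F has_field_derivative
        (\<Sum>m\<le>N. fps_nth p m * (of_nat m * z X ^ (m - 1) * deriv z X)) +
        (of_nat (Suc N) * z X ^ N * deriv z X * S (z X) + z X ^ Suc N * (deriv S (z X) * deriv z X))) (at X)"
      using der DERIV_cong_ev[OF refl ev refl] by simp
    then show ?thesis by (simp add: DERIV_imp_deriv h_def algebra_simps)
  qed
  have circ: "X \<in> B" "X \<noteq> 0" if "X \<in> path_image (circlepath 0 e)" for X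
    using that e by (auto simp: B_def)
  have summand: "((\<lambda>X. fps_nth p m * (of_nat m * z X ^ (m - 1) * deriv z X) / z X ^ N) has_contour_integral
      (if m = N then 2 * pi * \<i> * (of_nat N * fps_nth p N) else 0)) (circlepath 0 e)" if m: "m \<le> N" for m
  proof (cases "m = N")
    case True
    \<comment> \<open>For \<open>m = N\<close> the term is \<open>N p_N z' / z\<close>, and
      \<open>z' / z = 1 / X - D'\<close>, of which only the first part has a residue.\<close>
    have 1: "((\<lambda>X. 1 / X) has_contour_integral (2 * pi * \<i>)) (circlepath 0 e)"
      using Cauchy_integral_circlepath_simple[of "\<lambda>_. 1" 0 e 0] e by simp
    have 2: "(deriv D has_contour_integral 0) (circlepath 0 e)"
      using contour_integral_primitive[of B D "deriv D" "circlepath 0 e"] circ(1) B D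
      by (smt (verit, best) DERIV_subset holomorphic_derivI open_ball pathfinish_circlepath pathstart_circlepath subsetD subsetI subset_UNIV valid_path_circlepath diff_self)
    have "((\<lambda>X. of_nat N * fps_nth p N * (1 / X - deriv D X)) has_contour_integral of_nat N * fps_nth p N * (2 * pi * \<i> - 0)) (circlepath 0 e)"
      by (intro has_contour_integral_lmul has_contour_integral_diff 1 2)
    then have "((\<lambda>X. fps_nth p m * (of_nat m * z X ^ (m - 1) * deriv z X) / z X ^ N) has_contour_integral of_nat N * fps_nth p N * (2 * pi * \<i> - 0)) (circlepath 0 e)"
    proof (rule has_contour_integral_eq)
      fix X assume X: "X \<in> path_image (circlepath 0 e)"
      have "z X ^ N = z X * z X ^ (N - 1)" using N by (cases N) auto
      then show "of_nat N * fps_nth p N * (1 / X - deriv D X) = fps_nth p m * (of_nat m * z X ^ (m - 1) * deriv z X) / z X ^ N"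
      proof -
        have dz: "deriv z X = exp (- D X) * (1 - X * deriv D X)" using circ[OF X] B by (intro zder_eq) auto
        have "fps_nth p m * (of_nat m * z X ^ (m - 1) * deriv z X) / z X ^ N = of_nat N * fps_nth p N * (deriv z X / z X)"
          using znz[of X] circ[OF X] \<open>z X ^ N = z X * z X ^ (N - 1)\<close> True by simp
        also have "deriv z X / z X = 1 / X - deriv D X"
          unfolding dz z_def using circ[OF X] by (simp add: field_simps)
        finally show ?thesis ..
      qed
    qed
    then show ?thesis using True by (simp add: mult_ac)
  next
    case False
    then have mN: "m < N" using m by simp
    \<comment> \<open>For \<open>m < N\<close> the term is the derivative of
      \<open>c z^(m - N)\<close>, which is single-valued on the punctured disc, so its integral
      vanishes.\<close>
    define c where "c = fps_nth p m * of_nat m / (of_int (int m - int N))"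
    have nz: "of_int (int m - int N) \<noteq> (0::complex)" using mN by (simp del: of_int_diff)
    have "((\<lambda>X. fps_nth p m * (of_nat m * z X ^ (m - 1) * deriv z X) / z X ^ N) has_contour_integral
       (c * z (pathfinish (circlepath 0 e)) powi (int m - int N) - c * z (pathstart (circlepath 0 e)) powi (int m - int N))) (circlepath 0 e)"
    proof (rule contour_integral_primitive[where S = "B - {0}"])
      fix X assume X: "X \<in> B - {0}"
      have "((\<lambda>X. c * z X powi (int m - int N)) has_field_derivative c * (of_int (int m - int N) * z X powi (int m - int N - 1) * deriv z X)) (at X within B - {0})"
        using X B znz[of X] by (auto intro!: derivative_eq_intros DERIV_subset[OF zder] simp: subset_iff)
      moreover have "c * (of_int (int m - int N) * z X powi (int m - int N - 1) * deriv z X) = fps_nth p m * (of_nat m * z X ^ (m - 1) * deriv z X) / z X ^ N"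
      proof (cases m)
        case 0 then show ?thesis by (simp add: c_def)
      next
        case (Suc k)
        have "z X powi (int m - int N - 1) = z X ^ k / z X ^ N"
          using X znz[of X] Suc by (simp add: power_int_diff)
        then show ?thesis using nz Suc by (simp add: c_def del: of_int_diff)
      qed
      ultimately show "((\<lambda>X. c * z X powi (int m - int N)) has_field_derivative fps_nth p m * (of_nat m * z X ^ (m - 1) * deriv z X) / z X ^ N) (at X within B - {0})"
        by simp
    qed (use circ in auto)
    then show ?thesis using False by simp
  qed
  have hB: "h holomorphic_on B"
    unfolding h_def using SzB holz B
    by (intro holomorphic_intros holomorphic_deriv[of z B] holomorphic_on_subset[OF holz]) auto
  have hint: "(h has_contour_integral 0) (circlepath 0 e)"
    by (rule Cauchy_theorem_disc_simple[of h 0 d]) (use hB e in \<open>auto simp: B_def\<close>)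
  have "((\<lambda>X. (\<Sum>m\<le>N. fps_nth p m * (of_nat m * z X ^ (m - 1) * deriv z X) / z X ^ N) + h X) has_contour_integral
     ((\<Sum>m\<le>N. if m = N then 2 * pi * \<i> * (of_nat N * fps_nth p N) else 0) + 0)) (circlepath 0 e)"
    by (intro has_contour_integral_add has_contour_integral_sum hint) (use summand in auto)
  then have total: "((\<lambda>X. (\<Sum>m\<le>N. fps_nth p m * (of_nat m * z X ^ (m - 1) * deriv z X) / z X ^ N) + h X) has_contour_integral
     (2 * pi * \<i> * (of_nat N * fps_nth p N))) (circlepath 0 e)"
    by simp
  have small: "((\<lambda>X. deriv F X * exp (of_nat N * D X) / X ^ N) has_contour_integral (2 * pi * \<i> * (of_nat N * fps_nth p N))) (circlepath 0 e)"
  proof (rule has_contour_integral_eq[OF total])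
    fix X assume X: "X \<in> path_image (circlepath 0 e)"
    have "z X ^ N = X ^ N * inverse (exp (of_nat N * D X))"
      by (simp add: z_def power_mult_distrib exp_minus exp_of_nat_mult power_inverse)
    then have "deriv F X * exp (of_nat N * D X) / X ^ N = deriv F X / z X ^ N"
      by (simp add: divide_inverse mult_ac)
    also have "\<dots> = (\<Sum>m\<le>N. fps_nth p m * (of_nat m * z X ^ (m - 1) * deriv z X) / z X ^ N) + h X"
      unfolding dF[OF circ(1)[OF X]] using znz circ(2)[OF X] by (simp add: add_divide_distrib sum_divide_distrib)
    finally show "(\<Sum>m\<le>N. fps_nth p m * (of_nat m * z X ^ (m - 1) * deriv z X) / z X ^ N) + h X = deriv F X * exp (of_nat N * D X) / X ^ N" ..
  qed
  \<comment> \<open>By Cauchy's formula the integral over either circle is determined by the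
    \<open>M\<close>-th derivative of \<open>g\<close> at 0, hence independent of the
    radius.\<close>
  obtain M where M: "N = Suc M" using N by (cases N) auto
  define g where "g X = deriv F X * exp (of_nat N * D X)" for X
  have g: "g holomorphic_on ball 0 \<rho>"
    unfolding g_def using F D by (intro holomorphic_intros holomorphic_deriv) auto
  have I: "((\<lambda>X. g X / X ^ N) has_contour_integral ((2 * pi * \<i>) / fact M * (deriv ^^ M) g 0)) (circlepath 0 s)"
    if "0 < s" "s < \<rho>" for s
    using Cauchy_has_contour_integral_higher_derivative_circlepath[of 0 s g 0 M] that
      holomorphic_on_subset[OF g] holomorphic_on_imp_continuous_on
    by (simp add: M cball_subset_ball_iff ball_subset_ball_iff)
  from small have "(2 * pi * \<i>) / fact M * (deriv ^^ M) g 0 = 2 * pi * \<i> * (of_nat N * fps_nth p N)"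
    using has_contour_integral_unique[OF I[OF e(1,3)]] unfolding g_def by blast
  then show ?thesis using I[OF r] unfolding g_def by simp
qed


section \<open>Identifying the analytic functions with the tree counts\<close>

lemma graft_type_pairs:
  "{(t1, t2). graft_type t1 t2 = TL} = {(TL, Td)}"
  "{(t1, t2). graft_type t1 t2 = Td} = {(Td, Td), (Td, Tc), (TL, Tc)}"
  "{(t1, t2). graft_type t1 t2 = Tb} = {(Tb, TL), (Tb, Tc), (Tb, Td), (TL, TL), (Td, TL)}"
  "{(t1, t2). graft_type t1 t2 = Tc} = {(Tc, TL), (Tc, Tb), (Tc, Tc), (Tc, Td), (TL, Tb), (Tb, Tb), (Td, Tb)}"
proof -
  have "graft_type t1 t2 = TL \<longleftrightarrow> (t1, t2) \<in> {(TL, Td)}"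
    "graft_type t1 t2 = Td \<longleftrightarrow> (t1, t2) \<in> {(Td, Td), (Td, Tc), (TL, Tc)}"
    "graft_type t1 t2 = Tb \<longleftrightarrow> (t1, t2) \<in> {(Tb, TL), (Tb, Tc), (Tb, Td), (TL, TL), (Td, TL)}"
    "graft_type t1 t2 = Tc \<longleftrightarrow> (t1, t2) \<in> {(Tc, TL), (Tc, Tb), (Tc, Tc), (Tc, Td), (TL, Tb), (Tb, Tb), (Td, Tb)}" for t1 t2
    by (cases t1; cases t2; simp)+
  then show
    "{(t1, t2). graft_type t1 t2 = TL} = {(TL, Td)}"
    "{(t1, t2). graft_type t1 t2 = Td} = {(Td, Td), (Td, Tc), (TL, Tc)}"
    "{(t1, t2). graft_type t1 t2 = Tb} = {(Tb, TL), (Tb, Tc), (Tb, Td), (TL, TL), (Td, TL)}"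
    "{(t1, t2). graft_type t1 t2 = Tc} = {(Tc, TL), (Tc, Tb), (Tc, Tc), (Tc, Td), (TL, Tb), (Tb, Tb), (Td, Tb)}"
    by auto
qed

text \<open>Comparing coefficients turns the differential system into \<open>tree_count_Suc\<close>:
  the factor \<open>fps_deriv (fps_X * G t2)\<close> is the marked branch, its coefficient
  \<open>j + 1\<close> being the choice of \<open>s\<close>.\<close>

lemma tree_count_unique:
  fixes G :: "rtype \<Rightarrow> 'b :: field_char_0 fps"
  assumes "u \<noteq> 0"
    and init: "\<And>t. fps_nth (G t) 0 = (if t = TL then 1 else 0)"
    and deriv: "\<And>t. fps_deriv (G t) = (\<Sum>(t1, t2)\<in>{(t1, t2). graft_type t1 t2 = t}.
      fps_const (graft_weight u t1 t2) * (fps_deriv (fps_X * G t2) * G t1))"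
  shows "fps_nth (G t) n = tree_count u t n / fact n"
proof (induction n arbitrary: t rule: less_induct)
  case (less n)
  show ?case
  proof (cases n)
    case 0
    then show ?thesis by (simp add: init tree_count_0)
  next
    case (Suc m)
    have dX: "fps_nth (fps_deriv (fps_X * H)) j = of_nat (Suc j) * fps_nth H j" for H :: "'b fps" and j
      by (simp only: fps_deriv_nth) simp
    have coeff: "fps_nth (fps_deriv (fps_X * G t2) * G t1) m =
        (\<Sum>j\<le>m. of_nat (Suc j) * (tree_count u t2 j / fact j) * (tree_count u t1 (m - j) / fact (m - j)))" for t1 t2
      unfolding fps_mult_nth atLeast0AtMost
    proof (intro sum.cong refl)
      fix j assume "j \<in> {..m}"
      then show "fps_nth (fps_deriv (fps_X * G t2)) j * fps_nth (G t1) (m - j) =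
          of_nat (Suc j) * (tree_count u t2 j / fact j) * (tree_count u t1 (m - j) / fact (m - j))"
        using less.IH[of j t2] less.IH[of "m - j" t1] Suc unfolding dX by simp
    qed
    have bin: "fact m * (x / fact j * (y / fact (m - j))) = of_nat (m choose j) * (x * y)" if "j \<le> m" for x y :: 'b and j
      using binomial_fact[OF that, where 'a = 'b] by simp
    have "fact m * fps_nth (fps_deriv (G t)) m = fact m * (\<Sum>(t1, t2)\<in>{(t1, t2). graft_type t1 t2 = t}.
       graft_weight u t1 t2 * (\<Sum>j\<le>m. of_nat (Suc j) * (tree_count u t2 j / fact j) * (tree_count u t1 (m - j) / fact (m - j))))"
      unfolding deriv[of t] fps_sum_nth split_beta fps_mult_left_const_nth coeff ..
    also have "\<dots> = (\<Sum>(t1, t2)\<in>{(t1, t2). graft_type t1 t2 = t}. \<Sum>j\<le>m.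
       of_nat (m choose j) * (of_nat (Suc j) * (graft_weight u t1 t2 * tree_count u t1 (m - j) * tree_count u t2 j)))"
      unfolding sum_distrib_left split_beta
    proof (intro sum.cong refl)
      fix p j assume "j \<in> {..m}"
      then show "fact m * (graft_weight u (fst p) (snd p) * (of_nat (Suc j) * (tree_count u (snd p) j / fact j) * (tree_count u (fst p) (m - j) / fact (m - j))))
        = of_nat (m choose j) * (of_nat (Suc j) * (graft_weight u (fst p) (snd p) * tree_count u (fst p) (m - j) * tree_count u (snd p) j))"
      proof -
        have re: "a * (w * (b * c * d)) = b * w * (a * (c * d))" for a b c d w :: 'b by (simp only: mult_ac)
        show ?thesis using \<open>j \<in> {..m}\<close> unfolding re by (subst bin) (simp_all only: atMost_iff mult_ac)
      qed
    qed
    also have "\<dots> = tree_count u t (Suc m)"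
      unfolding tree_count_Suc[OF assms(1)] split_beta sum_distrib_left by (rule sum.swap)
    finally have "fact m * (of_nat (Suc m) * fps_nth (G t) (Suc m)) = tree_count u t (Suc m)" by simp
    then have "fact (Suc m) * fps_nth (G t) (Suc m) = tree_count u t (Suc m)"
      by (simp only: fact_Suc of_nat_mult mult_ac)
    then show ?thesis using Suc by (simp add: eq_divide_eq mult.commute del: fact_Suc)
  qed
qed

lemma has_fps_expansion_transfer:
  "f has_fps_expansion F \<Longrightarrow> \<forall>\<^sub>F w in nhds 0. f w = g w \<Longrightarrow> g has_fps_expansion F"
  using has_fps_expansion_cong[OF _ refl] by blast

text \<open>The chain rule is applied to the analytic functions and carried over by uniqueness of
  expansions.\<close>

lemma fps_deriv_exp:
  fixes \<phi> :: "complex \<Rightarrow> complex"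
  assumes "\<phi> has_fps_expansion P" "(\<lambda>w. exp (\<phi> w)) has_fps_expansion E"
  shows "fps_deriv E = fps_deriv P * E"
proof -
  obtain A where A: "open A" "0 \<in> A" "\<phi> holomorphic_on A"
    using has_fps_expansion_imp_holomorphic[OF assms(1)] by metis
  have "\<forall>\<^sub>F w in nhds 0. deriv (\<lambda>w. exp (\<phi> w)) w = deriv \<phi> w * exp (\<phi> w)"
    using eventually_nhds_in_open[OF A(1,2)]
  proof eventually_elim
    case (elim w)
    have "(\<phi> has_field_derivative deriv \<phi> w) (at w)" using A elim holomorphic_derivI by blast
    then show ?case by (intro DERIV_imp_deriv) (auto intro!: derivative_eq_intros)
  qed
  then have "(\<lambda>w. deriv \<phi> w * exp (\<phi> w)) has_fps_expansion fps_deriv E"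
    by (rule has_fps_expansion_transfer[OF has_fps_expansion_deriv[OF assms(2)]])
  moreover have "(\<lambda>w. deriv \<phi> w * exp (\<phi> w)) has_fps_expansion fps_deriv P * E"
    by (intro has_fps_expansion_mult has_fps_expansion_deriv assms)
  ultimately show ?thesis by (rule fps_expansion_unique_complex)
qed

text \<open>\<open>Zfun\<close> has derivative 1 at 0, so \<open>X\<close> is locally a function
  \<open>g\<close> of \<open>z\<close>. The exponentials of partial sums satisfy
  \<open>S' = (partial sum)' S\<close>, and their differences satisfy the system of
  \<open>tree_count_unique\<close>.\<close>

lemma tree_count_expansion:
  fixes u :: complex
  assumes u: "u \<noteq> 0" "cmod u \<le> umax"
  obtains P p where "P has_fps_expansion p" "\<forall>\<^sub>F X in nhds 0. P (X * exp (- Dfun X u)) = Ffun X u"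
    "\<And>n. fps_nth p (Suc n) = (\<Sum>t\<in>UNIV. tree_count u t n) / fact n"
proof -
  let ?Z = "\<lambda>X. Zfun X u"
  have small: "cmod X \<le> xmax" if "X \<in> ball 0 xmax" for X :: complex using that by simp
  have hZ: "?Z holomorphic_on ball 0 xmax" and hD: "(\<lambda>X. Dfun X u) holomorphic_on ball 0 xmax"
    using holomorphic_funs(2,4)[of "ball 0 xmax" "\<lambda>X. X" "\<lambda>_. u"] small u by auto
  have D0: "Dfun 0 u = 0" by (simp add: Dfun_def)
  have "((\<lambda>X. Dfun X u) has_field_derivative deriv (\<lambda>X. Dfun X u) 0) (at 0)"
    using hD holomorphic_derivI[of _ "ball 0 xmax"] by auto
  then have "(?Z has_field_derivative 1) (at 0)"
    unfolding Zfun_def by (auto intro!: derivative_eq_intros simp: D0)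
  then have d1: "deriv ?Z 0 \<noteq> 0" by (simp add: DERIV_imp_deriv)
  obtain r where r: "r > 0" "ball (0::complex) r \<subseteq> ball 0 xmax" "open (?Z ` ball 0 r)" "inj_on ?Z (ball 0 r)"
    by (rule has_complex_derivative_locally_invertible[OF hZ _ _ d1]) auto
  define T where "T = ?Z ` ball 0 r"
  have "?Z 0 \<in> T" unfolding T_def by (rule imageI) (use r(1) in simp)
  then have T: "open T" "0 \<in> T" using r(3) by (simp_all add: T_def Zfun_def)
  obtain g where g: "g holomorphic_on T" "\<And>X. X \<in> ball 0 r \<Longrightarrow> g (?Z X) = X"
    unfolding T_def by (rule holomorphic_has_inverse[OF holomorphic_on_subset[OF hZ r(2)] open_ball r(4)]) blast
  have gT: "?Z (g w) = w" "cmod (g w) \<le> xmax" "g w \<in> ball 0 r" if "w \<in> T" for w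
  proof -
    obtain X where X: "X \<in> ball 0 r" "w = ?Z X" using \<open>w \<in> T\<close> by (auto simp: T_def)
    then show "?Z (g w) = w" "cmod (g w) \<le> xmax" "g w \<in> ball 0 r" using g(2)[of X] subsetD[OF r(2), of X] by simp_all
  qed
  define C where "C w = cfun (g w) u" for w
  define B where "B w = Bfun (g w) u" for w
  define D where "D w = Dfun (g w) u" for w
  have hol: "C holomorphic_on T" "B holomorphic_on T" "D holomorphic_on T"
    unfolding C_def B_def D_def
    using holomorphic_cfun[OF T(1) g(1), of "\<lambda>_. u"] holomorphic_funs(1,2)[OF T(1) g(1), of "\<lambda>_. u"] gT u by auto
  have id: "w * exp (D w) = g w" "w * exp (D w + C w) = g w + D w"
    "w * exp (D w + C w + g w) = g w + D w + g w * exp (C w) * (exp (g w) - 1)"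
    "w * exp (D w + C w + g w + B w) = g w + D w + g w * exp (C w) * (exp (g w) - 1) + C w"
    and Bw: "B w = u * (g w * exp (C w) * (exp (g w) - 1))" if w: "w \<in> T" for w
    using Zfun_identities[OF gT(2)[OF w] u(2)] gT(1)[OF w] by (simp_all add: B_def C_def D_def Bfun_def)
  define S1 where "S1 w = exp (D w)" for w
  define S2 where "S2 w = exp (D w + C w)" for w
  define S3 where "S3 w = exp (D w + C w + g w)" for w
  define S4 where "S4 w = exp (D w + C w + g w + B w)" for w
  have holS: "S1 holomorphic_on T" "S2 holomorphic_on T" "S3 holomorphic_on T" "S4 holomorphic_on T"
    unfolding S1_def S2_def S3_def S4_def by (intro holomorphic_intros hol g(1))+
  define s1 where "s1 = fps_expansion S1 0"
  define s2 where "s2 = fps_expansion S2 0"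
  define s3 where "s3 = fps_expansion S3 0"
  define s4 where "s4 = fps_expansion S4 0"
  have ex: "S1 has_fps_expansion s1" "S2 has_fps_expansion s2" "S3 has_fps_expansion s3" "S4 has_fps_expansion s4"
    unfolding s1_def s2_def s3_def s4_def using holS T by (auto intro!: has_fps_expansion_fps_expansion)
  \<comment> \<open>Differences of consecutive exponentials isolate the type of the root;
    \<open>fps_X * G t\<close> is the generating function of type \<open>t\<close>. Only
    \<open>Tb\<close> carries the mark \<open>u\<close> of the root.\<close>
  define G where "G t = (case t of TL \<Rightarrow> s1 | Td \<Rightarrow> s2 - s1 | Tb \<Rightarrow> fps_const u * (s3 - s2) | Tc \<Rightarrow> s4 - s3)" for t
  have T_ev: "\<forall>\<^sub>F w in nhds 0. w \<in> T" using T by (intro eventually_nhds_in_open) auto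
  have exg: "g has_fps_expansion fps_X * G TL" "D has_fps_expansion fps_X * G Td"
    "B has_fps_expansion fps_X * G Tb" "C has_fps_expansion fps_X * G Tc"
  proof -
    have "(\<lambda>w. w * S1 w) has_fps_expansion fps_X * G TL"
      unfolding G_def rtype.case by (intro fps_expansion_intros ex)
    moreover have "\<forall>\<^sub>F w in nhds 0. w * S1 w = g w"
      using T_ev by eventually_elim (use id in \<open>simp add: S1_def\<close>)
    ultimately show "g has_fps_expansion fps_X * G TL" by (rule has_fps_expansion_transfer)
    have "(\<lambda>w. w * (S2 w - S1 w)) has_fps_expansion fps_X * G Td"
      unfolding G_def rtype.case by (intro fps_expansion_intros ex)
    moreover have "\<forall>\<^sub>F w in nhds 0. w * (S2 w - S1 w) = D w"
      using T_ev by eventually_elim (use id in \<open>simp add: S1_def S2_def right_diff_distrib\<close>)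
    ultimately show "D has_fps_expansion fps_X * G Td" by (rule has_fps_expansion_transfer)
    have "(\<lambda>w. w * (u * (S3 w - S2 w))) has_fps_expansion fps_X * G Tb"
      unfolding G_def rtype.case by (intro fps_expansion_intros ex)
    moreover have "\<forall>\<^sub>F w in nhds 0. w * (u * (S3 w - S2 w)) = B w"
      using T_ev
    proof eventually_elim
      case (elim w)
      have "w * (u * (S3 w - S2 w)) = u * (w * S3 w - w * S2 w)" by (simp add: algebra_simps)
      then show ?case using id[OF elim] Bw[OF elim] by (simp add: S2_def S3_def)
    qed
    ultimately show "B has_fps_expansion fps_X * G Tb" by (rule has_fps_expansion_transfer)
    have "(\<lambda>w. w * (S4 w - S3 w)) has_fps_expansion fps_X * G Tc"
      unfolding G_def rtype.case by (intro fps_expansion_intros ex)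
    moreover have "\<forall>\<^sub>F w in nhds 0. w * (S4 w - S3 w) = C w"
      using T_ev by eventually_elim (use id in \<open>simp add: S3_def S4_def right_diff_distrib\<close>)
    ultimately show "C has_fps_expansion fps_X * G Tc" by (rule has_fps_expansion_transfer)
  qed
  define f where "f t = fps_deriv (fps_X * G t)" for t
  have ds: "fps_deriv s1 = f Td * s1" "fps_deriv s2 = (f Td + f Tc) * s2"
    "fps_deriv s3 = (f Td + f Tc + f TL) * s3" "fps_deriv s4 = (f Td + f Tc + f TL + f Tb) * s4"
  proof -
    note E = ex[unfolded S1_def[abs_def] S2_def[abs_def] S3_def[abs_def] S4_def[abs_def]]
    show "fps_deriv s1 = f Td * s1" unfolding f_def by (rule fps_deriv_exp[OF exg(2) E(1)])
    show "fps_deriv s2 = (f Td + f Tc) * s2" unfolding f_def fps_deriv_add[symmetric]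
      by (rule fps_deriv_exp[OF has_fps_expansion_add[OF exg(2,4)] E(2)])
    show "fps_deriv s3 = (f Td + f Tc + f TL) * s3" unfolding f_def fps_deriv_add[symmetric]
      by (rule fps_deriv_exp[OF has_fps_expansion_add[OF has_fps_expansion_add[OF exg(2,4)] exg(1)] E(3)])
    show "fps_deriv s4 = (f Td + f Tc + f TL + f Tb) * s4" unfolding f_def fps_deriv_add[symmetric]
      by (rule fps_deriv_exp[OF has_fps_expansion_add[OF has_fps_expansion_add[OF has_fps_expansion_add[OF exg(2,4)] exg(1)] exg(3)] E(4)])
  qed
  have cu: "fps_const u * fps_const (inverse u) = 1" using u by simp
  have s: "s1 = G TL" "s2 = G TL + G Td" "s3 = G TL + G Td + fps_const (inverse u) * G Tb"
    "s4 = G TL + G Td + fps_const (inverse u) * G Tb + G Tc"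
  proof -
    have "fps_const (inverse u) * (fps_const u * (s3 - s2)) = s3 - s2"
      using cu by (simp only: mult.assoc[symmetric] mult.commute[of "fps_const (inverse u)"] mult_1)
    note eq = this
    show "s1 = G TL" "s2 = G TL + G Td" "s3 = G TL + G Td + fps_const (inverse u) * G Tb"
      "s4 = G TL + G Td + fps_const (inverse u) * G Tb + G Tc"
      unfolding G_def rtype.case eq by simp_all
  qed
  have init: "fps_nth (G t) 0 = (if t = TL then 1 else 0)" for t
  proof -
    have g0: "g 0 = 0" using id(1)[OF T(2)] by simp
    then have "C 0 = 0" "D 0 = 0" "B 0 = 0"
      using id(2,4)[OF T(2)] Bw[OF T(2)] by auto
    then have "fps_nth s1 0 = 1" "fps_nth s2 0 = 1" "fps_nth s3 0 = 1" "fps_nth s4 0 = 1"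
      using ex[THEN has_fps_expansion_imp_0_eq_fps_nth_0] g0 by (simp_all add: S1_def S2_def S3_def S4_def)
    then show ?thesis by (cases t) (simp_all add: G_def)
  qed
  have dG: "fps_deriv (G t) = (\<Sum>(t1, t2)\<in>{(t1, t2). graft_type t1 t2 = t}. fps_const (graft_weight u t1 t2) * (f t2 * G t1))" for t
  proof (cases t)
    case TL
    then show ?thesis using ds(1) s(1) by (simp add: graft_type_pairs)
  next
    case Td
    have "fps_deriv (G Td) = fps_deriv s2 - fps_deriv s1" by (simp add: G_def)
    then show ?thesis using Td unfolding ds unfolding s by (simp add: graft_type_pairs algebra_simps)
  next
    case Tb
    have "fps_deriv (G Tb) = fps_const u * (fps_deriv s3 - fps_deriv s2)" by (simp add: G_def)
    also have "\<dots> = fps_const u * ((f Td + f Tc + f TL) * (fps_const (inverse u) * G Tb) + f TL * (G TL + G Td))"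
      unfolding ds unfolding s by (simp add: algebra_simps)
    also have "\<dots> = (fps_const u * fps_const (inverse u)) * ((f Td + f Tc + f TL) * G Tb) + fps_const u * (f TL * (G TL + G Td))"
      by (simp only: algebra_simps)
    finally show ?thesis using Tb unfolding cu by (simp add: graft_type_pairs algebra_simps)
  next
    case Tc
    have "fps_deriv (G Tc) = fps_deriv s4 - fps_deriv s3" by (simp add: G_def)
    then show ?thesis using Tc unfolding ds unfolding s by (simp add: graft_type_pairs algebra_simps)
  qed
  have Gn: "fps_nth (G t) n = tree_count u t n / fact n" for t n
    by (rule tree_count_unique[OF u(1) init dG[unfolded f_def]])
  define P where "P w = g w + B w + C w + D w" for w
  define p where "p = fps_X * G TL + fps_X * G Tb + fps_X * G Tc + fps_X * G Td"
  show thesis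
  proof (rule that[of P p])
    show "P has_fps_expansion p" unfolding P_def p_def by (intro fps_expansion_intros exg)
    have "\<forall>\<^sub>F X in nhds 0. X \<in> ball 0 r" using r by (intro eventually_nhds_in_open) auto
    then show "\<forall>\<^sub>F X in nhds 0. P (X * exp (- Dfun X u)) = Ffun X u"
    proof eventually_elim
      case (elim X)
      then have "g (X * exp (- Dfun X u)) = X" using g(2) by (simp add: Zfun_def)
      then show ?case by (simp add: P_def Ffun_def B_def C_def D_def)
    qed
    show "fps_nth p (Suc n) = (\<Sum>t\<in>UNIV. tree_count u t n) / fact n" for n
      by (simp add: p_def Gn sum_rtype add_divide_distrib)
  qed
qed

lemma tree_count_contour_integral:
  fixes u :: complex
  assumes u: "u \<noteq> 0" "cmod u \<le> umax" and r: "0 < r" "r < xmax"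
  shows "((\<lambda>X. deriv (\<lambda>X. Ffun X u) X * exp (of_nat (Suc n) * Dfun X u) / X ^ Suc n) has_contour_integral
     (2 * pi * \<i> * (of_nat (Suc n) * ((\<Sum>t\<in>UNIV. tree_count u t n) / fact n)))) (circlepath 0 r)"
proof -
  obtain P p where P: "P has_fps_expansion p" "\<forall>\<^sub>F X in nhds 0. P (X * exp (- Dfun X u)) = Ffun X u"
    "\<And>n. fps_nth p (Suc n) = (\<Sum>t\<in>UNIV. tree_count u t n) / fact n"
    using tree_count_expansion[OF u] by metis
  have "(\<lambda>X. Dfun X u) holomorphic_on ball 0 xmax" "(\<lambda>X. Ffun X u) holomorphic_on ball 0 xmax"
    using holomorphic_funs(2,3)[of "ball 0 xmax" "\<lambda>X. X" "\<lambda>_. u"] u by auto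
  then show ?thesis using lagrange_inversion[OF _ _ P(1,2) r, of "Suc n"] P(3)[of n] by simp
qed


subsection \<open>Second-order expansion of a separately holomorphic function\<close>

text \<open>Cauchy's estimate on the circle of radius 3/4 of \<open>\<delta>\<close> makes the tail
  geometric with ratio at most 2/3, whence the factor 3.\<close>

lemma holomorphic_taylor_bound:
  fixes f :: "complex \<Rightarrow> complex"
  assumes f: "f holomorphic_on ball 0 \<delta>" and d: "\<delta> > 0" and M: "\<And>z. cmod z < \<delta> \<Longrightarrow> cmod (f z) \<le> M"
    and z: "cmod z \<le> \<delta> / 2"
  shows "cmod (f z - (\<Sum>k<n. (deriv ^^ k) f 0 / fact k * z ^ k)) \<le> 3 * M * (4 / (3 * \<delta>)) ^ n * cmod z ^ n"
proof -
  define a where "a k = (deriv ^^ k) f 0 / fact k" for k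
  define q where "q = cmod z * (4 / (3 * \<delta>))"
  have M0: "M \<ge> 0" using order_trans[OF norm_ge_zero M[of 0]] d by simp
  have q: "0 \<le> q" "q \<le> 2 / 3" using z d by (auto simp: q_def field_simps)
  have a: "cmod (a k) \<le> M * (4 / (3 * \<delta>)) ^ k" for k
  proof -
    have "cmod ((deriv ^^ k) f 0) \<le> fact k * M / (3 * \<delta> / 4) ^ k"
      using d M by (intro Cauchy_inequality holomorphic_on_subset[OF f] holomorphic_on_imp_continuous_on) auto
    then show ?thesis using d by (simp add: a_def norm_divide field_simps)
  qed
  have sums: "(\<lambda>k. a k * z ^ k) sums f z"
    using holomorphic_power_series[OF f, of z] z d by (simp add: a_def)
  then have tail: "(\<lambda>k. a (k + n) * z ^ (k + n)) sums (f z - (\<Sum>k<n. a k * z ^ k))"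
    by (rule sums_split_initial_segment)
  have le: "cmod (a (k + n) * z ^ (k + n)) \<le> M * q ^ n * q ^ k" for k
  proof -
    have "cmod (a (k + n) * z ^ (k + n)) \<le> M * (4 / (3 * \<delta>)) ^ (k + n) * cmod z ^ (k + n)"
      unfolding norm_mult norm_power by (intro mult_right_mono a) auto
    also have "\<dots> = M * q ^ n * q ^ k"
      by (simp only: q_def power_mult_distrib power_add mult_ac)
    finally show ?thesis .
  qed
  have sq: "(\<lambda>k. M * q ^ n * q ^ k) sums (M * q ^ n * (1 / (1 - q)))"
    using q by (intro sums_mult geometric_sums) auto
  have "cmod (f z - (\<Sum>k<n. a k * z ^ k)) \<le> (\<Sum>k. M * q ^ n * q ^ k)"
    unfolding sums_unique[OF tail] by (rule norm_suminf_le[OF le sums_summable[OF sq]])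
  also have "\<dots> = M * q ^ n * (1 / (1 - q))" using sums_unique[OF sq] by simp
  also have "\<dots> \<le> M * q ^ n * 3" using q M0 by (intro mult_left_mono) (auto simp: field_simps)
  also have "M * q ^ n * 3 = 3 * M * (4 / (3 * \<delta>)) ^ n * cmod z ^ n"
    by (simp only: q_def power_mult_distrib mult_ac)
  finally show ?thesis unfolding a_def .
qed

text \<open>Separate holomorphy and a common bound suffice for a joint second-order expansion, since
  the Taylor coefficients in \<open>s\<close> turn out to be holomorphic in
  \<open>t\<close>.\<close>

locale two_variables =
  fixes f :: "complex \<Rightarrow> complex \<Rightarrow> complex" and \<delta> M :: real
  assumes d: "\<delta> > 0"
    and hol1: "\<And>t. cmod t < \<delta> \<Longrightarrow> (\<lambda>s. f s t) holomorphic_on ball 0 \<delta>"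
    and hol2: "\<And>s. cmod s < \<delta> \<Longrightarrow> (\<lambda>t. f s t) holomorphic_on ball 0 \<delta>"
    and bound: "\<And>s t. cmod s < \<delta> \<Longrightarrow> cmod t < \<delta> \<Longrightarrow> cmod (f s t) \<le> M"
begin

definition g :: "nat \<Rightarrow> complex \<Rightarrow> complex" where
  "g k t = (deriv ^^ k) (\<lambda>s. f s t) 0 / fact k"

lemma g_0: "g 0 t = f 0 t"
  by (simp add: g_def)

lemma expand: "cmod t < \<delta> \<Longrightarrow> cmod s \<le> \<delta> / 2 \<Longrightarrow>
    cmod (f s t - (\<Sum>k<n. g k t * s ^ k)) \<le> 3 * M * (4 / (3 * \<delta>)) ^ n * cmod s ^ n"
  using holomorphic_taylor_bound[OF hol1[of t] d bound, of s n] by (simp add: g_def)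

lemma g_bound:
  assumes "cmod t < \<delta>" shows "cmod (g k t) \<le> M * (4 / (3 * \<delta>)) ^ k"
proof -
  have "cmod ((deriv ^^ k) (\<lambda>s. f s t) 0) \<le> fact k * M / (3 * \<delta> / 4) ^ k"
    using d bound assms
    by (intro Cauchy_inequality holomorphic_on_subset[OF hol1[OF assms]] holomorphic_on_imp_continuous_on) auto
  then show ?thesis using d by (simp add: g_def norm_divide field_simps)
qed

text \<open>The \<open>k\<close>-th coefficient is the limit of \<open>f\<close> minus its lower
  terms, divided by the \<open>k\<close>-th power, along points \<open>x j\<close> tending to 0; by
  \<open>expand\<close> the error is of order \<open>x j\<close>, uniformly in
  \<open>t\<close>.\<close>

lemma g_holomorphic: "g k holomorphic_on ball 0 \<delta>"
proof (induction k rule: less_induct)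
  case (less k)
  define x where "x j = (of_real (\<delta> / 2 / real (Suc j)) :: complex)" for j
  have nx: "cmod (x j) = \<delta> / 2 / real (Suc j)" for j unfolding x_def norm_of_real using d by simp
  have x: "x j \<noteq> 0" "cmod (x j) \<le> \<delta> / 2" for j
  proof -
    have "cmod (x j) > 0" unfolding nx using d by simp
    then show "x j \<noteq> 0" by auto
    have "\<delta> / 2 / real (Suc j) \<le> \<delta> / 2 / 1" using d by (intro divide_left_mono) auto
    then show "cmod (x j) \<le> \<delta> / 2" unfolding nx by simp
  qed
  define h where "h j t = (f (x j) t - (\<Sum>i<k. g i t * x j ^ i)) / x j ^ k" for j t
  show ?case
  proof (rule holomorphic_uniform_sequence[OF open_ball])
    show "h j holomorphic_on ball 0 \<delta>" for j
    proof -
      have "cmod (x j) < \<delta>" using x(2)[of j] d by linarith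
      then show ?thesis unfolding h_def using less.IH x(1)
        by (intro holomorphic_intros hol2) auto
    qed
    fix t0 :: complex assume "t0 \<in> ball 0 \<delta>"
    then obtain e where e: "e > 0" "cball t0 e \<subseteq> ball 0 \<delta>" using open_contains_cball open_ball by blast
    have err: "cmod (h j t - g k t) \<le> 3 * M * (4 / (3 * \<delta>)) ^ Suc k * (\<delta> / 2 / real (Suc j))" if t: "cmod t < \<delta>" for j t
    proof -
      have "h j t - g k t = (f (x j) t - (\<Sum>i<Suc k. g i t * x j ^ i)) / x j ^ k"
        using x(1) by (simp add: h_def field_simps)
      then have "cmod (h j t - g k t) \<le> (3 * M * (4 / (3 * \<delta>)) ^ Suc k * cmod (x j) ^ Suc k) / cmod (x j) ^ k"
        using expand[OF t x(2), of j "Suc k"] by (simp only: norm_divide norm_power divide_right_mono zero_le_power norm_ge_zero)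
      then show ?thesis using x(1)[of j] unfolding nx[symmetric] by simp
    qed
    have "uniform_limit (ball 0 \<delta>) h (g k) sequentially"
    proof (rule uniform_limitI)
      fix \<epsilon> :: real assume \<epsilon>: "\<epsilon> > 0"
      have "(\<lambda>j. 3 * M * (4 / (3 * \<delta>)) ^ Suc k * (\<delta> / 2 / real (Suc j))) \<longlonglongrightarrow> 3 * M * (4 / (3 * \<delta>)) ^ Suc k * 0"
        by (intro tendsto_mult tendsto_const LIMSEQ_Suc[OF lim_const_over_n])
      then have "\<forall>\<^sub>F j in sequentially. 3 * M * (4 / (3 * \<delta>)) ^ Suc k * (\<delta> / 2 / real (Suc j)) < \<epsilon>"
        using \<epsilon> by (intro order_tendstoD(2)) auto
      then show "\<forall>\<^sub>F j in sequentially. \<forall>t\<in>ball 0 \<delta>. dist (h j t) (g k t) < \<epsilon>"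
      proof eventually_elim
        case (elim j)
        then show ?case using err[of _ j] by (force simp: dist_norm)
      qed
    qed
    then show "\<exists>e>0. cball t0 e \<subseteq> ball 0 \<delta> \<and> uniform_limit (cball t0 e) h (g k) sequentially"
      using e uniform_limit_on_subset by blast
  qed
qed

lemma second_order:
  fixes s t :: complex
  defines "a \<equiv> deriv (\<lambda>s. f s 0) 0" and "b \<equiv> deriv (f 0) 0"
  shows "(\<lambda>n. of_nat n * (f (s / sqrt n) (t / sqrt n) - f 0 0) - sqrt n * (a * s + b * t)) \<longlonglongrightarrow>
     g 2 0 * s\<^sup>2 + deriv (g 1) 0 * s * t + deriv (deriv (f 0)) 0 / 2 * t\<^sup>2"
proof -
  define x where "x n = (of_real (1 / sqrt (real n)) :: complex)" for n
  define K where "K n = 3 * M * (4 / (3 * \<delta>)) ^ n" for n :: nat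
  have xlim: "x \<longlonglongrightarrow> 0"
  proof -
    have "(\<lambda>n. 1 / sqrt (real n)) \<longlonglongrightarrow> 0" by real_asymp
    from tendsto_of_real[OF this, where 'a = complex] show ?thesis unfolding x_def by simp
  qed
  have nx: "of_nat n * x n ^ 2 = 1" "of_real (sqrt n) = of_nat n * x n" if "n > 0" for n
  proof -
    have r: "real n * (1 / sqrt n)\<^sup>2 = 1" "sqrt n = real n * (1 / sqrt n)"
      using that by (simp_all add: power_divide real_div_sqrt)
    have "of_nat n * x n ^ 2 = complex_of_real (real n * (1 / sqrt n)\<^sup>2)" by (simp only: x_def of_real_mult of_real_power of_real_of_nat_eq)
    then show "of_nat n * x n ^ 2 = 1" unfolding r(1) by simp
    show "of_real (sqrt n) = of_nat n * x n"
      by (subst r(2)) (simp only: x_def of_real_mult of_real_of_nat_eq)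
  qed
  have sx: "(\<lambda>n. s * x n) \<longlonglongrightarrow> 0" "(\<lambda>n. t * x n) \<longlonglongrightarrow> 0"
    using tendsto_mult[OF tendsto_const xlim] by auto
  have small: "\<forall>\<^sub>F n in sequentially. cmod (s * x n) \<le> \<delta> / 2 \<and> cmod (t * x n) \<le> \<delta> / 2 \<and> n > 0"
  proof -
    have "\<forall>\<^sub>F n in sequentially. cmod (s * x n) < \<delta> / 2" "\<forall>\<^sub>F n in sequentially. cmod (t * x n) < \<delta> / 2"
      using tendstoD[OF sx(1), of "\<delta> / 2"] tendstoD[OF sx(2), of "\<delta> / 2"] d by simp_all
    then show ?thesis using eventually_gt_at_top[of 0] by eventually_elim auto
  qed
  have R: "(\<lambda>n. of_nat n * r n) \<longlonglongrightarrow> 0" if "\<forall>\<^sub>F n in sequentially. cmod (r n) \<le> C * cmod (x n) ^ 3" for r :: "nat \<Rightarrow> complex" and C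
  proof (rule Lim_null_comparison)
    show "(\<lambda>n. C * cmod (x n)) \<longlonglongrightarrow> 0" using tendsto_mult[OF tendsto_const tendsto_norm_zero[OF xlim]] by auto
    show "\<forall>\<^sub>F n in sequentially. cmod (of_nat n * r n) \<le> C * cmod (x n)"
      using that eventually_gt_at_top[of 0]
    proof eventually_elim
      case (elim n)
      have "cmod (of_nat n * r n) \<le> real n * (C * cmod (x n) ^ 3)" unfolding norm_mult norm_of_nat using elim by (intro mult_left_mono) auto
      also have "\<dots> = C * cmod (x n) * cmod (of_nat n * x n ^ 2)"
        by (simp add: norm_mult norm_power power2_eq_square power3_eq_cube)
      finally show ?case using nx(1)[of n] elim by simp
    qed
  qed
  \<comment> \<open>Three remainders of third order in \<open>1 / sqrt n\<close>: the expansion in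
    \<open>s\<close>, the expansion in \<open>t\<close> at \<open>s = 0\<close>, and that of the
    coefficient of \<open>s\<close>. Multiplied by \<open>n\<close> they vanish in the
    limit.\<close>
  define r1 where "r1 n = f (s * x n) (t * x n) - (\<Sum>k<3. g k (t * x n) * (s * x n) ^ k)" for n
  define r2 where "r2 n = f 0 (t * x n) - (\<Sum>k<3. (deriv ^^ k) (f 0) 0 / fact k * (t * x n) ^ k)" for n
  define r3 where "r3 n = s * x n * (g 1 (t * x n) - (\<Sum>k<2. (deriv ^^ k) (g 1) 0 / fact k * (t * x n) ^ k))" for n
  have "(\<lambda>n. of_nat n * r1 n) \<longlonglongrightarrow> 0"
  proof (rule R[where C = "K 3 * cmod s ^ 3"])
    show "\<forall>\<^sub>F n in sequentially. cmod (r1 n) \<le> K 3 * cmod s ^ 3 * cmod (x n) ^ 3"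
      using small
    proof eventually_elim
      case (elim n)
      then show ?case using expand[of "t * x n" "s * x n" 3] d
        by (simp add: r1_def K_def norm_mult power_mult_distrib mult.assoc)
    qed
  qed
  moreover have "(\<lambda>n. of_nat n * r2 n) \<longlonglongrightarrow> 0"
  proof (rule R[where C = "K 3 * cmod t ^ 3"])
    show "\<forall>\<^sub>F n in sequentially. cmod (r2 n) \<le> K 3 * cmod t ^ 3 * cmod (x n) ^ 3"
      using small
    proof eventually_elim
      case (elim n)
      then show ?case using holomorphic_taylor_bound[OF hol2[of 0] d, of M "t * x n" 3] bound[of 0] d
        by (simp add: r2_def K_def norm_mult power_mult_distrib mult.assoc)
    qed
  qed
  moreover have "(\<lambda>n. of_nat n * r3 n) \<longlonglongrightarrow> 0"
  proof (rule R[where C = "cmod s * (3 * (M * (4 / (3 * \<delta>))) * (4 / (3 * \<delta>)) ^ 2 * cmod t ^ 2)"])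
    show "\<forall>\<^sub>F n in sequentially. cmod (r3 n) \<le> cmod s * (3 * (M * (4 / (3 * \<delta>))) * (4 / (3 * \<delta>)) ^ 2 * cmod t ^ 2) * cmod (x n) ^ 3"
      using small
    proof eventually_elim
      case (elim n)
      have "cmod (g 1 (t * x n) - (\<Sum>k<2. (deriv ^^ k) (g 1) 0 / fact k * (t * x n) ^ k)) \<le> 3 * (M * (4 / (3 * \<delta>))) * (4 / (3 * \<delta>)) ^ 2 * cmod (t * x n) ^ 2"
        using holomorphic_taylor_bound[OF g_holomorphic d, of 1 "M * (4 / (3 * \<delta>))" "t * x n" 2] g_bound[of _ 1] elim by simp
      then have "cmod (r3 n) \<le> cmod (s * x n) * (3 * (M * (4 / (3 * \<delta>))) * (4 / (3 * \<delta>)) ^ 2 * cmod (t * x n) ^ 2)"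
        unfolding r3_def norm_mult[of "s * x n"] by (intro mult_left_mono) auto
      also have "\<dots> = cmod s * (3 * (M * (4 / (3 * \<delta>))) * (4 / (3 * \<delta>)) ^ 2 * cmod t ^ 2) * cmod (x n) ^ 3"
        by (simp only: norm_mult power_mult_distrib power2_eq_square power3_eq_cube mult_ac)
      finally show ?case .
    qed
  qed
  moreover have "(\<lambda>n. s\<^sup>2 * g 2 (t * x n)) \<longlonglongrightarrow> s\<^sup>2 * g 2 0"
  proof (intro tendsto_mult tendsto_const)
    have "isCont (g 2) 0" using g_holomorphic[of 2] d
      by (meson centre_in_ball continuous_on_eq_continuous_at holomorphic_on_imp_continuous_on open_ball)
    then show "(\<lambda>n. g 2 (t * x n)) \<longlonglongrightarrow> g 2 0" by (rule isCont_tendsto_compose[OF _ sx(2)])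
  qed
  ultimately have "(\<lambda>n. of_nat n * r1 n + of_nat n * r2 n + of_nat n * r3 n + s\<^sup>2 * g 2 (t * x n)
      + deriv (g 1) 0 * s * t + deriv (deriv (f 0)) 0 / 2 * t\<^sup>2) \<longlonglongrightarrow>
      0 + 0 + 0 + s\<^sup>2 * g 2 0 + deriv (g 1) 0 * s * t + deriv (deriv (f 0)) 0 / 2 * t\<^sup>2"
    by (intro tendsto_add tendsto_const)
  then have lim: "(\<lambda>n. of_nat n * r1 n + of_nat n * r2 n + of_nat n * r3 n + s\<^sup>2 * g 2 (t * x n)
      + deriv (g 1) 0 * s * t + deriv (deriv (f 0)) 0 / 2 * t\<^sup>2) \<longlonglongrightarrow>
      g 2 0 * s\<^sup>2 + deriv (g 1) 0 * s * t + deriv (deriv (f 0)) 0 / 2 * t\<^sup>2"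
    by (simp add: mult.commute)
  have ga: "g 1 0 = a" by (simp add: g_def a_def)
  show ?thesis
  proof (rule Lim_transform_eventually[OF lim])
    show "\<forall>\<^sub>F n in sequentially. of_nat n * r1 n + of_nat n * r2 n + of_nat n * r3 n + s\<^sup>2 * g 2 (t * x n)
      + deriv (g 1) 0 * s * t + deriv (deriv (f 0)) 0 / 2 * t\<^sup>2 =
      of_nat n * (f (s / sqrt n) (t / sqrt n) - f 0 0) - sqrt n * (a * s + b * t)"
      using eventually_gt_at_top[of 0]
    proof eventually_elim
      case (elim n)
      have fx: "f (s / sqrt n) (t / sqrt n) = f (s * x n) (t * x n)" by (simp add: x_def)
      define N where "N = (of_nat n :: complex)"
      have N1: "N * x n ^ 2 = 1" and N2: "of_real (sqrt n) = N * x n" using nx[OF elim] by (simp_all add: N_def)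
      have e1: "r1 n = f (s * x n) (t * x n) - f 0 (t * x n) - g 1 (t * x n) * (s * x n) - g 2 (t * x n) * (s * x n)\<^sup>2"
        by (simp add: r1_def numeral_3_eq_3 g_0 numeral_2_eq_2)
      have e2: "r2 n = f 0 (t * x n) - f 0 0 - b * (t * x n) - deriv (deriv (f 0)) 0 / 2 * (t * x n)\<^sup>2"
        by (simp add: r2_def numeral_3_eq_3 b_def numeral_2_eq_2)
      have e3: "r3 n = s * x n * (g 1 (t * x n) - a - deriv (g 1) 0 * (t * x n))"
        by (simp add: r3_def numeral_2_eq_2 ga[simplified])
      have "N * r1 n + N * r2 n + N * r3 n = N * (f (s * x n) (t * x n) - f 0 0) - N * x n * (a * s + b * t)
         - (N * x n ^ 2) * (s\<^sup>2 * g 2 (t * x n) + deriv (g 1) 0 * s * t + deriv (deriv (f 0)) 0 / 2 * t\<^sup>2)"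
        unfolding e1 e2 e3 by (simp add: algebra_simps power2_eq_square)
      then show ?case unfolding fx unfolding N1 N2 N_def[symmetric] by (simp add: algebra_simps)
    qed
  qed
qed

end


subsection \<open>The critical point\<close>

text \<open>Horner evaluation of the Taylor polynomial of \<^const>\<open>exp\<close>, rounded after each step to the numbers in the list.\<close>

fun horner_upper :: "real \<Rightarrow> nat \<Rightarrow> real list \<Rightarrow> real \<Rightarrow> bool" where
  "horner_upper x k [] q \<longleftrightarrow> 1 + x / real k * 3 \<le> q"
| "horner_upper x k (p # ps) q \<longleftrightarrow> 1 + x / real k * p \<le> q \<and> horner_upper x (k + 1) ps p"

fun horner_lower :: "real \<Rightarrow> nat \<Rightarrow> real list \<Rightarrow> real \<Rightarrow> bool" where
  "horner_lower x k [] q \<longleftrightarrow> q \<le> 1"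
| "horner_lower x k (p # ps) q \<longleftrightarrow> q \<le> 1 + x / real k * p \<and> horner_lower x (k + 1) ps p"

text \<open>The tail divided by its leading term. One Horner step leads from index
  \<open>k + 1\<close> to \<open>k\<close>, and the values lie between 1 and 3, which provides the
  starting values of the two evaluations.\<close>

definition exp_rest :: "nat \<Rightarrow> real \<Rightarrow> real" where
  "exp_rest k x = exp_tail k x * fact k / x ^ k"

lemma exp_rest_step:
  assumes "0 < x" shows "exp_rest k x = 1 + x / real (Suc k) * exp_rest (Suc k) x"
proof -
  have "exp_tail k x = x ^ k / fact k + exp_tail (Suc k) x" by (simp add: exp_tail_def)
  moreover have "x / real (Suc k) * exp_rest (Suc k) x = exp_tail (Suc k) x * fact k / x ^ k"
    using assms by (simp add: exp_rest_def del: of_nat_Suc)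
  ultimately show ?thesis using assms by (simp add: exp_rest_def field_simps)
qed

lemma exp_rest_le:
  assumes "0 < x" "x \<le> 1" shows "exp_rest k x \<le> 3" "1 \<le> exp_rest k x"
proof -
  have "exp_tail k x \<le> 3 * x ^ k / fact k" using exp_bounds(2)[of x k] assms by (simp add: exp_tail_def)
  then show "exp_rest k x \<le> 3" using assms by (simp add: exp_rest_def field_simps)
  have "x ^ k / fact k \<le> exp_tail k x" using exp_bounds(1)[of x "Suc k"] assms by (simp add: exp_tail_def)
  then show "1 \<le> exp_rest k x" using assms by (simp add: exp_rest_def field_simps)
qed

lemma horner_upper:
  assumes "0 < x" "x \<le> 1" "horner_upper x (Suc k) ps q" shows "exp_rest k x \<le> q"
  using assms(3)
proof (induction ps arbitrary: k q)
  case Nil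
  have "x / real (Suc k) * exp_rest (Suc k) x \<le> x / real (Suc k) * 3"
    using exp_rest_le(1)[OF assms(1,2)] assms(1) by (intro mult_left_mono) auto
  then show ?case using Nil exp_rest_step[OF assms(1), of k] by simp
next
  case (Cons p ps)
  then have "exp_rest (Suc k) x \<le> p" by simp
  then have "x / real (Suc k) * exp_rest (Suc k) x \<le> x / real (Suc k) * p"
    using assms(1) by (intro mult_left_mono) auto
  moreover have "1 + x / real (Suc k) * p \<le> q" using Cons.prems by simp
  ultimately show ?case using exp_rest_step[OF assms(1), of k] by linarith
qed

lemma horner_lower:
  assumes "0 < x" "x \<le> 1" "horner_lower x (Suc k) ps q" shows "q \<le> exp_rest k x"
  using assms(3)
proof (induction ps arbitrary: k q)
  case Nil
  then show ?case using exp_rest_le(2)[OF assms(1,2), of k] by simp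
next
  case (Cons p ps)
  then have "p \<le> exp_rest (Suc k) x" by simp
  then have "x / real (Suc k) * p \<le> x / real (Suc k) * exp_rest (Suc k) x"
    using assms(1) by (intro mult_left_mono) auto
  moreover have "q \<le> 1 + x / real (Suc k) * p" using Cons.prems by simp
  ultimately show ?case using exp_rest_step[OF assms(1), of k] by linarith
qed

lemma exp_upper: "0 < x \<Longrightarrow> x \<le> 1 \<Longrightarrow> horner_upper x 1 ps h \<Longrightarrow> exp x \<le> h"
  and exp_lower: "0 < x \<Longrightarrow> x \<le> 1 \<Longrightarrow> horner_lower x 1 ps h \<Longrightarrow> h \<le> exp x"
  using horner_upper[of x 0 ps h] horner_lower[of x 0 ps h] by (simp_all add: exp_rest_def exp_tail_def)

definition cstep_real :: "real \<Rightarrow> real \<Rightarrow> real" where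
  "cstep_real x y = x * exp x * exp y * (exp (x * exp y * (exp x - 1)) - 1)"

lemma cstep_of_real: "cstep (of_real x) 1 (of_real y) = of_real (cstep_real x y)"
  unfolding cstep_def cstep_real_def
  by (simp only: exp_of_real[symmetric] of_real_mult of_real_add of_real_diff of_real_1 exp_add mult_1 mult.assoc)

lemma cfun_of_real:
  assumes "0 \<le> x" "x \<le> xmax"
  shows "cfun (of_real x) 1 = of_real (Re (cfun (of_real x) 1))" "0 \<le> Re (cfun (of_real x) 1)" "Re (cfun (of_real x) 1) \<le> cmax"
  using majorant_real[OF majorant_cfun assms, of 1] norm_cfun[of "of_real x" 1] assms
    complex_Re_le_cmod[of "cfun (of_real x) 1"] by simp_all

lemma cfun_real_fixpoint:
  assumes "0 \<le> x" "x \<le> xmax"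
  shows "cstep_real x (Re (cfun (of_real x) 1)) = Re (cfun (of_real x) 1)"
proof -
  let ?c = "Re (cfun (of_real x) 1)"
  have "cstep (of_real x) 1 (of_real ?c) = of_real ?c"
    using cfun_fixpoint[of "of_real x" 1] assms unfolding cfun_of_real(1)[OF assms, symmetric] by simp
  then show ?thesis unfolding cstep_of_real of_real_eq_iff .
qed

lemma cstep_real_contraction:
  assumes "0 \<le> x" "x \<le> xmax" "0 \<le> y" "y \<le> cmax" "0 \<le> z" "z \<le> cmax"
  shows "\<bar>cstep_real x y - cstep_real x z\<bar> \<le> 3 / 4 * \<bar>y - z\<bar>"
proof -
  have "cmod (of_real (cstep_real x y - cstep_real x z)) \<le> 3 / 4 * cmod (of_real (y - z))"
    using cstep_contraction[of "of_real x" 1 "of_real y" "of_real z"] assms by (simp add: cstep_of_real)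
  then show ?thesis unfolding norm_of_real .
qed

lemma contract_le: "a \<le> 3 / 4 * b \<Longrightarrow> b = d \<Longrightarrow> d \<le> a \<Longrightarrow> d \<le> (0 :: real)"
  by simp

text \<open>If the fixpoint \<open>c\<close> exceeded \<open>y\<close>, then \<open>c - y\<close>
  would be at most \<open>c - cstep_real x y\<close>, hence at most 3/4 of itself. A single
  evaluation at a rational \<open>y\<close> thus bounds the fixpoint.\<close>

lemma cfun_le:
  assumes "0 \<le> x" "x \<le> xmax" "0 \<le> y" "y \<le> cmax" "cstep_real x y \<le> y"
  shows "Re (cfun (of_real x) 1) \<le> y"
proof (rule ccontr)
  let ?c = "Re (cfun (of_real x) 1)"
  assume n: "\<not> ?thesis"
  have 1: "\<bar>cstep_real x y - ?c\<bar> \<le> 3 / 4 * \<bar>y - ?c\<bar>"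
    using cstep_real_contraction[OF assms(1-4) cfun_of_real(2,3)[OF assms(1,2)]]
    unfolding cfun_real_fixpoint[OF assms(1,2)] .
  have 2: "\<bar>y - ?c\<bar> = ?c - y" using n by simp
  have 3: "?c - y \<le> \<bar>cstep_real x y - ?c\<bar>" using assms(5) by simp
  show False using contract_le[OF 1 2 3] n by simp
qed

lemma cfun_ge:
  assumes "0 \<le> x" "x \<le> xmax" "0 \<le> y" "y \<le> cmax" "y \<le> cstep_real x y"
  shows "y \<le> Re (cfun (of_real x) 1)"
proof (rule ccontr)
  let ?c = "Re (cfun (of_real x) 1)"
  assume n: "\<not> ?thesis"
  have 1: "\<bar>cstep_real x y - ?c\<bar> \<le> 3 / 4 * \<bar>y - ?c\<bar>"
    using cstep_real_contraction[OF assms(1-4) cfun_of_real(2,3)[OF assms(1,2)]]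
    unfolding cfun_real_fixpoint[OF assms(1,2)] .
  have 2: "\<bar>y - ?c\<bar> = y - ?c" using n by simp
  have 3: "y - ?c \<le> \<bar>cstep_real x y - ?c\<bar>" using assms(5) by simp
  show False using contract_le[OF 1 2 3] n by simp
qed

lemma Re_funs:
  fixes x :: real
  assumes "0 \<le> x" "x \<le> xmax"
  defines "c \<equiv> Re (cfun (of_real x) 1)"
  shows "Re (Bfun (of_real x) 1) = x * exp c * (exp x - 1)"
    and "Re (Ffun (of_real x) 1) = x + x * exp c * (exp x - 1) + c + x * (exp c - 1)"
proof -
  have c: "cfun (of_real x) 1 = of_real c" using cfun_of_real(1)[OF assms(1,2)] by (simp add: c_def)
  have B: "Bfun (of_real x) 1 = of_real (x * exp c * (exp x - 1))"
    by (simp add: Bfun_def c exp_of_real)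
  show "Re (Bfun (of_real x) 1) = x * exp c * (exp x - 1)" unfolding B by simp
  have "Ffun (of_real x) 1 = of_real (x + x * exp c * (exp x - 1) + c + x * (exp c - 1))"
    unfolding Ffun_def Dfun_def B c by (simp add: exp_of_real)
  then show "Re (Ffun (of_real x) 1) = x + x * exp c * (exp x - 1) + c + x * (exp c - 1)"
    by (metis Re_complex_of_real)
qed

text \<open>Interval arithmetic along the definition: \<open>xl\<close>, \<open>xu\<close> enclose
  \<open>exp x\<close>, then \<open>yl\<close>, \<open>yu\<close> the fixpoint with
  \<open>el\<close>, \<open>eu\<close> for its exponential, \<open>bl\<close>, \<open>bu\<close>
  enclose \<open>B\<close>, and \<open>fl\<close>, \<open>fu\<close> its exponential. The hypotheses
  \<open>fp\<close> are the sub- and supersolution tests for the fixpoint.\<close>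

lemma bracket:
  fixes x yl yu xl xu el eu bl bu fl fu :: real
  assumes x: "0 \<le> x" "x \<le> xmax" and y: "0 \<le> yl" "yl \<le> cmax" "0 \<le> yu" "yu \<le> cmax"
    and xb: "xl \<le> exp x" "exp x \<le> xu" "1 \<le> xl" and yb: "el \<le> exp yl" "exp yu \<le> eu" "1 \<le> el"
    and b: "bl \<le> x * el * (xl - 1)" "x * eu * (xu - 1) \<le> bu"
    and f: "fl \<le> exp bl" "exp bu \<le> fu" "1 \<le> fl"
    and fp: "yl \<le> x * xl * el * (fl - 1)" "x * xu * eu * (fu - 1) \<le> yu"
  shows "bl \<le> Re (Bfun (of_real x) 1)" "Re (Bfun (of_real x) 1) \<le> bu"
    "x + bl + yl + x * (el - 1) \<le> Re (Ffun (of_real x) 1)" "Re (Ffun (of_real x) 1) \<le> x + bu + yu + x * (eu - 1)"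
proof -
  let ?c = "Re (cfun (of_real x) 1)"
  have xu1: "1 \<le> xu" using xb by linarith
  have eu0: "0 \<le> eu" using yb(2) exp_ge_zero[of yu] by linarith
  have bl': "bl \<le> x * exp yl * (exp x - 1)"
    using b(1) x xb yb by (elim order_trans, intro mult_mono) auto
  have bu': "x * exp yu * (exp x - 1) \<le> bu"
    by (rule order_trans[OF _ b(2)], intro mult_mono) (use x xb yb eu0 in auto)
  have "x * xl * el * (fl - 1) \<le> cstep_real x yl"
    unfolding cstep_real_def
    by (intro mult_mono mult_nonneg_nonneg diff_right_mono order_trans[OF f(1)]) (use x xb yb f bl' in auto)
  then have cl: "yl \<le> ?c" using fp(1) by (intro cfun_ge x y) linarith
  have "cstep_real x yu \<le> x * xu * eu * (fu - 1)"
    unfolding cstep_real_def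
    by (intro mult_mono mult_nonneg_nonneg diff_right_mono order_trans[OF _ f(2)]) (use x xb xu1 yb eu0 f bu' in auto)
  then have cu: "?c \<le> yu" using fp(2) by (intro cfun_le x y) linarith
  have e: "el \<le> exp ?c" "exp ?c \<le> eu" using cl cu yb by (meson exp_le_cancel_iff order_trans)+
  show B1: "bl \<le> Re (Bfun (of_real x) 1)" unfolding Re_funs(1)[OF x]
    by (rule order_trans[OF b(1)], intro mult_mono) (use x xb yb e in auto)
  show B2: "Re (Bfun (of_real x) 1) \<le> bu" unfolding Re_funs(1)[OF x]
    by (rule order_trans[OF _ b(2)], intro mult_mono) (use x xb yb eu0 e in auto)
  have "x * (el - 1) \<le> x * (exp ?c - 1)" "x * (exp ?c - 1) \<le> x * (eu - 1)"
    using e x by (auto intro!: mult_left_mono)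
  then show "x + bl + yl + x * (el - 1) \<le> Re (Ffun (of_real x) 1)" "Re (Ffun (of_real x) 1) \<le> x + bu + yu + x * (eu - 1)"
    using B1 B2 cl cu unfolding Re_funs[OF x] by linarith+
qed

text \<open>There is hardly any room: the lower bound for \<open>B\<close> exceeds 0.25885 by less
  than 10^-7, while the upper bound for \<open>F\<close> stays below 1 by less than 10^-6. Hence the
  eight digits of \<open>x = 0.40845692\<close> and enclosures with up to ten decimals.\<close>

lemma lower_point:
  "Re (Ffun (of_real (10211423 / 25000000)) 1) < 1" "25885 / 100000 \<le> Re (Bfun (of_real (10211423 / 25000000)) 1)"
proof -
  have "(1880618047 / 1250000000) \<le> exp ((10211423 / 25000000) :: real)" 
    by (rule exp_lower[where ps = "[12351227583 / 10000000000, 5756366139 / 5000000000, 1111058869 / 1000000000, 2718986107 / 2500000000, 5361302417 / 5000000000, 2122930863 / 2000000000, 10533742963 / 10000000000, 5226920511 / 5000000000, 1 / 1]"]) simp_all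
  moreover have "exp ((10211423 / 25000000) :: real) \<le> (15044944379 / 10000000000)" 
    by (rule exp_upper[where ps = "[12351227587 / 10000000000, 2878183073 / 2500000000, 5555294393 / 5000000000, 10875945351 / 10000000000, 5361308057 / 5000000000, 5307409999 / 5000000000, 1053658237 / 1000000000, 84075627 / 80000000, 280634269 / 250000000]"]) simp_all
  moreover have "(12561620117 / 10000000000) \<le> exp ((4561221 / 20000000) :: real)" 
    by (rule exp_lower[where ps = "[5616084197 / 5000000000, 5402800673 / 5000000000, 5298590091 / 5000000000, 5237020371 / 5000000000, 10392847499 / 10000000000, 10335324683 / 10000000000, 10292300179 / 10000000000, 5126700583 / 5000000000, 1 / 1]"]) simp_all
  moreover have "exp ((4561223 / 20000000) :: real) \<le> (100492971 / 80000000)" 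
    by (rule exp_upper[where ps = "[5616084489 / 5000000000, 10805601721 / 10000000000, 10597180459 / 10000000000, 10474040987 / 10000000000, 1039284829 / 1000000000, 5167670469 / 5000000000, 10292794557 / 10000000000, 5135369287 / 5000000000, 213683669 / 200000000]"]) simp_all
  moreover have "(12954395719 / 10000000000) \<le> exp ((1294250377 / 5000000000) :: real)" 
    by (rule exp_lower[where ps = "[11413540117 / 10000000000, 2730422457 / 2500000000, 2670531853 / 2500000000, 1317610999 / 1250000000, 2611975251 / 2500000000, 10382094831 / 10000000000, 1291608577 / 1250000000, 5143805597 / 5000000000, 1 / 1]"]) simp_all
  moreover have "exp ((323562627 / 1250000000) :: real) \<le> (647719803 / 500000000)" 
    by (rule exp_upper[where ps = "[5706770137 / 5000000000, 10921689929 / 10000000000, 1068212749 / 1000000000, 1054088811 / 1000000000, 2089580441 / 2000000000, 2076424319 / 2000000000, 10333591311 / 10000000000, 10309945683 / 10000000000, 2155310061 / 2000000000]"]) simp_all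
  ultimately have "(1294250377 / 5000000000) \<le> Re (Bfun (of_real (10211423 / 25000000)) 1)"
    "Re (Ffun (of_real (10211423 / 25000000)) 1) \<le> (10211423 / 25000000) + (323562627 / 1250000000) + (4561223 / 20000000) + (10211423 / 25000000) * ((100492971 / 80000000) - 1)"
    by - (rule bracket[where yl = "(4561221 / 20000000)" and yu = "(4561223 / 20000000)" and xl = "(1880618047 / 1250000000)" and xu = "(15044944379 / 10000000000)" and el = "(12561620117 / 10000000000)" and eu = "(100492971 / 80000000)"
        and bl = "(1294250377 / 5000000000)" and bu = "(323562627 / 1250000000)" and fl = "(12954395719 / 10000000000)" and fu = "(647719803 / 500000000)"]; (assumption | simp))+
  then show "Re (Ffun (of_real (10211423 / 25000000)) 1) < 1" "25885 / 100000 \<le> Re (Bfun (of_real (10211423 / 25000000)) 1)" by simp_all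
qed

text \<open>On this side the margin is wider, and five digits of \<open>x\<close> suffice.\<close>

lemma upper_point:
  "1 < Re (Ffun (of_real (40847 / 100000)) 1)" "Re (Bfun (of_real (40847 / 100000)) 1) < 2589 / 10000"
proof -
  have "(3009028233 / 2000000000) \<le> exp ((40847 / 100000) :: real)" 
    by (rule exp_lower[where ps = "[3087828461 / 2500000000, 11512785981 / 10000000000, 2777656831 / 2500000000, 2718993621 / 2500000000, 2144525877 / 2000000000, 5307337519 / 5000000000, 10533760797 / 10000000000, 2090771111 / 2000000000, 1 / 1]"]) simp_all
  moreover have "exp ((40847 / 100000) :: real) \<le> (940321323 / 625000000)" 
    by (rule exp_upper[where ps = "[1543914231 / 1250000000, 5756392997 / 5000000000, 11110627419 / 10000000000, 10875975407 / 10000000000, 10722640667 / 10000000000, 10614840743 / 10000000000, 10536600477 / 10000000000, 1050947147 / 1000000000, 1122541 / 1000000]"]) simp_all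
  moreover have "(12562321703 / 10000000000) \<le> exp ((2281169 / 10000000) :: real)" 
    by (rule exp_lower[where ps = "[1123249397 / 1000000000, 10805810273 / 10000000000, 2119466661 / 2000000000, 5237080683 / 5000000000, 10392946917 / 10000000000, 10335409191 / 10000000000, 1029237353 / 1000000000, 5126731611 / 5000000000, 1 / 1]"]) simp_all
  moreover have "exp ((2281171 / 10000000) :: real) \<le> (12562324217 / 10000000000)" 
    by (rule exp_upper[where ps = "[11232495137 / 10000000000, 10805811023 / 10000000000, 331166683 / 312500000, 10474161827 / 10000000000, 10392947887 / 10000000000, 10335425613 / 10000000000, 10292868403 / 10000000000, 10270809249 / 10000000000, 106843513 / 100000000]"]) simp_all
  moreover have "(1295482121 / 1000000000) \<le> exp ((2588829201 / 10000000000) :: real)" 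
    by (rule exp_lower[where ps = "[5706867817 / 5000000000, 1365226831 / 1250000000, 2136443721 / 2000000000, 5270479839 / 5000000000, 5223979999 / 5000000000, 259553623 / 250000000, 5166456017 / 5000000000, 10287647689 / 10000000000, 1 / 1]"]) simp_all
  moreover have "exp ((1294414861 / 5000000000) :: real) \<le> (6477410943 / 5000000000)" 
    by (rule exp_upper[where ps = "[2282747189 / 2000000000, 10921814847 / 10000000000, 2136443751 / 2000000000, 10540959853 / 10000000000, 10447961247 / 10000000000, 10382171737 / 10000000000, 10333635039 / 10000000000, 5154993939 / 5000000000, 10776648917 / 10000000000]"]) simp_all
  ultimately have "Re (Bfun (of_real (40847 / 100000)) 1) \<le> (1294414861 / 5000000000)"
    "(40847 / 100000) + (2588829201 / 10000000000) + (2281169 / 10000000) + (40847 / 100000) * ((12562321703 / 10000000000) - 1) \<le> Re (Ffun (of_real (40847 / 100000)) 1)"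
    by - (rule bracket[where yl = "(2281169 / 10000000)" and yu = "(2281171 / 10000000)" and xl = "(3009028233 / 2000000000)" and xu = "(940321323 / 625000000)" and el = "(12562321703 / 10000000000)" and eu = "(12562324217 / 10000000000)"
        and bl = "(2588829201 / 10000000000)" and bu = "(1294414861 / 5000000000)" and fl = "(1295482121 / 1000000000)" and fu = "(6477410943 / 5000000000)"]; (assumption | simp))+
  then show "1 < Re (Ffun (of_real (40847 / 100000)) 1)" "Re (Bfun (of_real (40847 / 100000)) 1) < 2589 / 10000" by simp_all
qed

text \<open>The intermediate value theorem locates \<open>F = 1\<close> between the two points, and
  \<open>B\<close> increases with \<open>x\<close> because it is a majorant. The bounds on
  \<open>B\<close> are half of those claimed for the mean constant.\<close>

lemma critical_point:
  obtains x :: real where "0 < x" "x < xmax" "Ffun (of_real x) 1 = 1"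
    "25885 / 100000 \<le> Re (Bfun (of_real x) 1)" "Re (Bfun (of_real x) 1) < 2589 / 10000"
proof -
  have hol: "(\<lambda>X. Ffun X 1) holomorphic_on ball 0 xmax"
    using holomorphic_funs(3)[of "ball 0 xmax" "\<lambda>X. X" "\<lambda>_. 1"] by auto
  have cont: "isCont (\<lambda>x. Re (Ffun (of_real x) 1)) x" if "(10211423 / 25000000) \<le> x" "x \<le> (40847 / 100000)" for x :: real
  proof -
    have F: "isCont (\<lambda>X. Ffun X 1) (of_real x)"
      using hol that by (intro continuous_on_interior[OF holomorphic_on_imp_continuous_on[OF hol]]) simp
    have "isCont (\<lambda>x. Ffun (of_real x) 1) x"
      by (rule isCont_o2[where f = complex_of_real and g = "\<lambda>X. Ffun X 1", OF _ F]) (intro continuous_intros)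
    then show ?thesis by (rule isCont_Re)
  qed
  obtain x where x: "(10211423 / 25000000) \<le> x" "x \<le> (40847 / 100000)" "Re (Ffun (of_real x) 1) = 1"
    using IVT[of "\<lambda>x. Re (Ffun (of_real x) 1)" "(10211423 / 25000000)" 1 "(40847 / 100000)"] lower_point(1) upper_point(1) cont by (auto simp: less_imp_le)
  have mono: "Re (Bfun (of_real y) 1) \<le> Re (Bfun (of_real z) 1)" if "0 \<le> y" "y \<le> z" "z \<le> xmax" for y z :: real
    using majorantD[OF majorant_Bfun, of "of_real y" z 1 1] complex_Re_le_cmod[of "Bfun (of_real y) 1"] that by simp
  show thesis
  proof (rule that[of x])
    show "Ffun (of_real x) 1 = 1" using majorant_real(1)[OF majorant_Ffun, of x 1] x by simp
    show "25885 / 100000 \<le> Re (Bfun (of_real x) 1)" using mono[of "(10211423 / 25000000)" x] lower_point(2) x by simp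
    show "Re (Bfun (of_real x) 1) < 2589 / 10000" using mono[of x "(40847 / 100000)"] upper_point(2) x by simp
  qed (use x in auto)
qed


subsection \<open>The coefficient integral over the critical circle\<close>

text \<open>Moves the integral over a period to an interval centred at the saddle, angle 0.\<close>

lemma has_integral_periodic_circle:
  fixes h :: "real \<Rightarrow> complex"
  assumes h: "continuous_on UNIV h" "\<And>x. h (x + 2 * pi) = h x"
    and I: "((\<lambda>t. h (2 * pi * t) * (2 * pi)) has_integral I) {0..1}"
  shows "(h has_integral I) {-pi..pi}"
proof -
  have int: "h integrable_on {a..b}" for a b
    by (intro integrable_continuous_real continuous_on_subset[OF h(1)]) auto
  have shift: "integral {pi..2 * pi} h = integral {-pi..0} h"
  proof -
    have "(h has_integral integral {pi..2 * pi} h) (cbox pi (2 * pi))" using int by (simp add: integrable_integral)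
    from has_integral_affinity'[OF this, of 1 "2 * pi"]
    have "(h has_integral integral {pi..2 * pi} h) {-pi..0}" using h(2) by (simp add: add.commute)
    then show ?thesis by (simp add: integral_unique)
  qed
  have "(h has_integral integral {0..2 * pi} h) (cbox 0 (2 * pi))" using int by (simp add: integrable_integral)
  from has_integral_affinity'[OF this, of "2 * pi" 0]
  have "((\<lambda>t. h (2 * pi * t)) has_integral (integral {0..2 * pi} h /\<^sub>R (2 * pi))) {0..1}" by simp
  from has_integral_mult_left[OF this, of "of_real (2 * pi)"]
  have "((\<lambda>t. h (2 * pi * t) * (2 * pi)) has_integral integral {0..2 * pi} h) {0..1}"
    by (simp add: scaleR_conv_of_real field_simps)
  then have "I = integral {0..2 * pi} h" using I has_integral_unique by blast
  also have "\<dots> = integral {0..pi} h + integral {pi..2 * pi} h"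
    using Henstock_Kurzweil_Integration.integral_combine[of 0 pi "2 * pi" h] int by simp
  also have "\<dots> = integral {-pi..0} h + integral {0..pi} h" unfolding shift by simp
  also have "\<dots> = integral {-pi..pi} h"
    using Henstock_Kurzweil_Integration.integral_combine[of "-pi" 0 pi h] int by simp
  finally show ?thesis using int by (simp add: integrable_integral)
qed

locale critical =
  fixes x0 :: real
  assumes x0: "0 < x0" "x0 < xmax" and crit: "Ffun (of_real x0) 1 = 1"
begin

definition D0 :: real where "D0 = Re (Dfun x0 1)"
definition B0 :: real where "B0 = Re (Bfun x0 1)"

lemma Dfun_x0: "Dfun x0 1 = of_real D0" and Bfun_x0: "Bfun x0 1 = of_real B0"
  using majorant_real(1)[OF majorant_Dfun, of x0 1] majorant_real(1)[OF majorant_Bfun, of x0 1] x0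
  by (simp_all add: D0_def B0_def)

definition wfun :: "real \<Rightarrow> complex \<Rightarrow> complex" where
  "wfun \<theta> u = deriv (\<lambda>X. Ffun X u) (x0 * cis \<theta>) * (x0 * cis \<theta>)"

text \<open>Subtracting \<open>D0\<close> makes the exponential factor equal to 1 at the saddle for
  \<open>u = 1\<close>.\<close>

definition integrand :: "nat \<Rightarrow> complex \<Rightarrow> real \<Rightarrow> complex" where
  "integrand N u \<theta> = wfun \<theta> u * exp (of_nat N * (Dfun (x0 * cis \<theta>) u - D0)) * cis (- (real N * \<theta>))"

definition J :: "nat \<Rightarrow> complex \<Rightarrow> complex" where
  "J N u = integral {-pi..pi} (integrand N u)"

lemma in_disc: "x0 * cis \<theta> \<in> ball 0 xmax"
  using x0 by (simp add: norm_mult)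

lemma holomorphic_X:
  assumes "cmod u \<le> umax"
  shows "(\<lambda>X. Dfun X u) holomorphic_on ball 0 xmax" "(\<lambda>X. Ffun X u) holomorphic_on ball 0 xmax"
    "deriv (\<lambda>X. Ffun X u) holomorphic_on ball 0 xmax"
proof -
  show "(\<lambda>X. Dfun X u) holomorphic_on ball 0 xmax" and F: "(\<lambda>X. Ffun X u) holomorphic_on ball 0 xmax"
    using holomorphic_funs(2,3)[of "ball 0 xmax" "\<lambda>X. X" "\<lambda>_. u"] assms by auto
  show "deriv (\<lambda>X. Ffun X u) holomorphic_on ball 0 xmax" using F by (rule holomorphic_deriv) simp
qed

lemma continuous_on_circle:
  assumes "g holomorphic_on ball 0 xmax"
  shows "continuous_on UNIV (\<lambda>\<theta>. g (x0 * cis \<theta>))"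
proof -
  have "continuous_on UNIV (\<lambda>\<theta>. complex_of_real x0 * cis \<theta>)" by (intro continuous_intros)
  then show ?thesis
    by (rule continuous_on_compose2[OF holomorphic_on_imp_continuous_on[OF assms]]) (use in_disc in auto)
qed

lemma continuous_on_integrand:
  assumes "cmod u \<le> umax" shows "continuous_on UNIV (integrand N u)"
  unfolding integrand_def wfun_def
  by (intro continuous_intros continuous_on_circle holomorphic_X assms)

text \<open>The factor in front of the tree sum does not depend on \<open>u\<close>; it will cancel
  in quotients of \<open>J\<close>.\<close>

lemma J_eq:
  assumes u: "u \<noteq> 0" "cmod u \<le> umax"
  shows "J (Suc n) u = of_real (2 * pi * real (Suc n) / fact n * x0 ^ Suc n * exp (- (real (Suc n) * D0))) *
     (\<Sum>t\<in>UNIV. tree_count u t n)"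
proof -
  define N where "N = Suc n"
  define S where "S = (\<Sum>t\<in>UNIV. tree_count u t n) / fact n"
  define G where "G X = deriv (\<lambda>X. Ffun X u) X * exp (of_nat N * Dfun X u) / X ^ N" for X
  have "(G has_contour_integral (2 * pi * \<i> * (of_nat N * S))) (circlepath 0 x0)"
    using tree_count_contour_integral[OF u x0, of n] unfolding G_def N_def S_def .
  then have I: "((\<lambda>t. G (circlepath 0 x0 t) * vector_derivative (circlepath 0 x0) (at t)) has_integral 2 * pi * \<i> * (of_nat N * S)) {0..1}"
    unfolding has_contour_integral .
  have cancel: "(A / j) * (B * (P * j * Z)) = A * (B * (P * Z))" if "j \<noteq> 0" for A B P Z j :: complex
    using that by simp
  define c where "c = of_real (x0 ^ N * exp (- (real N * D0))) / \<i>"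
  have e: "integrand N u (2 * pi * t) * of_real (2 * pi) = c * (G (circlepath 0 x0 t) * vector_derivative (circlepath 0 x0) (at t))" for t :: real
  proof -
    let ?X = "x0 * cis (2 * pi * t)"
    have cp: "circlepath 0 x0 t = ?X" by (simp add: circlepath cis_conv_exp mult_ac)
    have vd: "vector_derivative (circlepath 0 x0) (at t) = 2 * pi * \<i> * ?X"
      unfolding vector_derivative_circlepath by (simp add: cis_conv_exp mult_ac)
    have "cis (- (real N * (2 * pi * t))) = inverse (cis (2 * pi * t) ^ N)"
      by (simp only: cis_inverse[symmetric] Complex.DeMoivre)
    moreover have "exp (of_nat N * (Dfun ?X u - D0)) = exp (of_nat N * Dfun ?X u) * of_real (exp (- (real N * D0)))"
      by (simp add: right_diff_distrib exp_diff exp_minus exp_of_real[symmetric] divide_inverse)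
    ultimately have "integrand N u (2 * pi * t) = deriv (\<lambda>X. Ffun X u) ?X * ?X * (exp (of_nat N * Dfun ?X u) * of_real (exp (- (real N * D0)))) * inverse (cis (2 * pi * t) ^ N)"
      unfolding integrand_def wfun_def by simp
    moreover have "a * (x * q) * (E * k) * inverse (q ^ N) * P = (x ^ N * k) / \<i> * (a * E / (x * q) ^ N * (P * \<i> * (x * q)))"
      if "x \<noteq> 0" for a E k q P x :: complex
    proof -
      have "(x ^ N * k) / \<i> * (a * E / (x * q) ^ N * (P * \<i> * (x * q))) = (x ^ N * k) * (a * E / (x * q) ^ N * (P * (x * q)))"
        by (rule cancel) simp
      also have "\<dots> = a * (x * q) * (E * k) * (x ^ N / (x * q) ^ N) * P"
        by (simp only: divide_inverse mult_ac)
      also have "x ^ N / (x * q) ^ N = inverse (q ^ N)" using that by (simp add: power_mult_distrib divide_inverse)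
      finally show ?thesis by (rule sym)
    qed
    ultimately show ?thesis
      unfolding G_def cp vd c_def of_real_mult[of "x0 ^ N"] of_real_power using x0 by simp
  qed
  have "((\<lambda>t. integrand N u (2 * pi * t) * of_real (2 * pi)) has_integral c * (2 * pi * \<i> * (of_nat N * S))) {0..1}"
    unfolding e by (rule has_integral_mult_right[OF I])
  moreover have "c * (2 * pi * \<i> * (of_nat N * S)) = of_real (x0 ^ N * exp (- (real N * D0))) * (2 * pi * (of_nat N * S))"
  proof -
    have "(A / j) * (P * j * Z) = A * (P * Z)" if "j \<noteq> 0" for A P Z j :: complex using that by simp
    from this[OF complex_i_not_zero] show ?thesis unfolding c_def .
  qed
  ultimately have "((\<lambda>t. integrand N u (2 * pi * t) * (2 * pi)) has_integral of_real (x0 ^ N * exp (- (real N * D0))) * (2 * pi * (of_nat N * S))) {0..1}"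
    by (simp only:)
  then have "(integrand N u has_integral of_real (x0 ^ N * exp (- (real N * D0))) * (2 * pi * (of_nat N * S))) {-pi..pi}"
  proof (rule has_integral_periodic_circle[OF continuous_on_integrand[OF u(2)], rotated])
    fix x :: real
    have "cis (x + 2 * pi) = cis x" by (simp add: complex_eq_iff)
    moreover have "cis (- (real N * (x + 2 * pi))) = cis (- (real N * x))"
    proof -
      have "- (real N * (x + 2 * pi)) = - (real N * x) + 2 * pi * of_int (- int N)" by (simp add: algebra_simps)
      then have "cis (- (real N * (x + 2 * pi))) = cis (- (real N * x)) * cis (2 * pi * of_int (- int N))"
        by (simp only: cis_mult[of "- (real N * x)" "2 * pi * of_int (- int N)"])
      also have "cis (2 * pi * of_int (- int N)) = 1" by (rule cis_multiple_2pi[OF Ints_of_int])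
      finally show ?thesis by simp
    qed
    ultimately show "integrand N u (x + 2 * pi) = integrand N u x" unfolding integrand_def wfun_def by simp
  qed
  then have "J N u = of_real (x0 ^ N * exp (- (real N * D0))) * (2 * pi * (of_nat N * S))" unfolding J_def by (rule integral_unique)
  then show ?thesis unfolding N_def[symmetric] S_def
    by (simp add: mult_ac)
qed

end


subsection \<open>Elementary estimates\<close>

text \<open>By the half-angle formula this reduces to \<open>sin y \<ge> y / 2\<close>. Up to 8/5, a
  rational bound for half of \<open>pi\<close>, the cubic Taylor polynomial
  \<open>y - y^3 / 6\<close> is at least \<open>y / 2\<close>.\<close>

lemma one_minus_cos_ge:
  assumes "\<bar>\<theta>\<bar> \<le> pi" shows "\<theta>\<^sup>2 / 8 \<le> 1 - cos \<theta>"
proof -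
  define y where "y = \<bar>\<theta>\<bar> / 2"
  have y: "0 \<le> y" "y \<le> 8 / 5" using assms pi_less_4 pi_approx by (auto simp: y_def)
  have "\<bar>sin y - (\<Sum>m<3. sin_coeff m * y ^ m)\<bar> \<le> inverse (fact 3) * \<bar>y\<bar> ^ 3" by (rule Maclaurin_sin_bound)
  then have "\<bar>sin y - y\<bar> \<le> y ^ 3 / 6"
    using y by (simp add: sin_coeff_def eval_nat_numeral)
  then have "y - y ^ 3 / 6 \<le> sin y" by linarith
  moreover have "y * (1 / 2) \<le> y - y ^ 3 / 6"
  proof -
    have "y * y \<le> 8 / 5 * (8 / 5)" using y by (intro mult_mono) auto
    then have "y * (y * y) \<le> y * 3" using y by (intro mult_left_mono) auto
    then show ?thesis by (simp add: power3_eq_cube)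
  qed
  ultimately have "y / 2 \<le> sin y" by simp
  then have "(y / 2)\<^sup>2 \<le> (sin y)\<^sup>2" using y by (intro power_mono) auto
  moreover have "cos \<theta> = 1 - 2 * (sin y)\<^sup>2"
    using cos_double_sin[of y] by (simp add: y_def)
  ultimately show ?thesis by (simp add: y_def power_divide)
qed

text \<open>In half angles this is the square of the subadditivity of
  \<open>\<bar>sin\<bar>\<close>. It turns losses in the phases \<open>4 \<theta> + t\<close> and
  \<open>5 \<theta> + t\<close> into a loss in \<open>\<theta>\<close>.\<close>

lemma one_minus_cos_diff: "1 - cos (b - a) \<le> 2 * ((1 - cos a) + (1 - cos b))" for a b :: real
proof -
  have c: "1 - cos x = 2 * (sin (x / 2))\<^sup>2" for x :: real using cos_double_sin[of "x / 2"] by simp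
  have "\<bar>sin (b / 2 - a / 2)\<bar> \<le> \<bar>sin (b / 2)\<bar> * \<bar>cos (a / 2)\<bar> + \<bar>cos (b / 2)\<bar> * \<bar>sin (a / 2)\<bar>"
    unfolding sin_diff by (simp flip: abs_mult)
  also have "\<dots> \<le> \<bar>sin (b / 2)\<bar> * 1 + 1 * \<bar>sin (a / 2)\<bar>"
    by (intro add_mono mult_left_mono mult_right_mono) auto
  finally have "(sin (b / 2 - a / 2))\<^sup>2 \<le> (\<bar>sin (b / 2)\<bar> + \<bar>sin (a / 2)\<bar>)\<^sup>2"
    by (metis abs_ge_zero mult.right_neutral mult_1 power2_abs power_mono)
  also have "\<dots> \<le> 2 * ((sin (b / 2))\<^sup>2 + (sin (a / 2))\<^sup>2)"
    using sum_squares_bound[of "\<bar>sin (b / 2)\<bar>" "\<bar>sin (a / 2)\<bar>"] by (simp add: power2_sum)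
  finally show ?thesis unfolding c by (simp add: diff_divide_distrib)
qed

lemma gaussian_integrable:
  assumes "(k :: real) > 0"
  shows "integrable lborel (\<lambda>s. exp (- k * s\<^sup>2))" "(\<integral>s. exp (- k * s\<^sup>2) \<partial>lborel) > 0"
proof -
  define \<sigma> where "\<sigma> = 1 / sqrt (2 * k)"
  have s: "\<sigma> > 0" "\<sigma>\<^sup>2 = 1 / (2 * k)" using assms by (simp_all add: \<sigma>_def power_divide)
  have eq: "exp (- k * s\<^sup>2) = sqrt (2 * pi * \<sigma>\<^sup>2) * normal_density 0 \<sigma> s" for s
    using s assms by (simp add: normal_density_def field_simps)
  show "integrable lborel (\<lambda>s. exp (- k * s\<^sup>2))" unfolding eq using s by (intro integrable_mult_right) simp
  have "(\<integral>s. exp (- k * s\<^sup>2) \<partial>lborel) = sqrt (2 * pi * \<sigma>\<^sup>2)" unfolding eq using s by simp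
  then show "(\<integral>s. exp (- k * s\<^sup>2) \<partial>lborel) > 0" using s assms by simp
qed

lemma of_nat_one_minus_cos_limit: "(\<lambda>n. real n * (1 - cos (x / sqrt (real n)))) \<longlonglongrightarrow> x\<^sup>2 / 2"
proof (cases "x = 0")
  case False
  have "((\<lambda>z. (1 - cos z) / z\<^sup>2) \<longlongrightarrow> 1 / 2) (at (0::real))" by real_asymp
  moreover have "filterlim (\<lambda>n. x / sqrt (real n)) (at 0) sequentially"
    unfolding filterlim_at
  proof
    show "(\<lambda>n. x / sqrt (real n)) \<longlonglongrightarrow> 0" by (intro tendsto_divide_0[OF tendsto_const] filterlim_at_top_imp_at_infinity
       filterlim_compose[OF sqrt_at_top filterlim_real_sequentially])
    show "\<forall>\<^sub>F n in sequentially. x / sqrt (real n) \<in> UNIV \<and> x / sqrt (real n) \<noteq> 0"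
      using eventually_gt_at_top[of 0] by eventually_elim (use False in auto)
  qed
  ultimately have "(\<lambda>n. (1 - cos (x / sqrt (real n))) / (x / sqrt (real n))\<^sup>2) \<longlonglongrightarrow> 1 / 2" by (rule filterlim_compose)
  from tendsto_mult_right[OF this, of "x\<^sup>2"]
  have "(\<lambda>n. (1 - cos (x / sqrt (real n))) / (x / sqrt (real n))\<^sup>2 * x\<^sup>2) \<longlonglongrightarrow> 1 / 2 * x\<^sup>2" .
  moreover have "\<forall>\<^sub>F n in sequentially. (1 - cos (x / sqrt (real n))) / (x / sqrt (real n))\<^sup>2 * x\<^sup>2 = real n * (1 - cos (x / sqrt (real n)))"
    using eventually_gt_at_top[of 0] by eventually_elim (use False in \<open>simp add: power_divide\<close>)
  ultimately show ?thesis using Lim_transform_eventually by fastforce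
qed simp

lemma cnj_cfun:
  assumes "cmod X \<le> xmax" "cmod u \<le> umax"
  shows "cnj (cfun X u) = cfun (cnj X) (cnj u)"
proof -
  have it: "cnj (citer k X u) = citer k (cnj X) (cnj u)" for k
    by (induction k) (simp_all add: cstep_def exp_cnj)
  have "(\<lambda>n. cnj (citer n X u)) \<longlonglongrightarrow> cnj (cfun X u)" by (intro tendsto_cnj citer_tendsto assms)
  moreover have "(\<lambda>n. citer n (cnj X) (cnj u)) \<longlonglongrightarrow> cfun (cnj X) (cnj u)" by (intro citer_tendsto) (use assms in simp_all)
  ultimately show ?thesis unfolding it using LIMSEQ_unique by blast
qed

context critical
begin

subsection \<open>Local expansion at the critical point\<close>

text \<open>For complex \<open>s\<close>, \<open>t\<close> below this radius,
  \<open>x0 exp (i s)\<close> and \<open>exp (i t)\<close> remain in the discs of \<open>X\<close>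
  and \<open>u\<close>. It is positive because both discs reach strictly beyond \<open>x0\<close>
  and 1; complex \<open>t\<close> will supply exponential moments.\<close>

definition \<delta> :: real where "\<delta> = min (ln (xmax / x0)) (ln umax)"

lemma delta_pos: "\<delta> > 0"
  using x0 by (simp add: \<delta>_def)

lemma norm_exp_delta:
  assumes "cmod s < \<delta>"
  shows "cmod (x0 * exp (\<i> * s)) \<le> xmax" "cmod (exp (\<i> * s)) \<le> umax"
proof -
  have e: "cmod (exp (\<i> * s)) \<le> exp \<delta>"
    using norm_exp[of "\<i> * s"] order_trans[of _ "exp (cmod (\<i> * s))" "exp \<delta>"] assms by (simp add: norm_mult)
  have "\<delta> \<le> ln (xmax / x0)" "\<delta> \<le> ln umax" unfolding \<delta>_def by (rule min.cobounded1 min.cobounded2)+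
  then have d: "exp \<delta> \<le> xmax / x0" "exp \<delta> \<le> umax"
    using x0 ln_ge_iff[of "xmax / x0" \<delta>] ln_ge_iff[of umax \<delta>] by simp_all
  then show "cmod (exp (\<i> * s)) \<le> umax" using e by linarith
  have "cmod (x0 * exp (\<i> * s)) \<le> x0 * (xmax / x0)" unfolding norm_mult using order_trans[OF e d(1)] x0 by (intro mult_mono) auto
  then show "cmod (x0 * exp (\<i> * s)) \<le> xmax" using x0 by simp
qed

definition f :: "complex \<Rightarrow> complex \<Rightarrow> complex" where
  "f s t = Dfun (x0 * exp (\<i> * s)) (exp (\<i> * t))"

definition F :: "complex \<Rightarrow> complex \<Rightarrow> complex" where
  "F s t = Ffun (x0 * exp (\<i> * s)) (exp (\<i> * t))"

definition MD :: real where "MD = Re (Dfun xmax umax)"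
definition MF :: real where "MF = Re (Ffun xmax umax)"

lemma norm_Dfun: "cmod X \<le> xmax \<Longrightarrow> cmod u \<le> umax \<Longrightarrow> cmod (Dfun X u) \<le> MD"
  and norm_Ffun: "cmod X \<le> xmax \<Longrightarrow> cmod u \<le> umax \<Longrightarrow> cmod (Ffun X u) \<le> MF"
  unfolding MD_def MF_def by (intro majorantD majorant_Dfun majorant_Ffun order_refl; assumption)+

sublocale Dv: two_variables f \<delta> MD
proof
  show "(\<lambda>s. f s t) holomorphic_on ball 0 \<delta>" if "cmod t < \<delta>" for t
    unfolding f_def by (rule holomorphic_funs(2)) (use norm_exp_delta that in \<open>auto intro!: holomorphic_intros\<close>)
  show "(\<lambda>t. f s t) holomorphic_on ball 0 \<delta>" if "cmod s < \<delta>" for s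
    unfolding f_def by (rule holomorphic_funs(2)) (use norm_exp_delta that in \<open>auto intro!: holomorphic_intros\<close>)
  show "cmod (f s t) \<le> MD" if "cmod s < \<delta>" "cmod t < \<delta>" for s t
    unfolding f_def using norm_exp_delta that by (intro norm_Dfun) auto
qed (rule delta_pos)

sublocale Fv: two_variables F \<delta> MF
proof
  show "(\<lambda>s. F s t) holomorphic_on ball 0 \<delta>" if "cmod t < \<delta>" for t
    unfolding F_def by (rule holomorphic_funs(3)) (use norm_exp_delta that in \<open>auto intro!: holomorphic_intros\<close>)
  show "(\<lambda>t. F s t) holomorphic_on ball 0 \<delta>" if "cmod s < \<delta>" for s
    unfolding F_def by (rule holomorphic_funs(3)) (use norm_exp_delta that in \<open>auto intro!: holomorphic_intros\<close>)
  show "cmod (F s t) \<le> MF" if "cmod s < \<delta>" "cmod t < \<delta>" for s t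
    unfolding F_def using norm_exp_delta that by (intro norm_Ffun) auto
qed (rule delta_pos)

lemma at_origin: "f 0 0 = of_real D0" "F 0 0 = 1"
  using crit Dfun_x0 by (simp_all add: f_def F_def)

lemma near_0: "\<forall>\<^sub>F s in nhds 0. cmod s < \<delta>"
proof -
  have "\<forall>\<^sub>F s in nhds 0. s \<in> ball (0::complex) \<delta>" using delta_pos by (intro eventually_nhds_in_open) auto
  then show ?thesis by simp
qed

text \<open>The saddle equation \<open>x0 D_X = 1\<close> in exponential coordinates. Both sides of
  \<open>X exp (- D) exp F = F\<close> are differentiated; as \<open>F = 1\<close>, the derivative
  of \<open>F\<close> occurs with factor 1 on both sides and cancels.\<close>

lemma deriv_1: "deriv (\<lambda>s. f s 0) 0 = \<i>"
proof -
  let ?f = "deriv (\<lambda>s. f s 0) 0" and ?F = "deriv (\<lambda>s. F s 0) 0"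
  have df: "((\<lambda>s. f s 0) has_field_derivative ?f) (at 0)" "((\<lambda>s. F s 0) has_field_derivative ?F) (at 0)"
    using Dv.hol1[of 0] Fv.hol1[of 0] delta_pos holomorphic_derivI[of _ "ball 0 \<delta>"] by auto
  have L: "((\<lambda>s. x0 * exp (\<i> * s) * exp (- f s 0) * exp (F s 0)) has_field_derivative (\<i> - ?f + ?F) * (x0 * exp (- f 0 0) * exp (F 0 0))) (at 0)"
    by (rule derivative_eq_intros refl df | simp add: algebra_simps)+
  have ev: "\<forall>\<^sub>F s in nhds 0. x0 * exp (\<i> * s) * exp (- f s 0) * exp (F s 0) = F s 0"
    using near_0
  proof eventually_elim
    case (elim s)
    then show ?case using Ffun_identity[of "x0 * exp (\<i> * s)" 1] norm_exp_delta(1)[of s]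
      by (simp add: f_def F_def Zfun_def)
  qed
  have "x0 * exp (- f 0 0) * exp (F 0 0) = 1" using eventually_nhds_x_imp_x[OF ev] at_origin by simp
  then have "((\<lambda>s. F s 0) has_field_derivative (\<i> - ?f + ?F)) (at 0)"
    using L DERIV_cong_ev[OF refl ev refl] by simp
  then have "\<i> - ?f + ?F = ?F" using df(2) DERIV_unique by blast
  then show ?thesis by simp
qed

text \<open>The same cancellation in the direction of \<open>u\<close>: the surviving term is the
  derivative of \<open>B (1 - exp (- i t))\<close>, which at 0 is \<open>i B0\<close>.\<close>

lemma deriv_2: "deriv (f 0) 0 = \<i> * B0"
proof -
  let ?f = "deriv (f 0) 0" and ?F = "deriv (F 0) 0"
  define B where "B t = Bfun x0 (exp (\<i> * t))" for t
  have hB: "B holomorphic_on ball 0 \<delta>"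
    unfolding B_def by (rule holomorphic_funs(1)) (use x0 norm_exp_delta in \<open>auto intro!: holomorphic_intros\<close>)
  have df: "(f 0 has_field_derivative ?f) (at 0)" "(F 0 has_field_derivative ?F) (at 0)" "(B has_field_derivative deriv B 0) (at 0)"
    using Dv.hol2[of 0] Fv.hol2[of 0] hB delta_pos holomorphic_derivI[of _ "ball 0 \<delta>"] by auto
  have L: "((\<lambda>t. x0 * exp (- f 0 t) * exp (F 0 t)) has_field_derivative (- ?f + ?F) * (x0 * exp (- f 0 0) * exp (F 0 0))) (at 0)"
    by (rule derivative_eq_intros refl df | simp add: algebra_simps)+
  have R: "((\<lambda>t. F 0 t - B t * (1 - exp (- (\<i> * t)))) has_field_derivative (?F - B 0 * \<i>)) (at 0)"
    by (rule derivative_eq_intros refl df | simp)+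
  have ev: "\<forall>\<^sub>F t in nhds 0. x0 * exp (- f 0 t) * exp (F 0 t) = F 0 t - B t * (1 - exp (- (\<i> * t)))"
    using near_0
  proof eventually_elim
    case (elim t)
    then show ?case using Ffun_identity[of x0 "exp (\<i> * t)"] norm_exp_delta(2)[of t] x0
      by (simp add: f_def F_def Zfun_def B_def exp_minus)
  qed
  have "x0 * exp (- f 0 0) * exp (F 0 0) = 1" using eventually_nhds_x_imp_x[OF ev] at_origin by simp
  then have "((\<lambda>t. F 0 t - B t * (1 - exp (- (\<i> * t)))) has_field_derivative (- ?f + ?F)) (at 0)"
    using L DERIV_cong_ev[OF refl ev refl] by simp
  then have "- ?f + ?F = ?F - B 0 * \<i>" using R DERIV_unique by blast
  then show ?thesis using Bfun_x0 by (simp add: B_def algebra_simps)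
qed

text \<open>The exponent of the integrand after scaling both angles by \<open>sqrt n\<close>, with
  its linear part removed.\<close>

definition A :: "nat \<Rightarrow> complex \<Rightarrow> complex \<Rightarrow> complex" where
  "A n s t = of_nat n * (f (s / complex_of_real (sqrt n)) (t / complex_of_real (sqrt n)) - f 0 0) - sqrt n * (\<i> * s + \<i> * B0 * t)"

definition q11 :: complex where "q11 = Dv.g 2 0"
definition q12 :: complex where "q12 = deriv (Dv.g 1) 0"
definition q22 :: complex where "q22 = deriv (deriv (f 0)) 0 / 2"

lemma A_limit: "(\<lambda>n. A n s t) \<longlonglongrightarrow> q11 * s\<^sup>2 + q12 * s * t + q22 * t\<^sup>2"
  using Dv.second_order[of s t] unfolding A_def deriv_1 deriv_2 q11_def q12_def q22_def .

text \<open>Since \<open>x0 / 2 \<le> 1\<close>, the coefficient of the fourth-degree loss may be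
  lowered to that of the fifth, after which \<open>one_minus_cos_diff\<close> eliminates
  \<open>t\<close>.\<close>

lemma Re_Dfun_circle:
  assumes "0 \<le> v" "v \<le> umax"
  shows "Re (Dfun (x0 * cis \<theta>) (v * cis t)) \<le> Re (Dfun x0 v) - v * x0 ^ 5 / 4 * (1 - cos \<theta>)"
proof -
  have "x0 ^ 5 / 2 \<le> x0 ^ 4"
    using x0 by (simp add: power_numeral_reduce)
  then have "v * (x0 ^ 5 / 2) * (1 - cos (4 * \<theta> + t)) \<le> v * x0 ^ 4 * (1 - cos (4 * \<theta> + t))"
    using assms by (intro mult_right_mono mult_left_mono) auto
  moreover have "v * (x0 ^ 5 / 4) * (1 - cos ((5 * \<theta> + t) - (4 * \<theta> + t))) \<le> v * (x0 ^ 5 / 4) * (2 * ((1 - cos (4 * \<theta> + t)) + (1 - cos (5 * \<theta> + t))))"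
    using assms x0 by (intro mult_left_mono one_minus_cos_diff) auto
  moreover have "v * (x0 ^ 5 / 4) * (2 * ((1 - cos (4 * \<theta> + t)) + (1 - cos (5 * \<theta> + t)))) =
      v * (x0 ^ 5 / 2) * (1 - cos (4 * \<theta> + t)) + v * x0 ^ 5 / 2 * (1 - cos (5 * \<theta> + t))"
    by (simp add: field_simps)
  ultimately show ?thesis using Re_Dfun_bound[of x0 v \<theta> t] assms x0 by simp
qed

end


context critical
begin

subsection \<open>Asymptotics of the coefficient integral\<close>

lemma norm_wfun:
  "\<exists>W. \<forall>\<theta> u. cmod u \<le> umax \<longrightarrow> cmod (wfun \<theta> u) \<le> W"
proof (intro exI allI impI)
  fix \<theta> and u :: complex assume u: "cmod u \<le> umax"
  let ?z = "x0 * cis \<theta>" and ?r = "(xmax - x0) / 2"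
  have r: "?r > 0" using x0 by simp
  have z: "cmod ?z = x0" using x0 by (simp add: norm_mult)
  have sub: "cball ?z ?r \<subseteq> ball 0 xmax"
  proof
    fix y assume "y \<in> cball ?z ?r"
    then have "cmod y \<le> x0 + ?r" using norm_triangle_sub[of y ?z] norm_minus_commute[of y ?z] unfolding z mem_cball dist_norm by linarith
    also have "\<dots> < xmax" using x0 by (simp add: field_simps)
    finally show "y \<in> ball 0 xmax" by simp
  qed
  have "cmod ((deriv ^^ 1) (\<lambda>X. Ffun X u) ?z) \<le> fact 1 * MF / ?r ^ 1"
  proof (rule Cauchy_inequality[OF _ _ r])
    have "(\<lambda>X. Ffun X u) holomorphic_on cball ?z ?r" by (rule holomorphic_on_subset[OF holomorphic_X(2)[OF u] sub])
    then show "(\<lambda>X. Ffun X u) holomorphic_on ball ?z ?r" "continuous_on (cball ?z ?r) (\<lambda>X. Ffun X u)"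
      using ball_subset_cball holomorphic_on_subset holomorphic_on_imp_continuous_on by blast+
    fix x assume "cmod (?z - x) = ?r"
    then have "x \<in> cball ?z ?r" by (simp add: dist_norm)
    then have "x \<in> ball 0 xmax" using sub by blast
    then show "cmod (Ffun x u) \<le> MF" using u by (intro norm_Ffun) auto
  qed
  then show "cmod (wfun \<theta> u) \<le> MF / ?r * x0"
    unfolding wfun_def norm_mult[of _ ?z] z using x0 by (intro mult_right_mono) auto
qed

lemma wfun_eq_deriv:
  assumes s: "\<bar>s\<bar> < \<delta>" and t: "cmod t < \<delta>"
  shows "wfun s (exp (\<i> * t)) = deriv (\<lambda>s. F s t) (of_real s) / \<i>"
proof -
  let ?u = "exp (\<i> * t)" and ?X = "x0 * exp (\<i> * of_real s)"
  have "?X \<in> ball 0 xmax" using in_disc[of s] by (simp add: cis_conv_exp)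
  then have "((\<lambda>X. Ffun X ?u) has_field_derivative deriv (\<lambda>X. Ffun X ?u) ?X) (at ?X)"
    by (intro holomorphic_derivI[OF holomorphic_X(2)[OF norm_exp_delta(2)[OF t]]]) auto
  moreover have "((\<lambda>s. x0 * exp (\<i> * s)) has_field_derivative (?X * \<i>)) (at (of_real s))"
    by (auto intro!: derivative_eq_intros)
  ultimately have "((\<lambda>s. F s t) has_field_derivative deriv (\<lambda>X. Ffun X ?u) ?X * (?X * \<i>)) (at (of_real s))"
    unfolding F_def by (rule DERIV_chain2)
  then have "deriv (\<lambda>s. F s t) (of_real s) = deriv (\<lambda>X. Ffun X ?u) ?X * (?X * \<i>)" by (rule DERIV_imp_deriv)
  then have "deriv (\<lambda>s. F s t) (of_real s) = (deriv (\<lambda>X. Ffun X ?u) ?X * ?X) * \<i>" by (simp only: mult.assoc)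
  then show ?thesis unfolding wfun_def cis_conv_exp using nonzero_mult_div_cancel_right[OF complex_i_not_zero] by simp
qed

text \<open>The constant is uniform in \<open>t\<close>, because \<open>s / sqrt n\<close> and
  \<open>t / sqrt n\<close> tend to 0 simultaneously.\<close>

lemma wfun_lipschitz:
  "\<exists>K. \<forall>s t. \<bar>s\<bar> < \<delta> / 4 \<longrightarrow> cmod t < \<delta> \<longrightarrow>
    cmod (deriv (\<lambda>s. F s t) (of_real s) - Fv.g 1 t) \<le> K * \<bar>s\<bar>"
proof (intro exI allI impI)
  fix s :: real and t :: complex assume s: "\<bar>s\<bar> < \<delta> / 4" and t: "cmod t < \<delta>"
  let ?h = "deriv (\<lambda>s. F s t)"
  have h: "?h holomorphic_on ball 0 \<delta>" using Fv.hol1[OF t] by (rule holomorphic_deriv) simp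
  have b: "cmod (?h z) \<le> MF / (\<delta> / 4)" if z: "cmod z < \<delta> / 2" for z
  proof -
    have sub: "cball z (\<delta> / 4) \<subseteq> ball 0 \<delta>"
    proof
      fix y assume "y \<in> cball z (\<delta> / 4)"
      then have "cmod y \<le> cmod z + \<delta> / 4" using norm_triangle_sub[of y z] norm_minus_commute[of y z] by (simp add: dist_norm)
      then show "y \<in> ball 0 \<delta>" using z delta_pos by simp
    qed
    have "cmod ((deriv ^^ 1) (\<lambda>s. F s t) z) \<le> fact 1 * MF / (\<delta> / 4) ^ 1"
    proof (rule Cauchy_inequality)
      have "(\<lambda>s. F s t) holomorphic_on cball z (\<delta> / 4)" by (rule holomorphic_on_subset[OF Fv.hol1[OF t] sub])
      then show "(\<lambda>s. F s t) holomorphic_on ball z (\<delta> / 4)" "continuous_on (cball z (\<delta> / 4)) (\<lambda>s. F s t)"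
        using ball_subset_cball holomorphic_on_subset holomorphic_on_imp_continuous_on by blast+
      show "0 < \<delta> / 4" using delta_pos by simp
      fix x assume "cmod (z - x) = \<delta> / 4"
      then have "x \<in> cball z (\<delta> / 4)" by (simp add: dist_norm)
      then have "x \<in> ball 0 \<delta>" using sub by blast
      then show "cmod (F x t) \<le> MF" using t by (intro Fv.bound) auto
    qed
    then show ?thesis by simp
  qed
  have "cmod (?h (of_real s) - (\<Sum>k<1. (deriv ^^ k) ?h 0 / fact k * of_real s ^ k))
     \<le> 3 * (MF / (\<delta> / 4)) * (4 / (3 * (\<delta> / 2))) ^ 1 * cmod (of_real s) ^ 1"
    using delta_pos s by (intro holomorphic_taylor_bound[OF holomorphic_on_subset[OF h]] b) auto
  then show "cmod (?h (of_real s) - Fv.g 1 t) \<le> 3 * (MF / (\<delta> / 4)) * (4 / (3 * (\<delta> / 2))) * \<bar>s\<bar>"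
    by (simp add: Fv.g_def)
qed

lemma over_sqrt_limit: "(\<lambda>n. x / of_real (sqrt (real n))) \<longlonglongrightarrow> 0" for x :: "'a :: real_normed_field"
proof -
  have "(\<lambda>n. 1 / sqrt (real n)) \<longlonglongrightarrow> 0" by real_asymp
  from tendsto_mult[OF tendsto_const[of x] tendsto_of_real[OF this, where 'a = 'a]] show ?thesis by simp
qed

lemma wfun_limit: "(\<lambda>n. wfun (s / sqrt n) (exp (\<i> * (t / of_real (sqrt n))))) \<longlonglongrightarrow> wfun 0 1"
proof -
  obtain K where K: "\<And>s t. \<bar>s\<bar> < \<delta> / 4 \<Longrightarrow> cmod t < \<delta> \<Longrightarrow>
    cmod (deriv (\<lambda>s. F s t) (of_real s) - Fv.g 1 t) \<le> K * \<bar>s\<bar>" using wfun_lipschitz by blast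
  let ?s = "\<lambda>n. s / sqrt (real n)" and ?t = "\<lambda>n. t / complex_of_real (sqrt (real n))"
  have l: "?s \<longlonglongrightarrow> 0" "?t \<longlonglongrightarrow> 0" using over_sqrt_limit[of s] over_sqrt_limit[of t] by simp_all
  have small: "\<forall>\<^sub>F n in sequentially. \<bar>?s n\<bar> < \<delta> / 4 \<and> cmod (?t n) < \<delta>"
    using tendstoD[OF l(1), of "\<delta> / 4"] tendstoD[OF l(2), of \<delta>] delta_pos
    by (auto simp: dist_norm elim: eventually_elim2)
  have "(\<lambda>n. deriv (\<lambda>s. F s (?t n)) (of_real (?s n)) - Fv.g 1 (?t n)) \<longlonglongrightarrow> 0"
  proof (rule Lim_null_comparison)
    show "\<forall>\<^sub>F n in sequentially. cmod (deriv (\<lambda>s. F s (?t n)) (of_real (?s n)) - Fv.g 1 (?t n)) \<le> K * \<bar>?s n\<bar>"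
      using small by eventually_elim (use K in blast)
    show "(\<lambda>n. K * \<bar>?s n\<bar>) \<longlonglongrightarrow> 0" using tendsto_mult[OF tendsto_const tendsto_rabs_zero[OF l(1)]] by auto
  qed
  moreover have "(\<lambda>n. Fv.g 1 (?t n)) \<longlonglongrightarrow> Fv.g 1 0"
  proof (rule isCont_tendsto_compose[OF _ l(2)])
    show "isCont (Fv.g 1) 0" using Fv.g_holomorphic[of 1] delta_pos
      by (meson centre_in_ball continuous_on_eq_continuous_at holomorphic_on_imp_continuous_on open_ball)
  qed
  ultimately have "(\<lambda>n. deriv (\<lambda>s. F s (?t n)) (of_real (?s n)) - Fv.g 1 (?t n) + Fv.g 1 (?t n)) \<longlonglongrightarrow> 0 + Fv.g 1 0"
    by (rule tendsto_add)
  then have "(\<lambda>n. deriv (\<lambda>s. F s (?t n)) (of_real (?s n)) / \<i>) \<longlonglongrightarrow> Fv.g 1 0 / \<i>"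
    by (intro tendsto_divide) (auto simp del: of_real_divide)
  moreover have "Fv.g 1 0 / \<i> = wfun 0 1"
    using wfun_eq_deriv[of 0 0] delta_pos by (simp add: Fv.g_def)
  moreover have "\<forall>\<^sub>F n in sequentially. deriv (\<lambda>s. F s (?t n)) (of_real (?s n)) / \<i> = wfun (s / sqrt n) (exp (\<i> * (t / of_real (sqrt n))))"
    using small
  proof eventually_elim
    case (elim n)
    then have "\<bar>?s n\<bar> < \<delta>" using delta_pos by linarith
    then show ?case using wfun_eq_deriv[of "?s n" "?t n"] elim by metis
  qed
  ultimately show ?thesis by (simp only: Lim_transform_eventually)
qed

text \<open>\<open>F - X\<close> is still a majorant, hence nondecreasing on the positive axis, so
  the derivative of \<open>F\<close> at \<open>x0\<close> has real part at least 1.\<close>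

lemma wfun_0: "wfun 0 1 \<noteq> 0"
proof -
  define p where "p x = Re (Ffun (of_real x) 1) - x" for x
  let ?d = "deriv (\<lambda>X. Ffun X 1) (of_real x0)"
  have "((\<lambda>X. Ffun X 1) has_field_derivative ?d) (at (of_real x0))"
    using x0 by (intro holomorphic_derivI[OF holomorphic_X(2)]) auto
  then have "((\<lambda>x. Ffun (of_real x) 1) has_vector_derivative ?d) (at x0)"
    using has_vector_derivative_real_field by blast
  then have "((\<lambda>x. Re (Ffun (of_real x) 1)) has_vector_derivative Re ?d) (at x0)"
    by (rule bounded_linear.has_vector_derivative[OF bounded_linear_Re])
  then have "(p has_real_derivative (Re ?d - 1)) (at x0)"
    unfolding p_def by (auto intro!: derivative_intros simp: has_real_derivative_iff_has_vector_derivative)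
  moreover have "mono_on {0..xmax} p"
  proof (rule mono_onI)
    fix x y :: real assume xy: "x \<in> {0..xmax}" "y \<in> {0..xmax}" "x \<le> y"
    have "Re (Ffun (of_real x) 1 - of_real x) \<le> cmod (Ffun (of_real x) 1 - of_real x)" by (rule complex_Re_le_cmod)
    also have "\<dots> \<le> Re (Ffun (of_real y) (of_real 1) - of_real y)"
      using xy by (intro majorantD[OF majorant_Ffun_minus]) auto
    finally show "p x \<le> p y" by (simp add: p_def)
  qed
  ultimately have "Re ?d - 1 \<ge> 0"
    using x0 by (intro mono_on_imp_deriv_nonneg[of "{0..xmax}" p _ x0]) auto
  then have "?d \<noteq> 0" by auto
  then show ?thesis using x0 by (simp add: wfun_def)
qed

lemma exp_ii_polar: "exp (\<i> * t) = of_real (exp (- Im t)) * cis (Re t)"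
  by (simp add: complex_eq_iff exp_eq_polar Re_exp Im_exp)

definition scaled :: "nat \<Rightarrow> complex \<Rightarrow> real \<Rightarrow> complex" where
  "scaled n t s = indicator {-pi..pi} (s / sqrt n) *\<^sub>R
     (integrand n (exp (\<i> * (t / of_real (sqrt n)))) (s / sqrt n) * exp (- (sqrt n * (\<i> * B0 * t))))"

lemma integrand_eq:
  assumes "n > 0"
  shows "integrand n (exp (\<i> * (t / of_real (sqrt n)))) (s / sqrt n) * exp (- (sqrt n * (\<i> * B0 * t))) =
    wfun (s / sqrt n) (exp (\<i> * (t / of_real (sqrt n)))) * exp (A n s t)"
proof -
  have sn: "real n * (s / sqrt n) = sqrt n * s" using assms by (simp add: real_div_sqrt field_simps)
  have "exp (A n s t) = exp (of_nat n * (Dfun (x0 * cis (s / sqrt n)) (exp (\<i> * (t / of_real (sqrt n)))) - D0)) *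
      cis (- (real n * (s / sqrt n))) * exp (- (sqrt n * (\<i> * B0 * t)))"
    unfolding A_def f_def[of "of_real s / _"] at_origin cis_conv_exp exp_add[symmetric] sn
    by (rule arg_cong[where f = exp]) (simp add: algebra_simps)
  then show ?thesis unfolding integrand_def by (simp only: mult_ac)
qed

lemma J_scaled:
  assumes n: "n > 0" and u: "cmod (exp (\<i> * (t / of_real (sqrt n)))) \<le> umax"
  shows "sqrt n * (J n (exp (\<i> * (t / of_real (sqrt n)))) * exp (- (sqrt n * (\<i> * B0 * t)))) = (\<integral>s. scaled n t s \<partial>lborel)"
    and "scaled n t \<in> borel_measurable borel"
proof -
  let ?g = "integrand n (exp (\<i> * (t / of_real (sqrt n))))" and ?e = "exp (- (sqrt n * (\<i> * B0 * t)))"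
  have c: "continuous_on A ?g" for A using continuous_on_integrand[OF u] continuous_on_subset by blast
  have m: "?g \<in> borel_measurable borel" using c by (intro borel_measurable_continuous_onI)
  show "scaled n t \<in> borel_measurable borel" unfolding scaled_def using m by measurable
  have si: "set_integrable lborel {-pi..pi} ?g" by (rule borel_integrable_atLeastAtMost'[OF c])
  have "J n (exp (\<i> * (t / of_real (sqrt n)))) = (LINT \<theta>:{-pi..pi}|lborel. ?g \<theta>)"
    unfolding J_def by (rule set_borel_integral_eq_integral(2)[OF si, symmetric])
  also have "\<dots> = \<bar>1 / sqrt n\<bar> *\<^sub>R (\<integral>s. indicator {-pi..pi} (0 + 1 / sqrt n * s) *\<^sub>R ?g (0 + 1 / sqrt n * s) \<partial>lborel)"
    unfolding set_lebesgue_integral_def using n by (intro lborel_integral_real_affine) simp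
  finally have "sqrt n * J n (exp (\<i> * (t / of_real (sqrt n)))) = (\<integral>s. indicator {-pi..pi} (s / sqrt n) *\<^sub>R ?g (s / sqrt n) \<partial>lborel)"
    using n by (simp add: scaleR_conv_of_real)
  then have "sqrt n * (J n (exp (\<i> * (t / of_real (sqrt n)))) * ?e) = (\<integral>s. indicator {-pi..pi} (s / sqrt n) *\<^sub>R ?g (s / sqrt n) \<partial>lborel) * ?e"
    by (simp only: mult.assoc[symmetric])
  also have "\<dots> = (\<integral>s. (indicator {-pi..pi} (s / sqrt n) *\<^sub>R ?g (s / sqrt n)) * ?e \<partial>lborel)"
    by (rule integral_mult_left_zero[symmetric])
  finally show "sqrt n * (J n (exp (\<i> * (t / of_real (sqrt n)))) * ?e) = (\<integral>s. scaled n t s \<partial>lborel)"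
    unfolding scaled_def by simp
qed

text \<open>\<open>Re t\<close> only rotates \<open>u\<close>, whereas \<open>Im t\<close> fixes its
  modulus \<open>v\<close>, so the comparison point is \<open>i Im t\<close>. The constant is the
  product of 1/2 for \<open>v\<close>, \<open>x0 ^ 5 / 4\<close> from the circle bound and 1/8 from
  the cosine.\<close>

lemma Re_A_bound:
  assumes n: "n > 0" and s: "\<bar>s / sqrt n\<bar> \<le> pi" and u: "exp (- Im t / sqrt n) \<le> umax" "1 / 2 \<le> exp (- Im t / sqrt n)"
  shows "Re (A n s t) \<le> Re (A n 0 (\<i> * Im t)) - x0 ^ 5 / 64 * s\<^sup>2"
proof -
  define v where "v = exp (- Im t / sqrt n)"
  have e: "exp (\<i> * (t / of_real (sqrt n))) = v * cis (Re t / sqrt n)" "exp (\<i> * (\<i> * Im t / sqrt n)) = v"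
    unfolding exp_ii_polar v_def by (simp_all add: complex_eq_iff Re_divide_of_real Im_divide_of_real)
  have "Re (f (s / sqrt n) (t / of_real (sqrt n))) \<le> Re (f 0 (\<i> * Im t / sqrt n)) - v * x0 ^ 5 / 4 * (1 - cos (s / sqrt n))"
    using Re_Dfun_circle[of v "s / sqrt n" "Re t / sqrt n"] u
    unfolding f_def of_real_divide[symmetric] cis_conv_exp[symmetric] e by (simp add: v_def)
  also have "\<dots> \<le> Re (f 0 (\<i> * Im t / sqrt n)) - (1 / 2) * x0 ^ 5 / 4 * ((s / sqrt n)\<^sup>2 / 8)"
    using u(2) x0 one_minus_cos_ge[OF s] by (intro diff_left_mono mult_mono divide_right_mono) (auto simp: v_def)
  finally have "real n * Re (f (s / sqrt n) (t / of_real (sqrt n))) \<le> real n * (Re (f 0 (\<i> * Im t / sqrt n)) - (1 / 2) * x0 ^ 5 / 4 * ((s / sqrt n)\<^sup>2 / 8))"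
    by (rule mult_left_mono) simp
  also have "\<dots> = real n * Re (f 0 (\<i> * Im t / sqrt n)) - x0 ^ 5 / 64 * s\<^sup>2"
    using n by (simp add: power_divide field_simps)
  finally show ?thesis
    unfolding A_def by (simp add: algebra_simps)
qed

definition \<Phi> :: "complex \<Rightarrow> complex" where
  "\<Phi> t = (\<integral>s. exp (q11 * (of_real s)\<^sup>2 + q12 * of_real s * t + q22 * t\<^sup>2) \<partial>lborel)"

lemma J_limit:
  "(\<lambda>n. sqrt n * (J n (exp (\<i> * (t / of_real (sqrt n)))) * exp (- (sqrt n * (\<i> * B0 * t))))) \<longlonglongrightarrow> wfun 0 1 * \<Phi> t"
proof -
  obtain W where W: "\<And>\<theta> u. cmod u \<le> umax \<Longrightarrow> cmod (wfun \<theta> u) \<le> W" using norm_wfun by blast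
  have W0: "W \<ge> 0" using order_trans[OF norm_ge_zero W[of 0]] by simp
  let ?L = "\<lambda>s. wfun 0 1 * exp (q11 * (of_real s)\<^sup>2 + q12 * of_real s * t + q22 * t\<^sup>2)"
  let ?S = "\<lambda>n. sqrt n * (J n (exp (\<i> * (t / of_real (sqrt n)))) * exp (- (sqrt n * (\<i> * B0 * t))))"
  \<comment> \<open>This sequence converges, so the part of the exponent that does not involve
    \<open>s\<close> is bounded by one constant \<open>C\<close>, and a fixed Gaussian
    dominates.\<close>
  have "Bseq (\<lambda>n. A n 0 (\<i> * Im t))" by (rule convergent_imp_Bseq[OF convergentI[OF A_limit]])
  then obtain C where C: "\<And>n. cmod (A n 0 (\<i> * Im t)) \<le> C" unfolding Bseq_def by blast
  have lv: "(\<lambda>n. exp (- Im t / sqrt n)) \<longlonglongrightarrow> exp 0"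
    using over_sqrt_limit[of "- Im t"] by (intro tendsto_exp) simp
  have ev: "\<forall>\<^sub>F n in sequentially. n > 0 \<and> exp (- Im t / sqrt n) \<le> umax \<and> 1 / 2 \<le> exp (- Im t / sqrt n)"
  proof -
    have "\<forall>\<^sub>F n in sequentially. exp (- Im t / sqrt n) < umax" "\<forall>\<^sub>F n in sequentially. 1 / 2 < exp (- Im t / sqrt n)"
      by (rule order_tendstoD[OF lv]; simp)+
    then show ?thesis using eventually_gt_at_top[of 0] by eventually_elim simp
  qed
  \<comment> \<open>For small \<open>n\<close> the point \<open>u\<close> may lie outside its disc
    when \<open>t\<close> is not real, so the sequence is started at \<open>N\<close>.\<close>
  then obtain N :: nat where N: "\<And>n :: nat. n \<ge> N \<Longrightarrow> n > 0 \<and> exp (- Im t / sqrt n) \<le> umax \<and> 1 / 2 \<le> exp (- Im t / sqrt n)"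
    unfolding eventually_sequentially by blast
  have u: "cmod (exp (\<i> * (t / of_real (sqrt n)))) \<le> umax" if "n \<ge> N" for n
    using N[OF that] by (simp add: Im_divide_of_real)
  have "(\<lambda>n. \<integral>s. scaled (n + N) t s \<partial>lborel) \<longlonglongrightarrow> (\<integral>s. ?L s \<partial>lborel)"
  proof (rule integral_dominated_convergence[where w = "\<lambda>s. W * exp C * exp (- (x0 ^ 5 / 64) * s\<^sup>2)"])
    show "?L \<in> borel_measurable lborel"
      unfolding measurable_lborel2 by (intro borel_measurable_continuous_onI continuous_intros)
    show "scaled (n + N) t \<in> borel_measurable lborel" for n
      unfolding measurable_lborel2 using N[of "n + N"] u[of "n + N"] by (intro J_scaled(2)) simp_all
    show "integrable lborel (\<lambda>s. W * exp C * exp (- (x0 ^ 5 / 64) * s\<^sup>2))"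
      using x0 by (intro integrable_mult_right gaussian_integrable) simp
    show "AE s in lborel. (\<lambda>n. scaled (n + N) t s) \<longlonglongrightarrow> ?L s"
    proof (rule AE_I2)
      fix s :: real
      have "\<forall>\<^sub>F n in sequentially. \<bar>s / sqrt n\<bar> < pi"
        using tendstoD[OF over_sqrt_limit[of s] pi_gt_zero] by (simp add: dist_norm)
      then have "\<forall>\<^sub>F n in sequentially. wfun (s / sqrt n) (exp (\<i> * (t / of_real (sqrt n)))) * exp (A n s t) = scaled n t s"
        using ev
      proof eventually_elim
        case (elim n)
        then have "s / sqrt n \<in> {-pi..pi}" unfolding atLeastAtMost_iff by (intro conjI; linarith)
        then show ?case unfolding scaled_def integrand_eq[OF conjunct1[OF elim(2)]] by simp
      qed
      moreover have "(\<lambda>n. wfun (s / sqrt n) (exp (\<i> * (t / of_real (sqrt n)))) * exp (A n s t)) \<longlonglongrightarrow> ?L s"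
        by (intro tendsto_mult tendsto_exp wfun_limit A_limit)
      ultimately have "(\<lambda>n. scaled n t s) \<longlonglongrightarrow> ?L s" by (rule Lim_transform_eventually[rotated])
      then show "(\<lambda>n. scaled (n + N) t s) \<longlonglongrightarrow> ?L s" by (rule LIMSEQ_ignore_initial_segment)
    qed
    show "AE s in lborel. cmod (scaled (n + N) t s) \<le> W * exp C * exp (- (x0 ^ 5 / 64) * s\<^sup>2)" for n
    proof (rule AE_I2)
      fix s :: real
      let ?n = "n + N"
      have n: "?n > 0" "exp (- Im t / sqrt ?n) \<le> umax" "1 / 2 \<le> exp (- Im t / sqrt ?n)" using N[of ?n] by auto
      show "cmod (scaled ?n t s) \<le> W * exp C * exp (- (x0 ^ 5 / 64) * s\<^sup>2)"
      proof (cases "s / sqrt ?n \<in> {-pi..pi}")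
        case True
        then have s: "\<bar>s / sqrt ?n\<bar> \<le> pi" unfolding atLeastAtMost_iff by linarith
        have "cmod (scaled ?n t s) = cmod (wfun (s / sqrt ?n) (exp (\<i> * (t / sqrt ?n)))) * exp (Re (A ?n s t))"
          unfolding scaled_def integrand_eq[OF n(1)] using True by (simp add: norm_mult)
        also have "\<dots> \<le> W * exp (C - x0 ^ 5 / 64 * s\<^sup>2)"
        proof (intro mult_mono W)
          have "Re (A ?n s t) \<le> C - x0 ^ 5 / 64 * s\<^sup>2"
            using Re_A_bound[OF n(1) s n(2,3)] C[of ?n] complex_Re_le_cmod[of "A ?n 0 (\<i> * Im t)"] by linarith
          then show "exp (Re (A ?n s t)) \<le> exp (C - x0 ^ 5 / 64 * s\<^sup>2)" by simp
        qed (use u[of ?n] W0 in simp_all)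
        also have "exp (C - x0 ^ 5 / 64 * s\<^sup>2) = exp C * exp (- (x0 ^ 5 / 64) * s\<^sup>2)"
          unfolding exp_add[symmetric] by (rule arg_cong[where f = exp]) (simp only: minus_mult_left[symmetric] diff_conv_add_uminus)
        finally show ?thesis by (simp only: mult.assoc)
      next
        case False
        then show ?thesis unfolding scaled_def using W0 by simp
      qed
    qed
  qed
  moreover have "(\<integral>s. ?L s \<partial>lborel) = wfun 0 1 * \<Phi> t"
    unfolding \<Phi>_def by (rule integral_mult_right_zero)
  moreover have "(\<integral>s. scaled (n + N) t s \<partial>lborel) = ?S (n + N)" for n
    using N[of "n + N"] u[of "n + N"] J_scaled(1)[of "n + N" t] by simp
  ultimately have "(\<lambda>n. ?S (n + N)) \<longlonglongrightarrow> wfun 0 1 * \<Phi> t" by (simp only:)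
  then show ?thesis by (rule LIMSEQ_offset[where f = ?S and k = N])
qed

end


context critical
begin

subsection \<open>The Gaussian limit\<close>

definition Q :: "real \<Rightarrow> real \<Rightarrow> complex" where
  "Q s t = q11 * (of_real s)\<^sup>2 + q12 * of_real s * of_real t + q22 * (of_real t)\<^sup>2"

lemma Q_limit: "(\<lambda>n. A n (of_real s) (of_real t)) \<longlonglongrightarrow> Q s t"
  using A_limit[of "of_real s" "of_real t"] unfolding Q_def .

lemma cnj_Dfun:
  assumes "cmod X \<le> xmax" "cmod u \<le> umax"
  shows "cnj (Dfun X u) = Dfun (cnj X) (cnj u)"
  by (simp add: Dfun_def cnj_cfun[OF assms] exp_cnj)

lemma cnj_A: "cnj (A n (of_real s) (of_real t)) = A n (of_real (- s)) (of_real (- t))"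
proof -
  have "cnj (f (of_real a) (of_real b)) = f (of_real (- a)) (of_real (- b))" for a b
  proof -
    have "x0 * iexp a \<in> ball 0 xmax" using in_disc[of a] by (simp add: cis_conv_exp)
    then have "cnj (f (of_real a) (of_real b)) = Dfun (cnj (x0 * iexp a)) (cnj (iexp b))"
      unfolding f_def by (intro cnj_Dfun) auto
    then show ?thesis by (simp add: f_def exp_cnj)
  qed
  from this[of "s / sqrt n" "t / sqrt n"] show ?thesis
    by (simp add: A_def at_origin algebra_simps)
qed

text \<open>Conjugation turns \<open>(s, t)\<close> into \<open>(- s, - t)\<close>, and a quadratic
  form is even.\<close>

lemma Q_real: "Q s t = of_real (Re (Q s t))"
proof -
  have "(\<lambda>n. cnj (A n (of_real s) (of_real t))) \<longlonglongrightarrow> cnj (Q s t)" by (intro tendsto_cnj Q_limit)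
  moreover have "(\<lambda>n. cnj (A n (of_real s) (of_real t))) \<longlonglongrightarrow> Q (- s) (- t)" unfolding cnj_A by (rule Q_limit)
  ultimately have "cnj (Q s t) = Q (- s) (- t)" by (rule LIMSEQ_unique)
  then have "cnj (Q s t) = Q s t" by (simp add: Q_def)
  then show ?thesis by (simp add: complex_eq_iff)
qed

lemma Re_Q: "Re (Q s t) = Re q11 * s\<^sup>2 + Re q12 * s * t + Re q22 * t\<^sup>2"
  by (simp add: Q_def power2_eq_square)

text \<open>The limit of the bound with the two phases. The linear forms \<open>4 s + t\<close> and
  \<open>5 s + t\<close> vanish together only at the origin, so the form is negative
  definite.\<close>

lemma Re_Q_bound: "Re (Q s t) \<le> - (x0 ^ 4 / 2 * (4 * s + t)\<^sup>2) - x0 ^ 5 / 4 * (5 * s + t)\<^sup>2"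
proof (rule LIMSEQ_le)
  show "(\<lambda>n. Re (A n (of_real s) (of_real t))) \<longlonglongrightarrow> Re (Q s t)" by (intro tendsto_Re Q_limit)
  let ?b = "\<lambda>n. - (x0 ^ 4 * (real n * (1 - cos ((4 * s + t) / sqrt n)))) - x0 ^ 5 / 2 * (real n * (1 - cos ((5 * s + t) / sqrt n)))"
  have "?b \<longlonglongrightarrow> - (x0 ^ 4 * ((4 * s + t)\<^sup>2 / 2)) - x0 ^ 5 / 2 * ((5 * s + t)\<^sup>2 / 2)"
    by (intro tendsto_diff tendsto_minus tendsto_mult tendsto_const of_nat_one_minus_cos_limit)
  then show "?b \<longlonglongrightarrow> - (x0 ^ 4 / 2 * (4 * s + t)\<^sup>2) - x0 ^ 5 / 4 * (5 * s + t)\<^sup>2" by simp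
  show "\<exists>N. \<forall>n\<ge>N. Re (A n (of_real s) (of_real t)) \<le> ?b n"
  proof (intro exI allI impI)
    fix n :: nat assume "0 \<le> n"
    have "Re (f (of_real (s / sqrt n)) (of_real (t / sqrt n))) \<le> D0 - x0 ^ 4 * (1 - cos (4 * (s / sqrt n) + t / sqrt n))
       - x0 ^ 5 / 2 * (1 - cos (5 * (s / sqrt n) + t / sqrt n))"
      using Re_Dfun_bound[of x0 1 "s / sqrt n" "t / sqrt n"] x0 unfolding f_def cis_conv_exp D0_def by simp
    then have "real n * Re (f (of_real (s / sqrt n)) (of_real (t / sqrt n))) \<le> real n * (D0 - x0 ^ 4 * (1 - cos ((4 * s + t) / sqrt n))
       - x0 ^ 5 / 2 * (1 - cos ((5 * s + t) / sqrt n)))"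
      by (intro mult_left_mono) (simp_all add: add_divide_distrib)
    then show "Re (A n (of_real s) (of_real t)) \<le> ?b n"
      by (simp add: A_def at_origin algebra_simps)
  qed
qed

text \<open>Minus the maximum of the form over \<open>s\<close> at \<open>t = 1\<close>, that is,
  what remains after completing the square in \<open>s\<close>. The limiting variance of
  \<open>Y\<close> will be \<open>2 V\<close>.\<close>

definition V :: real where
  "V = - Re (Q (- Re q12 / (2 * Re q11)) 1)"

lemma Q_neg: "s \<noteq> 0 \<or> t \<noteq> 0 \<Longrightarrow> Re (Q s t) < 0"
proof -
  assume st: "s \<noteq> 0 \<or> t \<noteq> 0"
  have "0 < (4 * s + t)\<^sup>2 \<or> 0 < (5 * s + t)\<^sup>2"
  proof (rule ccontr)
    assume "\<not> ?thesis"
    then have "4 * s + t = 0" "5 * s + t = 0" by auto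
    then have "s = 0" "t = 0" by linarith+
    then show False using st by simp
  qed
  moreover have p: "x0 ^ 4 / 2 > 0" "x0 ^ 5 / 4 > 0" using x0 by simp_all
  ultimately have "0 < x0 ^ 4 / 2 * (4 * s + t)\<^sup>2 + x0 ^ 5 / 4 * (5 * s + t)\<^sup>2"
    by (metis add_nonneg_pos add_pos_nonneg mult_pos_pos zero_le_mult_iff zero_le_power2 order_less_imp_le)
  then show ?thesis using Re_Q_bound[of s t] by linarith
qed

lemma V_pos: "V > 0"
  using Q_neg[of _ 1] by (simp add: V_def)

lemma q11_neg: "Re q11 < 0"
  using Q_neg[of 1 0] by (simp add: Re_Q)

lemma Re_Q_complete: "Re (Q s t) = Re q11 * (s + Re q12 / (2 * Re q11) * t)\<^sup>2 - V * t\<^sup>2"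
  using q11_neg unfolding V_def Re_Q by (simp add: field_simps power2_eq_square)

lemma \<Phi>_real: "\<Phi> (of_real t) = \<Phi> 0 * of_real (exp (- (V * t\<^sup>2)))"
  and \<Phi>_0: "\<Phi> 0 \<noteq> 0"
proof -
  let ?I = "\<integral>s. exp (- (- Re q11) * s\<^sup>2) \<partial>lborel"
  have *: "\<Phi> (of_real t) = of_real (exp (- (V * t\<^sup>2)) * ?I)" for t
  proof -
    let ?c = "Re q12 / (2 * Re q11) * t"
    have "\<Phi> (of_real t) = (\<integral>s. exp (Q s t) \<partial>lborel)" by (simp add: \<Phi>_def Q_def)
    also have "\<dots> = (\<integral>s. complex_of_real (exp (Re (Q s t))) \<partial>lborel)"
      by (subst Q_real) (simp add: exp_of_real)
    also have "\<dots> = of_real (\<integral>s. exp (Re (Q s t)) \<partial>lborel)" by (rule integral_complex_of_real)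
    also have "(\<integral>s. exp (Re (Q s t)) \<partial>lborel) = (\<integral>s. exp (- (V * t\<^sup>2)) * exp (- (- Re q11) * (?c + 1 * s)\<^sup>2) \<partial>lborel)"
      unfolding Re_Q_complete exp_add[symmetric] by (simp add: add.commute)
    also have "\<dots> = exp (- (V * t\<^sup>2)) * (\<integral>s. exp (- (- Re q11) * (?c + 1 * s)\<^sup>2) \<partial>lborel)"
      by (rule integral_mult_right_zero)
    also have "(\<integral>s. exp (- (- Re q11) * (?c + 1 * s)\<^sup>2) \<partial>lborel) = ?I"
      using lborel_integral_real_affine[of 1 "\<lambda>s. exp (- (- Re q11) * s\<^sup>2)" ?c] by simp
    finally show ?thesis .
  qed
  have "?I > 0" using q11_neg by (intro gaussian_integrable) simp
  then show "\<Phi> 0 \<noteq> 0" using *[of 0] by simp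
  show "\<Phi> (of_real t) = \<Phi> 0 * of_real (exp (- (V * t\<^sup>2)))" using *[of t] *[of 0] by simp
qed

text \<open>The centred and scaled characteristic function of the number of type-b vertices; see
  \<open>ratio_expectation\<close>.\<close>

definition ratio :: "nat \<Rightarrow> complex \<Rightarrow> complex" where
  "ratio n t = J n (exp (\<i> * (t / of_real (sqrt n)))) * exp (- (sqrt n * (\<i> * B0 * t))) / J n 1"

lemma ratio_limit: "(\<lambda>n. ratio n t) \<longlonglongrightarrow> \<Phi> t / \<Phi> 0"
proof -
  let ?N = "\<lambda>n t. sqrt n * (J n (exp (\<i> * (t / of_real (sqrt n)))) * exp (- (sqrt n * (\<i> * B0 * t))))"
  have "(\<lambda>n. ?N n t / ?N n 0) \<longlonglongrightarrow> (wfun 0 1 * \<Phi> t) / (wfun 0 1 * \<Phi> 0)"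
    using wfun_0 \<Phi>_0 by (intro tendsto_divide J_limit) simp
  moreover have "\<forall>\<^sub>F n in sequentially. ?N n t / ?N n 0 = ratio n t"
    using eventually_gt_at_top[of 0] by eventually_elim (simp add: ratio_def)
  ultimately have "(\<lambda>n. ratio n t) \<longlonglongrightarrow> (wfun 0 1 * \<Phi> t) / (wfun 0 1 * \<Phi> 0)" by (rule Lim_transform_eventually)
  then show ?thesis using wfun_0 by simp
qed

end


subsection \<open>From transforms to the limit law\<close>

lemma norm_expectation_le:
  fixes f :: "'a \<Rightarrow> 'b::{banach, second_countable_topology}"
  assumes "finite (set_pmf p)" "\<And>x. x \<in> set_pmf p \<Longrightarrow> norm (f x) \<le> c"
  shows "norm (measure_pmf.expectation p f) \<le> c"
proof -
  have "norm (measure_pmf.expectation p f) \<le> measure_pmf.expectation p (\<lambda>x. norm (f x))"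
    by (rule integral_norm_bound)
  also have "\<dots> \<le> c"
    using assms by (intro measure_pmf.integral_le_const integrable_measure_pmf_finite) (auto simp: AE_measure_pmf_iff)
  finally show ?thesis .
qed

lemma norm_iexp_diff: "cmod (iexp a - iexp b) \<le> \<bar>a - b\<bar>"
proof -
  have "iexp a - iexp b = iexp b * (iexp (a - b) - 1)"
    by (simp add: algebra_simps flip: exp_add)
  then have "cmod (iexp a - iexp b) = cmod (iexp (a - b) - 1)" by (simp add: norm_mult)
  also have "\<dots> \<le> \<bar>a - b\<bar>" using iexp_approx1[of "a - b" 0] by simp
  finally show ?thesis .
qed

lemma power2_le_exp: "y\<^sup>2 \<le> 2 * (exp y + exp (- y))" for y :: real
proof -
  have "1 + \<bar>y\<bar> + \<bar>y\<bar>\<^sup>2 / 2 \<le> exp \<bar>y\<bar>" by (rule exp_lower_Taylor_quadratic) simp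
  moreover have "exp \<bar>y\<bar> \<le> exp y + exp (- y)" by (cases "y \<ge> 0") auto
  ultimately show ?thesis using abs_ge_zero[of y] by simp
qed

text \<open>Convergence of characteristic functions alone does not control means. Here the error of
  \<open>exp (i \<eta> y)\<close> against \<open>1 + i \<eta> y\<close> is quadratic, and
  exponential moments bound the square; division by \<open>\<eta>\<close> leaves errors that are
  small with \<open>\<eta>\<close>.\<close>

lemma expectation_le_transform:
  fixes p :: "'a pmf" and Y :: "'a \<Rightarrow> real"
  assumes fin: "finite (set_pmf p)" and \<eta>: "\<eta> > 0"
    and C: "measure_pmf.expectation p (\<lambda>x. exp (Y x) + exp (- Y x)) \<le> C"
  shows "\<bar>measure_pmf.expectation p Y\<bar> \<le> cmod (measure_pmf.expectation p (\<lambda>x. iexp (\<eta> * Y x)) - 1) / \<eta> + \<eta> * C"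
proof -
  let ?E = "measure_pmf.expectation p"
  note int = integrable_measure_pmf_finite[OF fin]
  have "?E (\<lambda>x. iexp (\<eta> * Y x) - (1 + \<i> * of_real (\<eta> * Y x))) =
      ?E (\<lambda>x. iexp (\<eta> * Y x)) - (1 + \<i> * of_real (\<eta> * ?E Y))"
    by (subst Bochner_Integration.integral_diff[OF int int], subst Bochner_Integration.integral_add[OF int int])
      (simp only: integral_mult_right_zero integral_complex_of_real measure_pmf.prob_space lebesgue_integral_const measure_pmf.prob_space
         scaleR_one)
  then have e: "\<i> * of_real (\<eta> * ?E Y) = (?E (\<lambda>x. iexp (\<eta> * Y x)) - 1) - ?E (\<lambda>x. iexp (\<eta> * Y x) - (1 + \<i> * of_real (\<eta> * Y x)))"
    by simp
  have "cmod (?E (\<lambda>x. iexp (\<eta> * Y x) - (1 + \<i> * of_real (\<eta> * Y x)))) \<le> ?E (\<lambda>x. cmod (iexp (\<eta> * Y x) - (1 + \<i> * of_real (\<eta> * Y x))))"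
    by (rule integral_norm_bound)
  also have "\<dots> \<le> ?E (\<lambda>x. \<eta>\<^sup>2 * (exp (Y x) + exp (- Y x)))"
  proof (rule integral_mono[OF int int])
    fix x
    have "cmod (iexp (\<eta> * Y x) - (1 + \<i> * of_real (\<eta> * Y x))) \<le> \<bar>\<eta> * Y x\<bar>\<^sup>2 / 2"
      using iexp_approx1[of "\<eta> * Y x" 1] by (simp add: numeral_2_eq_2)
    also have "\<dots> = \<eta>\<^sup>2 * ((Y x)\<^sup>2 / 2)" by (simp add: power_mult_distrib)
    also have "\<dots> \<le> \<eta>\<^sup>2 * (exp (Y x) + exp (- Y x))" using power2_le_exp[of "Y x"] by (intro mult_left_mono) simp_all
    finally show "cmod (iexp (\<eta> * Y x) - (1 + \<i> * of_real (\<eta> * Y x))) \<le> \<eta>\<^sup>2 * (exp (Y x) + exp (- Y x))" .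
  qed
  also have "\<dots> = \<eta>\<^sup>2 * ?E (\<lambda>x. exp (Y x) + exp (- Y x))" by (rule integral_mult_right_zero)
  also have "\<dots> \<le> \<eta>\<^sup>2 * C" using C by (intro mult_left_mono) simp_all
  finally have b: "cmod (?E (\<lambda>x. iexp (\<eta> * Y x) - (1 + \<i> * of_real (\<eta> * Y x)))) \<le> \<eta>\<^sup>2 * C" .
  have "\<eta> * \<bar>?E Y\<bar> = cmod (\<i> * of_real (\<eta> * ?E Y))" using \<eta> by (simp add: norm_mult abs_mult)
  also have "\<dots> \<le> cmod (?E (\<lambda>x. iexp (\<eta> * Y x)) - 1) + \<eta>\<^sup>2 * C"
    unfolding e using norm_triangle_ineq4 b by (meson add_left_mono order_trans)
  finally have "\<bar>?E Y\<bar> \<le> (cmod (?E (\<lambda>x. iexp (\<eta> * Y x)) - 1) + \<eta>\<^sup>2 * C) / \<eta>"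
    using \<eta> by (simp add: pos_le_divide_eq mult.commute)
  then show ?thesis using \<eta> by (simp add: add_divide_distrib power2_eq_square)
qed

locale gaussian_transforms =
  fixes p :: "nat \<Rightarrow> 'a pmf" and Y Z :: "nat \<Rightarrow> 'a \<Rightarrow> real" and V :: real
  assumes V: "V > 0"
    and fin: "\<forall>\<^sub>F n in sequentially. finite (set_pmf (p n))"
    and char: "\<And>t. (\<lambda>n. measure_pmf.expectation (p n) (\<lambda>x. iexp (t * Y n x))) \<longlonglongrightarrow> of_real (exp (- (V * t\<^sup>2)))"
    and moments: "Bseq (\<lambda>n. measure_pmf.expectation (p n) (\<lambda>x. exp (Y n x) + exp (- Y n x)))"
    and close: "\<forall>\<^sub>F n in sequentially. \<forall>x\<in>set_pmf (p n). \<bar>Z n x - Y n x\<bar> \<le> 1 / sqrt n"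
begin

lemma mean_Y: "(\<lambda>n. measure_pmf.expectation (p n) (Y n)) \<longlonglongrightarrow> 0"
proof (rule tendstoI)
  fix \<epsilon> :: real assume \<epsilon>: "\<epsilon> > 0"
  obtain C where C: "C > 0" "\<And>n. \<bar>measure_pmf.expectation (p n) (\<lambda>x. exp (Y n x) + exp (- Y n x))\<bar> \<le> C"
    using moments unfolding Bseq_def real_norm_def by blast
  \<comment> \<open>The transform contributes \<open>\<eta>\<close> for the limit and
    \<open>V * \<eta>\<close> for its distance from 1, the moments \<open>\<eta> * C\<close>;
    together this is half of \<open>\<epsilon>\<close>.\<close>
  define \<eta> where "\<eta> = \<epsilon> / (2 * (1 + V + C))"
  have \<eta>: "\<eta> > 0" using \<epsilon> C V by (simp add: \<eta>_def)
  let ?c = "\<lambda>n. measure_pmf.expectation (p n) (\<lambda>x. iexp (\<eta> * Y n x))"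
  have "\<forall>\<^sub>F n in sequentially. dist (?c n) (of_real (exp (- (V * \<eta>\<^sup>2)))) < \<eta>\<^sup>2"
    using char[of \<eta>] \<eta> by (intro tendstoD) simp_all
  then show "\<forall>\<^sub>F n in sequentially. dist (measure_pmf.expectation (p n) (Y n)) 0 < \<epsilon>"
    using fin
  proof eventually_elim
    case (elim n)
    have "1 - V * \<eta>\<^sup>2 \<le> exp (- (V * \<eta>\<^sup>2))" using exp_ge_add_one_self[of "- (V * \<eta>\<^sup>2)"] by simp
    moreover have "exp (- (V * \<eta>\<^sup>2)) \<le> 1" using V by simp
    ultimately have "\<bar>exp (- (V * \<eta>\<^sup>2)) - 1\<bar> \<le> V * \<eta>\<^sup>2" by (simp only: abs_le_iff) linarith
    moreover have "of_real (exp (- (V * \<eta>\<^sup>2))) - 1 = complex_of_real (exp (- (V * \<eta>\<^sup>2)) - 1)" by simp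
    ultimately have "cmod (of_real (exp (- (V * \<eta>\<^sup>2))) - 1) \<le> V * \<eta>\<^sup>2" by (simp only: norm_of_real)
    then have "cmod (?c n - 1) \<le> \<eta>\<^sup>2 + V * \<eta>\<^sup>2"
      using elim(1) norm_triangle_sub[of "?c n - 1" "of_real (exp (- (V * \<eta>\<^sup>2))) - 1"] by (simp add: dist_norm)
    then have "cmod (?c n - 1) / \<eta> \<le> (\<eta>\<^sup>2 + V * \<eta>\<^sup>2) / \<eta>"
      using \<eta> by (intro divide_right_mono) simp_all
    moreover have "(\<eta>\<^sup>2 + V * \<eta>\<^sup>2) / \<eta> = \<eta> + V * \<eta>" using \<eta> by (simp add: add_divide_distrib power2_eq_square)
    moreover have "\<bar>measure_pmf.expectation (p n) (Y n)\<bar> \<le> cmod (?c n - 1) / \<eta> + \<eta> * C"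
      using C(2)[of n] by (intro expectation_le_transform elim \<eta>) simp
    ultimately have "\<bar>measure_pmf.expectation (p n) (Y n)\<bar> \<le> \<eta> * (1 + V + C)" by (simp add: algebra_simps)
    also have "\<dots> = \<epsilon> / 2"
    proof -
      have "\<epsilon> / (2 * D) * D = \<epsilon> / 2" if "D > 0" for D using that by simp
      from this[of "1 + V + C"] show ?thesis unfolding \<eta>_def using C V by simp
    qed
    finally show ?case using \<epsilon> by simp
  qed
qed

lemma mean_Z: "(\<lambda>n. measure_pmf.expectation (p n) (Z n)) \<longlonglongrightarrow> 0"
proof -
  have "(\<lambda>n. measure_pmf.expectation (p n) (\<lambda>x. Z n x - Y n x)) \<longlonglongrightarrow> 0"
  proof (rule Lim_null_comparison)
    show "\<forall>\<^sub>F n in sequentially. norm (measure_pmf.expectation (p n) (\<lambda>x. Z n x - Y n x)) \<le> 1 / sqrt n"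
      using fin close by eventually_elim (intro norm_expectation_le, auto)
    show "(\<lambda>n. 1 / sqrt n) \<longlonglongrightarrow> 0" by real_asymp
  qed
  from tendsto_add[OF this mean_Y]
  have "(\<lambda>n. measure_pmf.expectation (p n) (\<lambda>x. Z n x - Y n x) + measure_pmf.expectation (p n) (Y n)) \<longlonglongrightarrow> 0" by simp
  moreover have "\<forall>\<^sub>F n in sequentially. measure_pmf.expectation (p n) (\<lambda>x. Z n x - Y n x) + measure_pmf.expectation (p n) (Y n)
     = measure_pmf.expectation (p n) (Z n)"
    using fin
  proof eventually_elim
    case (elim n)
    then show ?case
      by (subst Bochner_Integration.integral_diff) (simp_all add: integrable_measure_pmf_finite)
  qed
  ultimately show ?thesis by (rule Lim_transform_eventually)
qed

lemma weak_limit: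
  "weak_conv_m (\<lambda>n. distr (measure_pmf (p n)) borel (\<lambda>x. Z n x / sqrt (2 * V))) std_normal_distribution"
proof (rule levy_continuity)
  show "real_distribution (distr (measure_pmf (p n)) borel (\<lambda>x. Z n x / sqrt (2 * V)))" for n
    by (rule prob_space.real_distribution_distr[OF measure_pmf.prob_space_axioms]) simp
  show "real_distribution std_normal_distribution" by (rule real_dist_normal_dist)
  fix t :: real
  \<comment> \<open>Rescaled so that \<open>V * a^2 = t^2 / 2\<close>, the exponent of the standard
    normal law.\<close>
  define a where "a = t / sqrt (2 * V)"
  have "(\<lambda>n. measure_pmf.expectation (p n) (\<lambda>x. iexp (a * Z n x) - iexp (a * Y n x))) \<longlonglongrightarrow> 0"
  proof (rule Lim_null_comparison)
    show "\<forall>\<^sub>F n in sequentially. cmod (measure_pmf.expectation (p n) (\<lambda>x. iexp (a * Z n x) - iexp (a * Y n x))) \<le> \<bar>a\<bar> * (1 / sqrt n)"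
      using fin close
    proof eventually_elim
      case (elim n)
      have "cmod (iexp (a * Z n x) - iexp (a * Y n x)) \<le> \<bar>a\<bar> * (1 / sqrt n)" if "x \<in> set_pmf (p n)" for x
      proof -
        have "cmod (iexp (a * Z n x) - iexp (a * Y n x)) \<le> \<bar>a * Z n x - a * Y n x\<bar>" by (rule norm_iexp_diff)
        also have "\<dots> = \<bar>a\<bar> * \<bar>Z n x - Y n x\<bar>" by (simp only: abs_mult[symmetric] right_diff_distrib)
        also have "\<dots> \<le> \<bar>a\<bar> * (1 / sqrt n)" using elim(2) that by (intro mult_left_mono) auto
        finally show ?thesis .
      qed
      then show ?case using elim(1) by (intro norm_expectation_le)
    qed
    have "(\<lambda>n. 1 / sqrt (real n)) \<longlonglongrightarrow> 0" by real_asymp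
    then show "(\<lambda>n. \<bar>a\<bar> * (1 / sqrt n)) \<longlonglongrightarrow> 0" by (rule tendsto_mult_right_zero)
  qed
  from tendsto_add[OF this char[of a]]
  have "(\<lambda>n. measure_pmf.expectation (p n) (\<lambda>x. iexp (a * Z n x) - iexp (a * Y n x))
      + measure_pmf.expectation (p n) (\<lambda>x. iexp (a * Y n x))) \<longlonglongrightarrow> of_real (exp (- (V * a\<^sup>2)))" by simp
  moreover have "\<forall>\<^sub>F n in sequentially. measure_pmf.expectation (p n) (\<lambda>x. iexp (a * Z n x) - iexp (a * Y n x))
      + measure_pmf.expectation (p n) (\<lambda>x. iexp (a * Y n x)) = measure_pmf.expectation (p n) (\<lambda>x. iexp (a * Z n x))"
    using fin
  proof eventually_elim
    case (elim n)
    then show ?case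
      by (subst Bochner_Integration.integral_diff) (simp_all add: integrable_measure_pmf_finite)
  qed
  ultimately have "(\<lambda>n. measure_pmf.expectation (p n) (\<lambda>x. iexp (a * Z n x))) \<longlonglongrightarrow> of_real (exp (- (V * a\<^sup>2)))"
    by (rule Lim_transform_eventually)
  moreover have "V * a\<^sup>2 = t\<^sup>2 / 2" using V by (simp add: a_def power_divide)
  moreover have "char (distr (measure_pmf (p n)) borel (\<lambda>x. Z n x / sqrt (2 * V))) t = measure_pmf.expectation (p n) (\<lambda>x. iexp (a * Z n x))" for n
    unfolding char_def by (subst integral_distr) (simp_all add: a_def)
  ultimately show "(\<lambda>n. char (distr (measure_pmf (p n)) borel (\<lambda>x. Z n x / sqrt (2 * V))) t) \<longlonglongrightarrow> char std_normal_distribution t"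
    unfolding char_std_normal_distribution by simp
qed

end

section \<open>Application to random labelled trees\<close>

definition pair_count :: "nat \<Rightarrow> nat pair_pre_digraph \<Rightarrow> nat" where
  "pair_count n T = snd (tree_class {1..n} (parcs T) 1)"

lemma sum_pair_count:
  fixes u :: complex
  assumes "u \<noteq> 0"
  shows "(\<Sum>T\<in>labelled_trees (Suc m). u ^ pair_count (Suc m) T) = (\<Sum>t\<in>UNIV. tree_count u t m)"
proof -
  have "(\<Sum>T\<in>labelled_trees (Suc m). u ^ snd (tree_class {1..Suc m} (parcs T) 1)) = (\<Sum>E\<in>trees {1..Suc m}. u ^ snd (tree_class {1..Suc m} E 1))"
    by (rule sum.reindex_bij_betw[OF bij_labelled_trees]) simp
  then show ?thesis using sum_trees_power[OF assms, of "{1..Suc m}" 1] by (simp add: pair_count_def)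
qed

context critical
begin

definition Y :: "nat \<Rightarrow> nat pair_pre_digraph \<Rightarrow> real" where
  "Y n T = (real (pair_count n T) - B0 * n) / sqrt n"

lemma ratio_expectation:
  assumes n: "n > 0" and u: "cmod (exp (\<i> * (t / of_real (sqrt n)))) \<le> umax"
  shows "ratio n t = measure_pmf.expectation (random_cayley_tree n) (\<lambda>T. exp (\<i> * t * of_real (Y n T)))"
proof -
  obtain m where m: "n = Suc m" using n gr0_conv_Suc by blast
  let ?L = "labelled_trees n" and ?u = "exp (\<i> * (t / of_real (sqrt n)))" and ?e = "exp (- (sqrt n * (\<i> * B0 * t)))"
  have L: "finite ?L" "?L \<noteq> {}" "card ?L \<noteq> 0"
    using finite_labelled_trees[of n] labelled_trees_nonempty[of n] n by (auto simp: card_eq_0_iff)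
  define c where "c = complex_of_real (2 * pi * real n / fact m * x0 ^ n * exp (- (real n * D0)))"
  have c: "c \<noteq> 0" using x0 n by (simp add: c_def)
  have J: "J n v = c * (\<Sum>T\<in>?L. v ^ pair_count n T)" if "v \<noteq> 0" "cmod v \<le> umax" for v
    using J_eq[OF that, of m] sum_pair_count[OF that(1), of m] unfolding m c_def by simp
  have e: "?u ^ pair_count n T * ?e = exp (\<i> * t * of_real (Y n T))" for T
  proof -
    have "sqrt n = real n / sqrt n" by (simp add: real_div_sqrt)
    then have s: "complex_of_real (sqrt n) = of_nat n / of_real (sqrt n)" by (metis of_real_divide of_real_of_nat_eq)
    have "?u ^ pair_count n T * ?e = exp (of_nat (pair_count n T) * (\<i> * (t / of_real (sqrt n))) + - (of_nat n / of_real (sqrt n) * (\<i> * B0 * t)))"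
      unfolding exp_add exp_of_nat_mult s[symmetric] ..
    also have "of_nat (pair_count n T) * (\<i> * (t / of_real (sqrt n))) + - (of_nat n / of_real (sqrt n) * (\<i> * B0 * t)) = \<i> * t * of_real (Y n T)"
      by (simp add: Y_def diff_divide_distrib algebra_simps)
    finally show ?thesis .
  qed
  have "ratio n t = (\<Sum>T\<in>?L. ?u ^ pair_count n T * ?e) / of_nat (card ?L)"
    unfolding ratio_def using J[OF _ u] J[of 1] c by (simp add: sum_distrib_right)
  also have "\<dots> = (\<Sum>T\<in>?L. exp (\<i> * t * of_real (Y n T))) / of_nat (card ?L)" unfolding e ..
  also have "\<dots> = measure_pmf.expectation (random_cayley_tree n) (\<lambda>T. exp (\<i> * t * of_real (Y n T)))"
    unfolding random_cayley_tree_def using L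
    by (subst integral_measure_pmf[OF L(1)]) (simp_all add: scaleR_conv_of_real sum_divide_distrib)
  finally show ?thesis .
qed

lemma transform_limit:
  "(\<lambda>n. measure_pmf.expectation (random_cayley_tree n) (\<lambda>T. exp (\<i> * t * of_real (Y n T)))) \<longlonglongrightarrow> \<Phi> t / \<Phi> 0"
proof (rule Lim_transform_eventually[OF ratio_limit])
  have "(\<lambda>n. cmod (exp (\<i> * (t / of_real (sqrt n))))) \<longlonglongrightarrow> cmod (exp (\<i> * 0))"
    by (intro tendsto_norm tendsto_exp tendsto_mult tendsto_const over_sqrt_limit)
  then have "\<forall>\<^sub>F n in sequentially. cmod (exp (\<i> * (t / of_real (sqrt n)))) < umax"
    by (rule order_tendstoD) simp
  then show "\<forall>\<^sub>F n in sequentially. ratio n t = measure_pmf.expectation (random_cayley_tree n) (\<lambda>T. exp (\<i> * t * of_real (Y n T)))"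
    using eventually_gt_at_top[of 0] by eventually_elim (intro ratio_expectation, auto)
qed

text \<open>Half the centred domination number. As \<open>paired_domination_number\<close> is
  between \<open>2 k\<close> and \<open>2 k + 2\<close>, it differs from \<open>Y\<close> by at most
  \<open>1 / sqrt n\<close>.\<close>

definition Z :: "nat \<Rightarrow> nat pair_pre_digraph \<Rightarrow> real" where
  "Z n T = (real (paired_domination_number (with_proj T)) - 2 * B0 * n) / (2 * sqrt n)"

lemma set_random_cayley_tree: "n > 0 \<Longrightarrow> set_pmf (random_cayley_tree n) = labelled_trees n"
  unfolding random_cayley_tree_def using finite_labelled_trees[of n] labelled_trees_nonempty[of n] by simp

sublocale gaussian_transforms random_cayley_tree Y Z V
proof
  show "V > 0" by (rule V_pos)
  show fin: "\<forall>\<^sub>F n in sequentially. finite (set_pmf (random_cayley_tree n))"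
    using eventually_gt_at_top[of 0] by eventually_elim (simp add: set_random_cayley_tree finite_labelled_trees)
  show "(\<lambda>n. measure_pmf.expectation (random_cayley_tree n) (\<lambda>x. iexp (t * Y n x))) \<longlonglongrightarrow> of_real (exp (- (V * t\<^sup>2)))" for t
    using transform_limit[of "of_real t"] \<Phi>_real[of t] \<Phi>_0 by (simp add: mult.assoc)
  have B: "Bseq (\<lambda>n. measure_pmf.expectation (random_cayley_tree n) (\<lambda>T. exp (s * Y n T)))" for s :: real
  proof -
    \<comment> \<open>At the imaginary point \<open>t = - i s\<close> the transform is the
      exponential moment of \<open>Y\<close> at the real number \<open>s\<close>; a convergent
      sequence is bounded.\<close>
    have "(\<lambda>n. measure_pmf.expectation (random_cayley_tree n) (\<lambda>T. exp (\<i> * (- (\<i> * s)) * of_real (Y n T)))) \<longlonglongrightarrow> \<Phi> (- (\<i> * s)) / \<Phi> 0"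
      by (rule transform_limit)
    moreover have "exp (\<i> * (- (\<i> * s)) * of_real (Y n T)) = complex_of_real (exp (s * Y n T))" for n T
      by (simp add: exp_of_real[symmetric])
    ultimately have "(\<lambda>n. complex_of_real (measure_pmf.expectation (random_cayley_tree n) (\<lambda>T. exp (s * Y n T)))) \<longlonglongrightarrow> \<Phi> (- (\<i> * s)) / \<Phi> 0"
      by (simp only: integral_complex_of_real)
    then have "Bseq (\<lambda>n. complex_of_real (measure_pmf.expectation (random_cayley_tree n) (\<lambda>T. exp (s * Y n T))))"
      by (intro convergent_imp_Bseq convergentI)
    then show ?thesis by (simp add: Bseq_def)
  qed
  obtain C1 C2 where C: "\<And>n. \<bar>measure_pmf.expectation (random_cayley_tree n) (\<lambda>T. exp (1 * Y n T))\<bar> \<le> C1"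
      "\<And>n. \<bar>measure_pmf.expectation (random_cayley_tree n) (\<lambda>T. exp ((-1) * Y n T))\<bar> \<le> C2"
    using B[of 1] B[of "-1"] unfolding Bseq_def real_norm_def by blast
  have "\<forall>\<^sub>F n in sequentially. norm (measure_pmf.expectation (random_cayley_tree n) (\<lambda>x. exp (Y n x) + exp (- Y n x))) \<le> C1 + C2"
    using fin
  proof eventually_elim
    case (elim n)
    then have "measure_pmf.expectation (random_cayley_tree n) (\<lambda>x. exp (Y n x) + exp (- Y n x)) =
       measure_pmf.expectation (random_cayley_tree n) (\<lambda>T. exp (1 * Y n T)) + measure_pmf.expectation (random_cayley_tree n) (\<lambda>T. exp ((-1) * Y n T))"
      by (subst Bochner_Integration.integral_add) (simp_all add: integrable_measure_pmf_finite)
    then show ?case using C(1)[of n] C(2)[of n] by simp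
  qed
  then show "Bseq (\<lambda>n. measure_pmf.expectation (random_cayley_tree n) (\<lambda>x. exp (Y n x) + exp (- Y n x)))"
    by (rule BfunI)
  show "\<forall>\<^sub>F n in sequentially. \<forall>T\<in>set_pmf (random_cayley_tree n). \<bar>Z n T - Y n T\<bar> \<le> 1 / sqrt n"
    using eventually_ge_at_top[of 2]
  proof eventually_elim
    case (elim n)
    show ?case
    proof
      fix T assume "T \<in> set_pmf (random_cayley_tree n)"
      then have T: "T \<in> labelled_trees n" using elim set_random_cayley_tree[of n] by simp
      let ?g = "paired_domination_number (with_proj T)" and ?k = "pair_count n T"
      have g: "2 * ?k \<le> ?g" "?g \<le> 2 * ?k + 2"
        using paired_domination_number_bounds[OF elim T] by (simp_all add: pair_count_def)
      have "Z n T - Y n T = ((real ?g - 2 * real ?k) / 2) / sqrt n"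
        using elim by (simp add: Z_def Y_def field_simps)
      moreover have "\<bar>(real ?g - 2 * real ?k) / 2\<bar> \<le> 1" using g by simp
      ultimately show "\<bar>Z n T - Y n T\<bar> \<le> 1 / sqrt n"
        using divide_right_mono[of "\<bar>(real ?g - 2 * real ?k) / 2\<bar>" 1 "sqrt n"] by (simp add: abs_divide)
    qed
  qed
qed

end

theorem mainTheorem3:
  shows "\<exists>\<mu> \<sigma> :: real. 0.5177 \<le> \<mu> \<and> \<mu> < 0.5178 \<and> \<sigma> > 0 \<and>
    (\<lambda>n. measure_pmf.expectation (random_cayley_tree n)
            (\<lambda>T. real (paired_domination_number (with_proj T))) - \<mu> * real n)
      \<in> o(\<lambda>n. sqrt (real n)) \<and>
    weak_conv_m
      (\<lambda>n. distr (measure_pmf (random_cayley_tree n)) borel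
            (\<lambda>T. (real (paired_domination_number (with_proj T)) - \<mu> * real n) / (\<sigma> * sqrt (real n))))
      std_normal_distribution"
proof -
  obtain x where x: "0 < x" "x < xmax" "Ffun (of_real x) 1 = 1"
    "25885 / 100000 \<le> Re (Bfun (of_real x) 1)" "Re (Bfun (of_real x) 1) < 2589 / 10000"
    by (rule critical_point)
  interpret critical x using x by unfold_locales
  \<comment> \<open>Both factors 2 arise because each pair contributes two vertices;
    \<open>sqrt (2 * V)\<close> is the limiting standard deviation of \<open>Y\<close>.\<close>
  let ?\<mu> = "2 * B0" and ?\<sigma> = "2 * sqrt (2 * V)" and ?\<gamma> = "\<lambda>T. real (paired_domination_number (with_proj T))"
  have mean: "(\<lambda>n. measure_pmf.expectation (random_cayley_tree n) ?\<gamma> - ?\<mu> * real n) \<in> o(\<lambda>n. sqrt (real n))"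
  proof (rule smalloI_tendsto)
    have "(\<lambda>n. 2 * measure_pmf.expectation (random_cayley_tree n) (Z n)) \<longlonglongrightarrow> 0"
      using mean_Z by (rule tendsto_mult_right_zero)
    moreover have "\<forall>\<^sub>F n in sequentially. 2 * measure_pmf.expectation (random_cayley_tree n) (Z n)
        = (measure_pmf.expectation (random_cayley_tree n) ?\<gamma> - ?\<mu> * real n) / sqrt (real n)"
      using fin
    proof eventually_elim
      case (elim n)
      have half: "2 * (a / (2 * s)) = a / s" for a s :: real by simp
      have "measure_pmf.expectation (random_cayley_tree n) (Z n)
          = measure_pmf.expectation (random_cayley_tree n) (\<lambda>T. ?\<gamma> T - ?\<mu> * real n) / (2 * sqrt n)"
        unfolding Z_def by (rule integral_divide_zero)
      also have "measure_pmf.expectation (random_cayley_tree n) (\<lambda>T. ?\<gamma> T - ?\<mu> * real n)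
          = measure_pmf.expectation (random_cayley_tree n) ?\<gamma> - ?\<mu> * real n"
        by (subst Bochner_Integration.integral_diff) (simp_all add: elim integrable_measure_pmf_finite)
      finally show ?case by (simp only: half)
    qed
    ultimately show "(\<lambda>n. (measure_pmf.expectation (random_cayley_tree n) ?\<gamma> - ?\<mu> * real n) / sqrt (real n)) \<longlonglongrightarrow> 0"
      by (rule Lim_transform_eventually)
    show "\<forall>\<^sub>F n in sequentially. sqrt (real n) \<noteq> 0"
      using eventually_gt_at_top[of 0] by eventually_elim simp
  qed
  have "Z n T / sqrt (2 * V) = (?\<gamma> T - ?\<mu> * real n) / (?\<sigma> * sqrt (real n))" for n T
    by (simp add: Z_def mult_ac)
  then have "weak_conv_m (\<lambda>n. distr (measure_pmf (random_cayley_tree n)) borel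
      (\<lambda>T. (?\<gamma> T - ?\<mu> * real n) / (?\<sigma> * sqrt (real n)))) std_normal_distribution"
    using weak_limit by simp
  moreover have "0.5177 \<le> ?\<mu>" "?\<mu> < 0.5178" using x(4,5) unfolding B0_def by simp_all
  moreover have "?\<sigma> > 0" using V by simp
  ultimately show ?thesis using mean by (intro exI conjI)
qed

end
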